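(* Let $\varphi$ be a growth function on $\mathbb{R}^n\times[0,\infty)$, $R\in(0,\infty)$, and let $\psi_0\in\mathcal{D}(\mathbb{R}^n)$ satisfy $\int_{\mathbb{R}^n}\psi_0(x)\,dx\ne0$. Let $A_1:=\max\{A_0,\,nq(\varphi)/i(\varphi)\}$, $B_1:=B_0/i(\varphi)$ and $N_0:=\lfloor 2A_1\rfloor+1$, where $A_0$ and $B_0$ are the constants described in the context. Then for any $A\in(A_1,\infty)$, $B\in(B_1,\infty)$ and integer $N\ge N_0$, there exists a positive constant $C$, depending only on $A,B,N,R,\psi_0,\varphi$ and $n$, such that, for all $f\in\mathcal{S}'(\mathbb{R}^n)$, $$\left\|\psi^{**}_{0,A,B}(f)\right\|_{L^\varphi(\mathbb{R}^n)}\le C\left\|\psi_0^+(f)\right\|_{L^\varphi(\mathbb{R}^n)}$$ and $$\left\|f^*\right\|_{L^\varphi(\mathbb{R}^n)}\le C\left\|\psi_0^+(f)\right\|_{L^\varphi(\mathbb{R}^n)}.$$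
   Context: Growth functions. An Orlicz function is a nondecreasing $\Phi:[0,\infty)\to[0,\infty)$ with $\Phi(0)=0$, $\Phi(t)>0$ for $t>0$ and $\lim_{t\to\infty}\Phi(t)=\infty$. A function $\varphi:\mathbb{R}^n\times[0,\infty)\to[0,\infty)$ is of uniformly upper (resp. lower) type $p$ if there is $C>0$ such that $\varphi(x,st)\le Cs^p\varphi(x,t)$ for all $x\in\mathbb{R}^n$, $t\in[0,\infty)$ and $s\in[1,\infty)$ (resp. $s\in[0,1]$). $\varphi\in\mathbb{A}_q(\mathbb{R}^n)$, $q\in[1,\infty)$, means that $\int_K\sup_{t\in(0,\infty)}\{\varphi(x,t)[\int_K\varphi(y,t)\,dy]^{-1}\}\,dx<\infty$ for all compact $K$, and that, when $q>1$ with $1/q+1/q'=1$, $\sup_{t\in(0,\infty)}\sup_B|B|^{-q}\int_B\varphi(x,t)\,dx\{\int_B[\varphi(y,t)]^{-q'/q}\,dy\}^{q/q'}<\infty$, or, when $q=1$, $\sup_{t\in(0,\infty)}\sup_B|B|^{-1}\int_B\varphi(x,t)\,dx\ \operatorname{ess\,sup}_{y\in B}[\varphi(y,t)]^{-1}<\infty$, with $B$ ranging over all balls. $\mathbb{A}_\infty(\mathbb{R}^n):=\bigcup_{q\in[1,\infty)}\mathbb{A}_q(\mathbb{R}^n)$. A growth function is a $\varphi$ such that: $\varphi(x,\cdot)$ is an Orlicz function for all $x$ and $\varphi(\cdot,t)$ is measurable for all $t$; $\varphi\in\mathbb{A}_\infty(\mathbb{R}^n)$; $\varphi$ is of uniformly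 lower type $p$ for some $p\in(0,1]$ and of uniformly upper type $1$. Set $q(\varphi):=\inf\{q\in[1,\infty):\varphi\in\mathbb{A}_q(\mathbb{R}^n)\}$, $i(\varphi):=\sup\{p\in(0,\infty):\varphi\text{ is of uniformly lower type }p\}$ and $m(\varphi):=\lfloor n[q(\varphi)/i(\varphi)-1]\rfloor$. $\|f\|_{L^\varphi(\mathbb{R}^n)}:=\inf\{\lambda\in(0,\infty):\int_{\mathbb{R}^n}\varphi(x,|f(x)|/\lambda)\,dx\le1\}$. Maximal functions. $\mathcal{D}(\mathbb{R}^n)$ is the space of $C^\infty$ functions with compact support, $\mathcal{S}(\mathbb{R}^n)$ the Schwartz space, $\mathcal{S}'(\mathbb{R}^n)$ its dual. For $j\in\mathbb{Z}$, $(\psi_0)_j(x):=2^{jn}\psi_0(2^jx)$; for $t\in(0,\infty)$, $\psi_t(x):=t^{-n}\psi(x/t)$. For $j\in\mathbb{Z}$, $A,B\in[0,\infty)$, $y\in\mathbb{R}^n$, $m_{j,A,B}(y):=(1+2^j|y|)^A2^{B|y|}$. Define $$\psi_0^+(f)(x):=\sup_{j\in\mathbb{Z}}|(\psi_0)_j*f(x)|,\qquad \psi^{**}_{0,A,B}(f)(x):=\sup_{j\in\mathbb{Z},\,y\in\mathbb{R}^n}\frac{|(\psi_0)_j*f(x-y)|}{m_{j,A,B}(y)}.$$ For $m\in\mathbb{Z}_+:=\{0,1,2,\dots\}$, $\mathcal{S}_m(\mathbb{R}^n):=\{\psi\in\mathcal{S}(\mathbb{R}^n):\sup_{x\in\mathbb{R}^n}\sup_{\beta\in\mathbb{Z}_+^n,|\beta|\le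 m+1}(1+|x|)^{(m+2)(n+1)}|\partial_x^\beta\psi(x)|\le1\}$, $f^*_m(x):=\sup_{\psi\in\mathcal{S}_m(\mathbb{R}^n)}\sup_{|y-x|<t,\,t\in(0,\infty)}|f*\psi_t(y)|$, and $f^*:=f^*_{m(\varphi)}$. The constants $A_0,B_0$. Let $M$ be the Hardy-Littlewood maximal operator and, for $B\in[0,\infty)$ and locally integrable $h$, $K_Bh(x):=\int_{\mathbb{R}^n}|h(y)|2^{-B|x-y|}\,dy$. $A_0$ is a positive constant, depending only on the support of $\psi_0$, with the following property: for every $r\in(0,\infty)$, $A\in(\max\{A_0,n/r\},\infty)$ and $B\in[0,\infty)$ there is a constant $C>0$, depending only on $n,r,\psi_0,A,B$, such that for all $f\in\mathcal{S}'(\mathbb{R}^n)$, $j\in\mathbb{Z}$ and $x\in\mathbb{R}^n$, $$\left[\sup_{y\in\mathbb{R}^n}\frac{|(\psi_0)_j*f(x-y)|}{m_{j,A,B}(y)}\right]^r\le C\sum_{k=j}^\infty2^{(j-k)(Ar-n)}\left\{M(|(\psi_0)_k*f|^r)(x)+K_{Br}(|(\psi_0)_k*f|^r)(x)\right\}.$$ $B_0=B_0(\varphi,n)$ is a positive constant with the following property: whenever $p\in(1,\infty)$, $q\in(1,\infty]$ and $\varphi\in\mathbb{A}_p(\mathbb{R}^n)$, there is $C>0$ such that for all $t\in(0,\infty)$, $B\ge B_0/p$ and all sequences $\{f^j\}_j$ with $\|\{f^j\}_j\|_{L^p_{\varphi(\cdot,t)}(\ell^q,\mathbb{R}^n)}<\infty$,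 $$\|\{K_B(f^j)\}_j\|_{L^p_{\varphi(\cdot,t)}(\ell^q,\mathbb{R}^n)}\le C\|\{f^j\}_j\|_{L^p_{\varphi(\cdot,t)}(\ell^q,\mathbb{R}^n)},$$ where $\|\{f^j\}_j\|_{L^p_{\varphi(\cdot,t)}(\ell^q,\mathbb{R}^n)}:=\{\int_{\mathbb{R}^n}[\sum_j|f^j(x)|^q]^{p/q}\varphi(x,t)\,dx\}^{1/p}$ (with $\sup_j$ in place of the $\ell^q$ sum if $q=\infty$). Such constants $A_0$ and $B_0$ exist and are fixed. *)

theory Defs
  imports "HOL-Probability.Essential_Supremum"
begin

section \<open>Powers of extended nonnegative reals\<close>

text \<open>Only used for exponents \<open>r > 0\<close>; negative powers are written as positive powers of
  \<open>inverse\<close>, which on \<^typ>\<open>ennreal\<close> sends \<open>0\<close> to \<open>\<infinity>\<close> and \<open>\<infinity>\<close> to \<open>0\<close>.\<close>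

definition ennreal_powr :: "ennreal \<Rightarrow> real \<Rightarrow> ennreal"  (infixr "ennpow" 80) where
  "a ennpow r = (if a = top then top else ennreal (enn2real a powr r))"


section \<open>Growth functions\<close>

text \<open>A function \<open>\<real>\<^sup>n \<times> [0,\<infinity>) \<rightarrow> [0,\<infinity>)\<close> is represented by \<open>\<phi> :: real^'n \<Rightarrow> real \<Rightarrow> real\<close>, of which only
  the values \<open>\<phi> x t\<close> with \<open>t \<ge> 0\<close> are ever used. ``Measurable'' means Lebesgue measurable.\<close>

definition orlicz_function :: "(real \<Rightarrow> real) \<Rightarrow> bool" where
  "orlicz_function \<Phi> \<longleftrightarrow>
     mono_on {0..} \<Phi> \<and> \<Phi> 0 = 0 \<and> (\<forall>t>0. \<Phi> t > 0) \<and> filterlim \<Phi> at_top at_top"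

definition uniformly_upper_type :: "(real^'n \<Rightarrow> real \<Rightarrow> real) \<Rightarrow> real \<Rightarrow> bool" where
  "uniformly_upper_type \<phi> p \<longleftrightarrow>
     (\<exists>C>0. \<forall>x. \<forall>t\<ge>0. \<forall>s\<ge>1. \<phi> x (s * t) \<le> C * s powr p * \<phi> x t)"

definition uniformly_lower_type :: "(real^'n \<Rightarrow> real \<Rightarrow> real) \<Rightarrow> real \<Rightarrow> bool" where
  "uniformly_lower_type \<phi> p \<longleftrightarrow>
     (\<exists>C>0. \<forall>x. \<forall>t\<ge>0. \<forall>s\<in>{0..1}. \<phi> x (s * t) \<le> C * s powr p * \<phi> x t)"

definition muckenhoupt :: "(real^'n \<Rightarrow> real \<Rightarrow> real) \<Rightarrow> real \<Rightarrow> bool" where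
  "muckenhoupt \<phi> q \<longleftrightarrow>
     (\<forall>K. compact K \<longrightarrow>
        (\<integral>\<^sup>+x\<in>K. (SUP t\<in>{0<..}. ennreal (\<phi> x t) *
                      inverse (\<integral>\<^sup>+y\<in>K. ennreal (\<phi> y t) \<partial>lebesgue)) \<partial>lebesgue) < top) \<and>
     (if q = 1 then
        (SUP t\<in>{0<..}. SUP c. SUP r\<in>{0<..}.
           inverse (emeasure lebesgue (ball c r)) *
           (\<integral>\<^sup>+x\<in>ball c r. ennreal (\<phi> x t) \<partial>lebesgue) *
           esssup (lebesgue_on (ball c r)) (\<lambda>y. inverse (ennreal (\<phi> y t)))) < top
      else
        (let q' = q / (q - 1) in
         (SUP t\<in>{0<..}. SUP c. SUP r\<in>{0<..}.
           (inverse (emeasure lebesgue (ball c r)) ennpow q) *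
           (\<integral>\<^sup>+x\<in>ball c r. ennreal (\<phi> x t) \<partial>lebesgue) *
           ((\<integral>\<^sup>+y\<in>ball c r. (inverse (ennreal (\<phi> y t)) ennpow (q' / q)) \<partial>lebesgue)
              ennpow (q / q'))) < top))"

definition muckenhoupt_infinity :: "(real^'n \<Rightarrow> real \<Rightarrow> real) \<Rightarrow> bool" where
  "muckenhoupt_infinity \<phi> \<longleftrightarrow> (\<exists>q\<ge>1. muckenhoupt \<phi> q)"

definition growth_function :: "(real^'n \<Rightarrow> real \<Rightarrow> real) \<Rightarrow> bool" where
  "growth_function \<phi> \<longleftrightarrow>
     (\<forall>x. orlicz_function (\<phi> x)) \<and>
     (\<forall>t\<ge>0. (\<lambda>x. \<phi> x t) \<in> borel_measurable lebesgue) \<and>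
     muckenhoupt_infinity \<phi> \<and>
     (\<exists>p. 0 < p \<and> p \<le> 1 \<and> uniformly_lower_type \<phi> p) \<and>
     uniformly_upper_type \<phi> 1"

definition critical_weight_index :: "(real^'n \<Rightarrow> real \<Rightarrow> real) \<Rightarrow> real" where
  "critical_weight_index \<phi> = Inf {q. 1 \<le> q \<and> muckenhoupt \<phi> q}"

definition critical_lower_type_index :: "(real^'n \<Rightarrow> real \<Rightarrow> real) \<Rightarrow> real" where
  "critical_lower_type_index \<phi> = Sup {p. 0 < p \<and> uniformly_lower_type \<phi> p}"

text \<open>For a growth function the argument of the floor is nonnegative, because
  \<open>i(\<phi>) \<le> 1 \<le> q(\<phi>)\<close>, so that the conversion to \<^typ>\<open>nat\<close> loses nothing.\<close>

definition critical_order :: "(real^'n \<Rightarrow> real \<Rightarrow> real) \<Rightarrow> nat" where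
  "critical_order \<phi> =
     nat \<lfloor>real CARD('n) * (critical_weight_index \<phi> / critical_lower_type_index \<phi> - 1)\<rfloor>"

text \<open>Maximal functions may take the value \<open>\<infinity>\<close>, hence the quasi-norm is defined on
  \<^typ>\<open>ennreal\<close>-valued functions, with \<open>\<phi>(x,\<infinity>) = lim\<^sub>t \<phi>(x,t) = \<infinity>\<close>.
  If no \<open>\<mu>\<close> is admissible, the infimum is \<open>\<infinity>\<close>.\<close>

definition orlicz_ext :: "(real \<Rightarrow> real) \<Rightarrow> ennreal \<Rightarrow> ennreal" where
  "orlicz_ext \<Phi> a = (if a = top then top else ennreal (\<Phi> (enn2real a)))"

definition musielak_orlicz_norm ::
    "(real^'n \<Rightarrow> real \<Rightarrow> real) \<Rightarrow> (real^'n \<Rightarrow> ennreal) \<Rightarrow> ennreal" where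
  "musielak_orlicz_norm \<phi> g =
     Inf {ennreal \<mu> | \<mu>. 0 < \<mu> \<and> (\<integral>\<^sup>+x. orlicz_ext (\<phi> x) (g x / ennreal \<mu>) \<partial>lebesgue) \<le> 1}"


section \<open>Test functions, Schwartz functions, tempered distributions\<close>

definition partial_deriv :: "'n \<Rightarrow> (real^'n \<Rightarrow> complex) \<Rightarrow> real^'n \<Rightarrow> complex" where
  "partial_deriv i u x = frechet_derivative u (at x) (axis i 1)"

text \<open>A multi-index \<open>\<beta>\<close> with \<open>|\<beta>| = k\<close> is encoded by a list of \<open>k\<close> coordinates in which \<open>i\<close> occurs
  \<open>\<beta>\<^sub>i\<close> times. For smooth functions the order of the list is immaterial, so quantifying over all
  lists of a given length amounts to quantifying over all multi-indices of that order.\<close>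

definition partial_derivs :: "'n list \<Rightarrow> (real^'n \<Rightarrow> complex) \<Rightarrow> real^'n \<Rightarrow> complex" where
  "partial_derivs \<beta> u = foldr partial_deriv \<beta> u"

definition smooth :: "(real^'n \<Rightarrow> complex) \<Rightarrow> bool" where
  "smooth u \<longleftrightarrow> (\<forall>\<beta>. partial_derivs \<beta> u differentiable_on UNIV)"

definition supp :: "(real^'n \<Rightarrow> complex) \<Rightarrow> (real^'n) set" where
  "supp u = closure {x. u x \<noteq> 0}"

definition test_functions :: "(real^'n \<Rightarrow> complex) set" where
  "test_functions = {u. smooth u \<and> compact (supp u)}"

definition schwartz_seminorm :: "nat \<Rightarrow> nat \<Rightarrow> (real^'n \<Rightarrow> complex) \<Rightarrow> ennreal" where
  "schwartz_seminorm k l u =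
     (SUP x. SUP \<beta>\<in>{\<beta>. length \<beta> \<le> l}. ennreal ((1 + norm x) ^ k * cmod (partial_derivs \<beta> u x)))"

definition schwartz :: "(real^'n \<Rightarrow> complex) set" where
  "schwartz = {u. smooth u \<and> (\<forall>k l. schwartz_seminorm k l u < top)}"

definition schwartz_topology :: "(real^'n \<Rightarrow> complex) topology" where
  "schwartz_topology = topology_generated_by
     {{v \<in> schwartz. schwartz_seminorm k l (\<lambda>x. v x - u x) < \<epsilon>} | u k l \<epsilon>. u \<in> schwartz \<and> 0 < \<epsilon>}"

text \<open>Only the values on \<^const>\<open>schwartz\<close> matter.\<close>

definition tempered_distributions :: "((real^'n \<Rightarrow> complex) \<Rightarrow> complex) set" where
  "tempered_distributions =
     {f. (\<forall>u\<in>schwartz. \<forall>v\<in>schwartz. \<forall>a b. f (\<lambda>x. a * u x + b * v x) = a * f u + b * f v) \<and>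
         continuous_map schwartz_topology euclidean f}"

definition dist_conv ::
    "(real^'n \<Rightarrow> complex) \<Rightarrow> ((real^'n \<Rightarrow> complex) \<Rightarrow> complex) \<Rightarrow> real^'n \<Rightarrow> complex" where
  "dist_conv u f x = f (\<lambda>y. u (x - y))"

definition dyadic_dilation :: "(real^'n \<Rightarrow> complex) \<Rightarrow> int \<Rightarrow> real^'n \<Rightarrow> complex" where
  "dyadic_dilation u j x = of_real (2 powi (j * int CARD('n))) * u ((2 powi j) *\<^sub>R x)"

definition dilation :: "(real^'n \<Rightarrow> complex) \<Rightarrow> real \<Rightarrow> real^'n \<Rightarrow> complex" where
  "dilation u t x = of_real (inverse (t ^ CARD('n))) * u (x /\<^sub>R t)"


section \<open>Maximal functions\<close>

definition peetre_weight :: "int \<Rightarrow> real \<Rightarrow> real \<Rightarrow> real^'n \<Rightarrow> real" where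
  "peetre_weight j A B y = (1 + 2 powi j * norm y) powr A * 2 powr (B * norm y)"

definition radial_maximal ::
    "(real^'n \<Rightarrow> complex) \<Rightarrow> ((real^'n \<Rightarrow> complex) \<Rightarrow> complex) \<Rightarrow> real^'n \<Rightarrow> ennreal" where
  "radial_maximal \<psi>\<^sub>0 f x = (SUP j. ennreal (cmod (dist_conv (dyadic_dilation \<psi>\<^sub>0 j) f x)))"

definition peetre_maximal_at ::
    "(real^'n \<Rightarrow> complex) \<Rightarrow> int \<Rightarrow> real \<Rightarrow> real \<Rightarrow> ((real^'n \<Rightarrow> complex) \<Rightarrow> complex) \<Rightarrow>
     real^'n \<Rightarrow> ennreal" where
  "peetre_maximal_at \<psi>\<^sub>0 j A B f x =
     (SUP y. ennreal (cmod (dist_conv (dyadic_dilation \<psi>\<^sub>0 j) f (x - y)) / peetre_weight j A B y))"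

definition peetre_maximal ::
    "(real^'n \<Rightarrow> complex) \<Rightarrow> real \<Rightarrow> real \<Rightarrow> ((real^'n \<Rightarrow> complex) \<Rightarrow> complex) \<Rightarrow>
     real^'n \<Rightarrow> ennreal" where
  "peetre_maximal \<psi>\<^sub>0 A B f x = (SUP j. peetre_maximal_at \<psi>\<^sub>0 j A B f x)"

definition schwartz_class :: "nat \<Rightarrow> (real^'n \<Rightarrow> complex) set" where
  "schwartz_class m =
     {\<psi> \<in> schwartz. schwartz_seminorm ((m + 2) * (CARD('n) + 1)) (m + 1) \<psi> \<le> 1}"

definition grand_maximal_of_order ::
    "nat \<Rightarrow> ((real^'n \<Rightarrow> complex) \<Rightarrow> complex) \<Rightarrow> real^'n \<Rightarrow> ennreal" where
  "grand_maximal_of_order m f x =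
     (SUP \<psi>\<in>schwartz_class m. SUP (y, t)\<in>{(y, t). 0 < t \<and> norm (y - x) < t}.
        ennreal (cmod (dist_conv (dilation \<psi> t) f y)))"

definition grand_maximal ::
    "(real^'n \<Rightarrow> real \<Rightarrow> real) \<Rightarrow> ((real^'n \<Rightarrow> complex) \<Rightarrow> complex) \<Rightarrow> real^'n \<Rightarrow> ennreal" where
  "grand_maximal \<phi> f = grand_maximal_of_order (critical_order \<phi>) f"

text \<open>The uncentred Hardy--Littlewood maximal operator: all balls containing \<open>x\<close> are admitted.\<close>

definition hl_maximal :: "(real^'n \<Rightarrow> 'b::real_normed_vector) \<Rightarrow> real^'n \<Rightarrow> ennreal" where
  "hl_maximal h x =
     (SUP (c, r)\<in>{(c, r). x \<in> ball c r}.
        (\<integral>\<^sup>+y\<in>ball c r. ennreal (norm (h y)) \<partial>lebesgue) / emeasure lebesgue (ball c r))"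

definition exp_convolution ::
    "real \<Rightarrow> (real^'n \<Rightarrow> 'b::real_normed_vector) \<Rightarrow> real^'n \<Rightarrow> ennreal" where
  "exp_convolution B h x =
     (\<integral>\<^sup>+y. ennreal (norm (h y) * 2 powr (- B * norm (x - y))) \<partial>lebesgue)"

definition mixed_norm ::
    "real \<Rightarrow> ennreal \<Rightarrow> (real^'n \<Rightarrow> real) \<Rightarrow> (int \<Rightarrow> real^'n \<Rightarrow> ennreal) \<Rightarrow> ennreal" where
  "mixed_norm p q w g =
     (\<integral>\<^sup>+x. (if q = top then (SUP j. g j x) ennpow p
            else (\<Sum>\<^sub>\<infinity>j. g j x ennpow enn2real q) ennpow (p / enn2real q)) * ennreal (w x) \<partial>lebesgue)
       ennpow (1 / p)"


section \<open>The constants \<open>A\<^sub>0\<close> and \<open>B\<^sub>0\<close>\<close>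

text \<open>The constant depends on \<open>\<psi>\<^sub>0\<close> only through its support, so it is characterised in terms of a
  set \<open>S\<close>, and has to serve all \<open>\<psi>\<^sub>0\<close> that are supported exactly on \<open>S\<close>.\<close>

definition admissible_A0 :: "(real^'n) set \<Rightarrow> real \<Rightarrow> bool" where
  "admissible_A0 S A\<^sub>0 \<longleftrightarrow> 0 < A\<^sub>0 \<and>
     (\<forall>\<psi>\<^sub>0\<in>test_functions. supp \<psi>\<^sub>0 = S \<and> (LINT x|lebesgue. \<psi>\<^sub>0 x) \<noteq> 0 \<longrightarrow>
       (\<forall>r>0. \<forall>A > max A\<^sub>0 (real CARD('n) / r). \<forall>B\<ge>0. \<exists>C>0.
          \<forall>f\<in>tempered_distributions. \<forall>j x.
            peetre_maximal_at \<psi>\<^sub>0 j A B f x ennpow r \<le>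
            ennreal C *
            (\<Sum>\<^sub>\<infinity>k\<in>{j..}. ennreal (2 powr (of_int (j - k) * (A * r - real CARD('n)))) *
               (hl_maximal (\<lambda>y. cmod (dist_conv (dyadic_dilation \<psi>\<^sub>0 k) f y) powr r) x +
                exp_convolution (B * r)
                  (\<lambda>y. cmod (dist_conv (dyadic_dilation \<psi>\<^sub>0 k) f y) powr r) x))))"

definition admissible_B0 :: "(real^'n \<Rightarrow> real \<Rightarrow> real) \<Rightarrow> real \<Rightarrow> bool" where
  "admissible_B0 \<phi> B\<^sub>0 \<longleftrightarrow> 0 < B\<^sub>0 \<and>
     (\<forall>p q. 1 < p \<and> 1 < q \<and> muckenhoupt \<phi> p \<longrightarrow>
       (\<exists>C>0. \<forall>t>0. \<forall>B \<ge> B\<^sub>0 / p. \<forall>h :: int \<Rightarrow> real^'n \<Rightarrow> complex.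
          (\<forall>j. h j \<in> borel_measurable lebesgue) \<and>
          mixed_norm p q (\<lambda>x. \<phi> x t) (\<lambda>j x. ennreal (cmod (h j x))) < top \<longrightarrow>
          mixed_norm p q (\<lambda>x. \<phi> x t) (\<lambda>j. exp_convolution B (h j)) \<le>
          ennreal C * mixed_norm p q (\<lambda>x. \<phi> x t) (\<lambda>j x. ennreal (cmod (h j x)))))"

end

theory Submission
  imports Defs
begin

text \<open>
  Write \<open>g\<close> for the radial maximal function of \<open>f\<close>, \<open>n\<close> for the dimension, \<open>m = m(\<phi>)\<close>, and \<open>M\<close> for the
  uncentred maximal operator, here \<open>maxop\<close>. Both target functions \<open>T\<close> satisfy one pointwise estimate
  \<open>T(x)\<^sup>r \<le> C M(M(g\<^sup>r))(x)\<close>, and the rest is a norm inequality for \<open>M\<close>. The exponent \<open>r\<close> has to meet three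
  demands: \<open>n / r \<le> A\<close> for the Peetre maximal function, \<open>n / r - n < m + 1\<close> for the grand maximal
  function, and \<open>q < p / r\<close> for some \<open>A\<^sub>q\<close> class and some lower type \<open>p\<close> of \<open>\<phi>\<close> for the norm
  inequality. The threshold for \<open>A\<close> and the definition of \<open>m(\<phi>)\<close> as a floor leave exactly enough room
  (\<open>exponent_choice\<close>).

  Norm inequality (\<open>musielak_norm_maxop\<close>). The Muckenhoupt condition gives a weighted bound for averages
  over balls, and the Vitali covering lemma turns it into a weak type \<open>(q,q)\<close> inequality for \<open>M\<close> whose
  constant is the same for all weights \<open>\<phi>(\<cdot>,t)\<close> (\<open>maxop_weak_type\<close>). Applied on the level
  \<open>{M h > 2\<^sup>k}\<close> with the weight \<open>\<phi>(\<cdot>,2\<^sup>k\<^sup>/\<^sup>r)\<close> and summed over \<open>k\<close>, it yields a modular inequality, because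
  the lower type \<open>p / r > q\<close> makes the sum over the levels below \<open>h(x)\<close> geometric
  (\<open>dyadic_modular_maxop\<close>).

  Control of one convolution. The inequality that defines \<open>A\<^sub>0\<close> is used only at scale \<open>j = 0\<close>, where the
  factor \<open>2\<^sup>|\<^sup>y\<^sup>|\<close> is harmless and the exponential kernel is dominated by \<open>M\<close>: it says that
  \<open>|\<psi>\<^sub>0 * f(z)|\<^sup>r \<le> c M(g\<^sup>r)(w)\<close> for \<open>|z - w| \<le> 1\<close>. Applied to dyadic dilates of \<open>f\<close> it becomes the same
  bound, with the same constant, for \<open>(\<psi>\<^sub>0)\<^sub>j * f\<close> and \<open>|z - w| < 2\<^sup>-\<^sup>j\<close> (\<open>nontangential_bound\<close>). Averaging
  over the ball of radius \<open>2\<^sup>-\<^sup>j\<close> costs a factor \<open>(1 + 2\<^sup>j|y|)\<^sup>n\<close> and a second maximal operator; this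
  is the estimate for the Peetre maximal function.

  Grand maximal function. Let \<open>\<theta> = \<psi>\<^sub>0 / \<integral>\<psi>\<^sub>0\<close> and \<open>D\<^sub>j u = u - \<theta>\<^sub>j * u\<close>. Each \<open>D\<^sub>j\<close> gains a factor \<open>2\<^sup>-\<^sup>j\<close> at
  the price of one derivative, and all these operators commute. With \<open>L = m + 2\<close>, telescoping
  \<open>D\<^sub>j\<^sup>L - D\<^sub>j\<^sub>+\<^sub>1\<^sup>L\<close> writes a test function as a series of functions \<open>\<theta>\<^sub>j * v\<close> with \<open>v\<close> of size
  \<open>2\<^sup>-\<^sup>j\<^sup>(\<^sup>m\<^sup>+\<^sup>1\<^sup>)\<close> and decay of order \<open>(m + 2)(n + 1)\<close> (\<open>reproducing_estimate\<close>).
  Pairing \<open>\<theta>\<^sub>j * v\<close> with \<open>f\<close> gives \<open>\<integral>v(z) (\<theta>\<^sub>j * f)(y - z) dz\<close>, which is at most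
  \<open>2\<^sup>j\<^sup>(\<^sup>n\<^sup>/\<^sup>r\<^sup>-\<^sup>n\<^sup>)\<close> times the size of \<open>v\<close> times \<open>M(M(g\<^sup>r))(x)\<^sup>1\<^sup>/\<^sup>r\<close> (\<open>convolution_pairing_bound\<close>). The series
  converges because \<open>n / r - n < m + 1\<close>.
\<close>

section \<open>Averages over balls against Muckenhoupt weights\<close>

lemma ennpow_ennreal: "0 \<le> a \<Longrightarrow> ennreal a ennpow r = ennreal (a powr r)"
  by (simp add: ennreal_powr_def)

lemma ennpow_top: "top ennpow r = top"
  by (simp add: ennreal_powr_def)

lemma ennpow_0: "0 ennpow r = 0"
  by (simp add: ennreal_powr_def)

lemma ennpow_one: "a ennpow 1 = a"
  by (cases a) (auto simp: ennreal_powr_def)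

lemma ennpow_mono: "a \<le> b \<Longrightarrow> 0 \<le> r \<Longrightarrow> a ennpow r \<le> b ennpow r"
  by (cases a; cases b) (auto simp: ennreal_powr_def powr_mono2 top_unique intro!: ennreal_leI)

lemma ennpow_measurable [measurable]: "(\<lambda>a. a ennpow r) \<in> borel_measurable borel"
  unfolding ennreal_powr_def by measurable

lemma ennpow_pos: "0 < a \<Longrightarrow> 0 < a ennpow r"
  by (cases a) (auto simp: ennreal_powr_def)

lemma emeasure_lebesgue_ball:
  "0 < r \<Longrightarrow> emeasure lebesgue (ball c r :: (real^'n) set) =
     ennreal (unit_ball_vol (real CARD('n)) * r ^ CARD('n))"
  using emeasure_ball[of r c] by simp

text \<open>The only consequence of the Muckenhoupt condition that is used later. The hypothesis on
  \<open>\<tau>\<close> says that \<open>h\<close> has average at least \<open>\<tau>\<close>; a level \<open>\<tau>\<close> in place of the average itself avoids powers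
  of an average that may be infinite.\<close>
definition ball_average_bound :: "real \<Rightarrow> real \<Rightarrow> (real^'n \<Rightarrow> ennreal) \<Rightarrow> bool" where
  "ball_average_bound C q w \<longleftrightarrow> (\<forall>c. \<forall>r>0. \<forall>h\<in>borel_measurable lebesgue. \<forall>\<tau>>0.
     ennreal \<tau> * emeasure lebesgue (ball c r) \<le> (\<integral>\<^sup>+y\<in>ball c r. h y \<partial>lebesgue) \<longrightarrow>
     ennreal (\<tau> powr q) * (\<integral>\<^sup>+y\<in>ball c r. w y \<partial>lebesgue) \<le>
     ennreal C * (\<integral>\<^sup>+y\<in>ball c r. h y ennpow q * w y \<partial>lebesgue))"

text \<open>For \<open>q > 1\<close> the usual proof applies Hoelder's inequality to \<open>h \<phi>\<^sup>1\<^sup>/\<^sup>q\<close> and \<open>\<phi>\<^sup>-\<^sup>1\<^sup>/\<^sup>q\<close>. The pointwise inequality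
  \<open>h \<le> \<sigma>\<^sup>1\<^sup>-\<^sup>q h\<^sup>q \<phi> + \<sigma> \<phi>\<^sup>-\<^sup>1\<^sup>/\<^sup>(\<^sup>q\<^sup>-\<^sup>1\<^sup>)\<close>, valid for every \<open>\<sigma> > 0\<close>, serves the same purpose: either \<open>h\<close> is at most the
  second summand, or \<open>h\<^sup>q\<^sup>-\<^sup>1 \<phi> \<ge> \<sigma>\<^sup>q\<^sup>-\<^sup>1\<close>. For \<open>q = 1\<close> one only needs \<open>\<phi>\<^sup>-\<^sup>1 \<le> ess sup \<phi>\<^sup>-\<^sup>1\<close> almost everywhere.\<close>
lemma muckenhoupt_ball_average:
  fixes \<phi> :: "real^'n \<Rightarrow> real \<Rightarrow> real"
  assumes q: "1 \<le> q" and A: "muckenhoupt \<phi> q"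
    and pos: "\<And>x t. 0 < t \<Longrightarrow> 0 < \<phi> x t"
    and meas: "\<And>t. 0 < t \<Longrightarrow> (\<lambda>x. \<phi> x t) \<in> borel_measurable lebesgue"
  shows "\<exists>C>0. \<forall>t>0. ball_average_bound C q (\<lambda>x. ennreal (\<phi> x t))"
proof -
  define v where "v r = unit_ball_vol (real CARD('n)) * r ^ CARD('n)" for r :: real
  have v: "0 < v r" "emeasure lebesgue (ball c r :: (real^'n) set) = ennreal (v r)" if "0 < r" for c r
    using emeasure_lebesgue_ball[OF that] that unfolding v_def by (auto simp: unit_ball_vol_pos)
  define W where "W t c r = (\<integral>\<^sup>+y\<in>ball c r. ennreal (\<phi> y t) \<partial>lebesgue)" for t c r
  have ballm [measurable]: "ball c r \<in> sets lebesgue" for c :: "real^'n" and r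
    by simp
  have pos_int: "0 < (\<integral>\<^sup>+y\<in>ball c r. g y \<partial>lebesgue)"
    if "0 < r" "\<And>y. 0 < g y" and [measurable]: "g \<in> borel_measurable lebesgue"
    for c r and g :: "real^'n \<Rightarrow> ennreal"
  proof (rule ccontr)
    assume "\<not> ?thesis"
    then have "(\<integral>\<^sup>+y\<in>ball c r. g y \<partial>lebesgue) = 0" by simp
    then have "AE y in lebesgue. g y * indicator (ball c r) y = 0"
      by (subst (asm) nn_integral_0_iff_AE) auto
    then have "AE y in lebesgue. y \<notin> ball c r"
      by eventually_elim (metis that(2) indicator_simps(1) less_irrefl mult.right_neutral)
    then have "emeasure lebesgue (ball c r) = 0"
      by (subst (asm) AE_iff_measurable[of "ball c r"]) auto
    then show False using v[OF that(1)] by simp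
  qed
  have Wpos: "0 < W t c r" if "0 < t" "0 < r" for t c r
    unfolding W_def using that pos meas by (intro pos_int) auto
  show ?thesis
  proof (cases "q = 1")
    case True
    define F where "F t c r = inverse (emeasure lebesgue (ball c r)) * W t c r *
         esssup (lebesgue_on (ball c r)) (\<lambda>y. inverse (ennreal (\<phi> y t)))" for t c r
    have "(SUP t\<in>{0<..}. SUP c. SUP r\<in>{0<..}. F t c r) < top"
      using A True unfolding muckenhoupt_def F_def W_def by simp
    then obtain S where S: "0 \<le> S" "(SUP t\<in>{0<..}. SUP c. SUP r\<in>{0<..}. F t c r) = ennreal S"
      by (metis ennreal_cases less_irrefl)
    have FS: "F t c r \<le> ennreal S" if "0 < t" "0 < r" for t c r
      unfolding S(2)[symmetric] using that
      by (intro SUP_upper2[of t] SUP_upper2[of c] SUP_upper2[of r]) auto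
    show ?thesis
      unfolding ball_average_bound_def
    proof (intro exI[of _ "S + 1"] conjI allI impI ballI)
      fix t r \<tau> :: real and c and h :: "real^'n \<Rightarrow> ennreal"
      assume t: "0 < t" and r: "0 < r" and h [measurable]: "h \<in> borel_measurable lebesgue" and \<tau>: "0 < \<tau>"
        and le: "ennreal \<tau> * emeasure lebesgue (ball c r) \<le> (\<integral>\<^sup>+y\<in>ball c r. h y \<partial>lebesgue)"
      note [measurable] = meas[OF t]
      define E where "E = esssup (lebesgue_on (ball c r)) (\<lambda>y. inverse (ennreal (\<phi> y t)))"
      define X where "X = (\<integral>\<^sup>+y\<in>ball c r. h y * ennreal (\<phi> y t) \<partial>lebesgue)"
      have F: "ennreal (inverse (v r)) * W t c r * E \<le> ennreal S"
        using FS[OF t r, of c] v[OF r] unfolding F_def E_def by (simp add: inverse_ennreal)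
      have AE: "AE y in lebesgue. y \<in> ball c r \<longrightarrow> inverse (ennreal (\<phi> y t)) \<le> E"
        using esssup_AE[of "\<lambda>y. inverse (ennreal (\<phi> y t))" "lebesgue_on (ball c r)"]
        unfolding E_def by (subst (asm) AE_restrict_space_iff) auto
      have "(\<integral>\<^sup>+y\<in>ball c r. h y \<partial>lebesgue) \<le> (\<integral>\<^sup>+y. E * (h y * ennreal (\<phi> y t) * indicator (ball c r) y) \<partial>lebesgue)"
      proof (rule nn_integral_mono_AE)
        show "AE y in lebesgue. h y * indicator (ball c r) y \<le> E * (h y * ennreal (\<phi> y t) * indicator (ball c r) y)"
          using AE
        proof eventually_elim
          case (elim y)
          have one: "inverse (ennreal (\<phi> y t)) * ennreal (\<phi> y t) = 1"
            using pos[OF t, of y] by (simp add: inverse_ennreal flip: ennreal_mult)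
          have "h y = h y * (inverse (ennreal (\<phi> y t)) * ennreal (\<phi> y t))" by (simp add: one)
          also have "\<dots> \<le> E * (h y * ennreal (\<phi> y t))" if "y \<in> ball c r"
            using mult_right_mono[OF elim[rule_format, OF that], of "h y * ennreal (\<phi> y t)"]
            by (simp add: ac_simps)
          finally show ?case by (auto simp: indicator_def)
        qed
      qed
      also have "\<dots> = E * X" unfolding X_def by (rule nn_integral_cmult) simp
      finally have "ennreal \<tau> * ennreal (v r) \<le> E * X" using le v[OF r] by simp
      then have "ennreal (inverse (v r)) * W t c r * (ennreal \<tau> * ennreal (v r)) \<le> ennreal (inverse (v r)) * W t c r * (E * X)"
        by (rule mult_left_mono) simp
      moreover have "ennreal (inverse (v r)) * W t c r * (ennreal \<tau> * ennreal (v r)) = ennreal \<tau> * W t c r"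
      proof -
        have "ennreal (inverse (v r)) * ennreal (v r) = 1"
          using v(1)[OF r] by (simp flip: ennreal_mult)
        then show ?thesis by (metis mult.assoc mult.commute mult.right_neutral)
      qed
      moreover have "ennreal (inverse (v r)) * W t c r * (E * X) \<le> ennreal (S + 1) * X"
        using mult_right_mono[OF order_trans[OF F, of "ennreal (S+1)"], of X] S(1) by (simp add: ac_simps ennreal_leI)
      ultimately show "ennreal (\<tau> powr q) * (\<integral>\<^sup>+y\<in>ball c r. ennreal (\<phi> y t) \<partial>lebesgue) \<le>
           ennreal (S + 1) * (\<integral>\<^sup>+y\<in>ball c r. h y ennpow q * ennreal (\<phi> y t) \<partial>lebesgue)"
        unfolding True X_def W_def[symmetric] ennpow_one using \<tau> by simp
    qed (use S in simp)
  next
    case False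
    with q have q1: "1 < q" by simp
    have exps: "(q / (q - 1)) / q = 1 / (q - 1)" "q / (q / (q - 1)) = q - 1" using q1 by auto
    define Y where "Y t c r = (\<integral>\<^sup>+y\<in>ball c r. (inverse (ennreal (\<phi> y t)) ennpow (1 / (q - 1))) \<partial>lebesgue)" for t c r
    define F where "F t c r = (inverse (emeasure lebesgue (ball c r)) ennpow q) * W t c r *
         (Y t c r ennpow (q - 1))" for t c r
    have "(SUP t\<in>{0<..}. SUP c. SUP r\<in>{0<..}. F t c r) < top"
      using A False unfolding muckenhoupt_def F_def W_def Y_def Let_def exps by simp
    then obtain S where S: "0 \<le> S" "(SUP t\<in>{0<..}. SUP c. SUP r\<in>{0<..}. F t c r) = ennreal S"
      by (metis ennreal_cases less_irrefl)
    have FS: "F t c r \<le> ennreal S" if "0 < t" "0 < r" for t c r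
      unfolding S(2)[symmetric] using that
      by (intro SUP_upper2[of t] SUP_upper2[of c] SUP_upper2[of r]) auto
    have Ypos: "0 < Y t c r" if "0 < t" "0 < r" for t c r
    proof -
      note [measurable] = meas[OF that(1)]
      show ?thesis unfolding Y_def 
        by (intro pos_int ennpow_pos that) (auto simp: ennreal_inverse_positive less_top)
    qed
    show ?thesis
      unfolding ball_average_bound_def
    proof (intro exI[of _ "2 powr q * S + 1"] conjI allI impI ballI)
      fix t r \<tau> :: real and c and h :: "real^'n \<Rightarrow> ennreal"
      assume t: "0 < t" and r: "0 < r" and h [measurable]: "h \<in> borel_measurable lebesgue" and \<tau>: "0 < \<tau>"
        and le: "ennreal \<tau> * emeasure lebesgue (ball c r) \<le> (\<integral>\<^sup>+y\<in>ball c r. h y \<partial>lebesgue)"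
      note [measurable] = meas[OF t]
      define X where "X = (\<integral>\<^sup>+y\<in>ball c r. h y ennpow q * ennreal (\<phi> y t) \<partial>lebesgue)"
      have F: "ennreal (inverse (v r) powr q) * W t c r * (Y t c r ennpow (q - 1)) \<le> ennreal S"
        using FS[OF t r, of c] v[OF r] unfolding F_def by (simp add: inverse_ennreal ennpow_ennreal)
      have vq: "0 < inverse (v r) powr q" using v(1)[OF r] by simp
      \<comment> \<open>Since \<open>\<infinity> \<cdot> a = \<infinity>\<close> for \<open>a > 0\<close>, the finite product forces both integrals to be finite.\<close>
      have "W t c r \<noteq> top"
        using F ennpow_pos[OF Ypos[OF t r], of c "q-1"] vq
        by (auto simp: ennreal_mult_top ennreal_top_mult top_unique split: if_splits)
      then obtain W' where W': "0 < W'" "W t c r = ennreal W'"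
        using Wpos[OF t r, of c] by (cases "W t c r") auto
      have "Y t c r \<noteq> top"
        using F Wpos[OF t r, of c] vq
        by (auto simp: ennpow_top ennreal_mult_top top_unique split: if_splits)
      then obtain Y' where Y': "0 < Y'" "Y t c r = ennreal Y'"
        using Ypos[OF t r, of c] by (cases "Y t c r") auto
      have F': "inverse (v r) powr q * W' * Y' powr (q - 1) \<le> S"
        using F W' Y' S by (simp add: ennpow_ennreal flip: ennreal_mult)
      show "ennreal (\<tau> powr q) * (\<integral>\<^sup>+y\<in>ball c r. ennreal (\<phi> y t) \<partial>lebesgue) \<le>
           ennreal (2 powr q * S + 1) * (\<integral>\<^sup>+y\<in>ball c r. h y ennpow q * ennreal (\<phi> y t) \<partial>lebesgue)"
      proof (cases "X = top")
        case True
        then show ?thesis using S(1) unfolding X_def by (simp add: ennreal_mult_top add_pos_nonneg)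
      next
        case False
        then obtain X' where X': "0 \<le> X'" "X = ennreal X'" by (cases X) auto
        \<comment> \<open>With this choice the second summand integrates to half of \<open>\<tau> |B|\<close> and can be absorbed.\<close>
        define \<sigma> where "\<sigma> = \<tau> * v r / (2 * Y')"
        have \<sigma>: "0 < \<sigma>" unfolding \<sigma>_def using \<tau> v(1)[OF r] Y' by simp
        have point: "h y \<le> ennreal (\<sigma> powr (1 - q)) * (h y ennpow q * ennreal (\<phi> y t)) +
               ennreal \<sigma> * (inverse (ennreal (\<phi> y t)) ennpow (1 / (q - 1)))" for y
        proof (cases "h y")
          case (real a)
          define w where "w = \<phi> y t"
          have w: "0 < w" unfolding w_def using pos[OF t] .
          have "a \<le> \<sigma> powr (1 - q) * (a powr q * w) + \<sigma> * (inverse w powr (1 / (q - 1)))"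
          proof (cases "a \<le> \<sigma> * (inverse w powr (1 / (q - 1)))")
            case True
            then show ?thesis using w by (smt (verit) mult_nonneg_nonneg powr_ge_zero)
          next
            case False
            have s: "0 < \<sigma> * inverse w powr (1 / (q - 1))" using w \<sigma> by simp
            with False have a: "0 < a" by linarith
            have "\<sigma> powr (q - 1) * inverse w = (\<sigma> * inverse w powr (1 / (q - 1))) powr (q - 1)"
              using \<sigma> w q1 by (simp add: powr_mult powr_powr)
            also have "\<dots> \<le> a powr (q - 1)"
              using False s q1 by (intro powr_mono2) auto
            finally have "\<sigma> powr (1 - q) * w * (\<sigma> powr (q - 1) * inverse w) \<le> \<sigma> powr (1 - q) * w * a powr (q - 1)"
              using w by (intro mult_left_mono) auto
            moreover have "\<sigma> powr (1 - q) * w * (\<sigma> powr (q - 1) * inverse w) = 1"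
            proof -
              have "\<sigma> powr (1 - q) * \<sigma> powr (q - 1) = 1" using \<sigma> by (simp add: powr_add[symmetric])
              then have "(\<sigma> powr (1 - q) * \<sigma> powr (q - 1)) * (w * inverse w) = 1" using w by simp
              then show ?thesis by (simp only: ac_simps)
            qed
            ultimately have "a * 1 \<le> a * (\<sigma> powr (1 - q) * w * a powr (q - 1))"
              using a by (intro mult_left_mono) auto
            also have "\<dots> = \<sigma> powr (1 - q) * (a powr q * w)"
              using a by (simp add: powr_diff)
            finally show ?thesis using s by simp
          qed
          then show ?thesis
            using real w \<sigma> unfolding w_def[symmetric]
            by (simp add: ennpow_ennreal inverse_ennreal ennreal_leI flip: ennreal_mult ennreal_plus)
        next
          case top
          then show ?thesis using \<sigma> pos[OF t, of y] by (simp add: ennpow_top ennreal_mult_top ennreal_top_mult)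
        qed
        have "(\<integral>\<^sup>+y\<in>ball c r. h y \<partial>lebesgue) \<le>
            (\<integral>\<^sup>+y. ennreal (\<sigma> powr (1 - q)) * (h y ennpow q * ennreal (\<phi> y t) * indicator (ball c r) y) +
               ennreal \<sigma> * (inverse (ennreal (\<phi> y t)) ennpow (1 / (q - 1)) * indicator (ball c r) y) \<partial>lebesgue)"
          using point by (intro nn_integral_mono) (auto simp: indicator_def)
        also have "\<dots> = ennreal (\<sigma> powr (1 - q)) * X + ennreal \<sigma> * Y t c r"
          unfolding X_def Y_def
          by (subst nn_integral_add, simp, simp, subst nn_integral_cmult, simp, subst nn_integral_cmult, auto)
        finally have "ennreal (\<tau> * v r) \<le> ennreal (\<sigma> powr (1 - q) * X' + \<sigma> * Y')"
          using le v[OF r] X' Y' \<tau> \<sigma> by (simp add: ennreal_mult)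
        then have "\<tau> * v r \<le> \<sigma> powr (1 - q) * X' + \<sigma> * Y'"
          using X' Y' \<sigma> by (subst (asm) ennreal_le_iff) auto
        moreover have "\<sigma> * Y' = \<tau> * v r / 2" unfolding \<sigma>_def using Y' by simp
        ultimately have *: "\<tau> * v r / 2 \<le> \<sigma> powr (1 - q) * X'" by linarith
        have "(\<tau> * v r / 2) * (\<tau> * v r / 2) powr (q - 1) \<le> \<sigma> powr (1 - q) * X' * (\<tau> * v r / 2) powr (q - 1)"
          using * by (rule mult_right_mono) simp
        also have "\<dots> = Y' powr (q - 1) * X'"
        proof -
          have "\<tau> * v r / 2 = \<sigma> * Y'" unfolding \<sigma>_def using Y' by simp
          then have "(\<tau> * v r / 2) powr (q - 1) = \<sigma> powr (q - 1) * Y' powr (q - 1)"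
            using \<sigma> Y' by (simp add: powr_mult)
          moreover have "\<sigma> powr (1 - q) * \<sigma> powr (q - 1) = 1" using \<sigma> by (simp add: powr_add[symmetric])
          ultimately show ?thesis by (simp add: algebra_simps)
        qed
        finally have "(\<tau> * v r / 2) powr q \<le> Y' powr (q - 1) * X'"
          using powr_mult_base[of "\<tau> * v r / 2" "q - 1"] \<tau> v(1)[OF r] by simp
        moreover have "(\<tau> * v r / 2) powr q = \<tau> powr q * v r powr q / 2 powr q"
          using \<tau> v(1)[OF r] by (simp add: powr_divide powr_mult)
        ultimately have "\<tau> powr q * v r powr q \<le> 2 powr q * (Y' powr (q - 1) * X')"
          by (simp add: field_simps)
        then have "inverse (v r) powr q * W' * (\<tau> powr q * v r powr q) \<le> inverse (v r) powr q * W' * (2 powr q * (Y' powr (q - 1) * X'))"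
          using W' by (intro mult_left_mono) auto
        moreover have "inverse (v r) powr q * v r powr q = 1"
          using v(1)[OF r] by (simp add: powr_mult[symmetric])
        ultimately have "\<tau> powr q * W' \<le> (inverse (v r) powr q * W' * Y' powr (q - 1)) * (2 powr q * X')"
          by (simp add: algebra_simps)
        also have "\<dots> \<le> S * (2 powr q * X')" using F' X' by (intro mult_right_mono) auto
        also have "\<dots> \<le> (2 powr q * S + 1) * X'" using X' by (simp add: algebra_simps)
        finally show ?thesis
          using X' W' S(1) unfolding X_def[symmetric] W_def[symmetric]
          by (simp add: ennreal_leI ennreal_mult''[symmetric] del: ennreal_plus)
      qed
    qed (use S in \<open>simp add: add_nonneg_pos\<close>)
  qed
qed

section \<open>The Hardy--Littlewood maximal operator\<close>

definition maxop :: "(real^'n \<Rightarrow> ennreal) \<Rightarrow> real^'n \<Rightarrow> ennreal" where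
  "maxop h x = (SUP (c, r)\<in>{(c, r). x \<in> ball c r}.
     (\<integral>\<^sup>+y\<in>ball c r. h y \<partial>lebesgue) / emeasure lebesgue (ball c r))"

lemma emeasure_ball_pos_finite:
  assumes "0 < r"
  shows "0 < emeasure lebesgue (ball c r :: (real^'n) set)" "emeasure lebesgue (ball c r :: (real^'n) set) < top"
  unfolding emeasure_lebesgue_ball[OF assms] using assms by (auto simp: unit_ball_vol_pos)

lemma open_sets_lebesgue: "open S \<Longrightarrow> S \<in> sets lebesgue"
  by (auto intro: sets_completionI_sets)

lemma ennreal_mult_div_cancel:
  fixes e a :: ennreal
  assumes "0 < e" "e < top" shows "e * (a / e) = a"
  using assms by (metis ennreal_mult_divide_eq ennreal_times_divide mult.commute order_less_irrefl)

lemma integral_ball_le_maxop: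
  assumes "x \<in> ball c r"
  shows "(\<integral>\<^sup>+y\<in>ball c r. h y \<partial>lebesgue) \<le> emeasure lebesgue (ball c r) * maxop h x"
proof -
  have r: "0 < r" using assms by (metis ball_eq_empty emptyE not_le)
  have "(\<integral>\<^sup>+y\<in>ball c r. h y \<partial>lebesgue) / emeasure lebesgue (ball c r) \<le> maxop h x"
    unfolding maxop_def using assms by (intro SUP_upper2[of "(c, r)"]) auto
  then have "emeasure lebesgue (ball c r) * ((\<integral>\<^sup>+y\<in>ball c r. h y \<partial>lebesgue) / emeasure lebesgue (ball c r))
      \<le> emeasure lebesgue (ball c r) * maxop h x"
    by (rule mult_left_mono) simp
  then show ?thesis
    unfolding ennreal_mult_div_cancel[OF emeasure_ball_pos_finite(1)[OF r, of c] emeasure_ball_pos_finite(2)[OF r, of c]] .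
qed

text \<open>Multiplying out the quotient makes the superlevel sets visibly unions of balls, so that \<open>maxop h\<close> is
  lower semicontinuous, hence measurable, for every \<open>h\<close>.\<close>
lemma less_maxop_iff:
  "a < maxop h x \<longleftrightarrow> (\<exists>c r. x \<in> ball c r \<and> a * emeasure lebesgue (ball c r) < (\<integral>\<^sup>+y\<in>ball c r. h y \<partial>lebesgue))"
proof -
  have "a < X / e \<longleftrightarrow> a * e < X" if "0 < e" "e < top" for e X :: ennreal
    using that by (metis divide_less_ennreal ennreal_mult_div_cancel ennreal_divide_self leD leI le_less_linear
      less_irrefl mult.commute mult_right_mono zero_le divide_right_mono_ennreal ennreal_mult_divide_eq less_le order_le_less)
  moreover have "0 < r" if "x \<in> ball c r" for c r
    using that by (metis ball_eq_empty emptyE not_le)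
  ultimately have *: "a < X / emeasure lebesgue (ball c r) \<longleftrightarrow> a * emeasure lebesgue (ball c r) < X"
    if "x \<in> ball c r" for c r X
    using that emeasure_ball_pos_finite by metis
  have "a < maxop h x \<longleftrightarrow> (\<exists>c r. x \<in> ball c r \<and>
      a < (\<integral>\<^sup>+y\<in>ball c r. h y \<partial>lebesgue) / emeasure lebesgue (ball c r))"
    unfolding maxop_def less_SUP_iff by (simp only: Bex_def split_paired_Ex mem_Collect_eq prod.case)
  then show ?thesis using * by blast
qed

lemma open_maxop_superlevel: "open {x. a < maxop h x}"
proof -
  have "{x. a < maxop h x} = (\<Union>(c, r)\<in>{(c, r). a * emeasure lebesgue (ball c r) < (\<integral>\<^sup>+y\<in>ball c r. h y \<partial>lebesgue)}. ball c r)"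
  proof (intro set_eqI iffI)
    fix x assume "x \<in> {x. a < maxop h x}"
    then obtain c r where "x \<in> ball c r" "a * emeasure lebesgue (ball c r) < (\<integral>\<^sup>+y\<in>ball c r. h y \<partial>lebesgue)"
      unfolding less_maxop_iff by blast
    then show "x \<in> (\<Union>(c, r)\<in>{(c, r). a * emeasure lebesgue (ball c r) < (\<integral>\<^sup>+y\<in>ball c r. h y \<partial>lebesgue)}. ball c r)"
      by (intro UN_I[of "(c, r)"]) simp_all
  next
    fix x assume "x \<in> (\<Union>(c, r)\<in>{(c, r). a * emeasure lebesgue (ball c r) < (\<integral>\<^sup>+y\<in>ball c r. h y \<partial>lebesgue)}. ball c r)"
    then obtain c r where "x \<in> ball c r" "a * emeasure lebesgue (ball c r) < (\<integral>\<^sup>+y\<in>ball c r. h y \<partial>lebesgue)"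
      by force
    then show "x \<in> {x. a < maxop h x}"
      unfolding less_maxop_iff by blast
  qed
  then show ?thesis by auto
qed

lemma maxop_measurable [measurable]: "maxop h \<in> borel_measurable lebesgue"
  by (rule borel_measurableI_greater) (simp add: open_sets_lebesgue open_maxop_superlevel)

lemma maxop_mono: "(\<And>y. h y \<le> g y) \<Longrightarrow> maxop h x \<le> maxop g x"
  unfolding maxop_def by (rule SUP_mono') (auto intro!: divide_right_mono_ennreal nn_integral_mono mult_right_mono)

lemma maxop_cmult:
  assumes "h \<in> borel_measurable lebesgue"
  shows "maxop (\<lambda>y. a * h y) x = a * maxop h x"
proof -
  have [measurable]: "ball c r \<in> sets lebesgue" for c :: "real^'n" and r by simp
  note [measurable] = assms
  have "(\<integral>\<^sup>+y\<in>ball c r. a * h y \<partial>lebesgue) = a * (\<integral>\<^sup>+y\<in>ball c r. h y \<partial>lebesgue)" for c r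
    unfolding mult.assoc by (rule nn_integral_cmult) measurable
  then show ?thesis
    unfolding maxop_def SUP_mult_left_ennreal by (intro SUP_cong) (auto simp: ennreal_times_divide)
qed

lemma ball_average_boundD:
  assumes "ball_average_bound C q w" "0 < r" "h \<in> borel_measurable lebesgue" "0 < \<tau>"
    "ennreal \<tau> * emeasure lebesgue (ball c r) \<le> (\<integral>\<^sup>+y\<in>ball c r. h y \<partial>lebesgue)"
  shows "ennreal (\<tau> powr q) * (\<integral>\<^sup>+y\<in>ball c r. w y \<partial>lebesgue) \<le>
     ennreal C * (\<integral>\<^sup>+y\<in>ball c r. h y ennpow q * w y \<partial>lebesgue)"
  using assms unfolding ball_average_bound_def by blast

text \<open>The indicator function of the inner ball has average \<open>5\<^sup>-\<^sup>n\<close> over the outer one. The factor \<open>5\<close> is the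
  enlargement in the Vitali covering lemma.\<close>
lemma ball_average_bound_doubling:
  fixes w :: "real^'n \<Rightarrow> ennreal"
  assumes "ball_average_bound C q w" "0 < r"
  shows "(\<integral>\<^sup>+y\<in>ball c (5 * r). w y \<partial>lebesgue) \<le>
    ennreal (5 powr (real CARD('n) * q) * C) * (\<integral>\<^sup>+y\<in>ball c r. w y \<partial>lebesgue)"
proof -
  let ?n = "CARD('n)"
  define \<tau> :: real where "\<tau> = inverse (5 ^ ?n)"
  have \<tau>: "0 < \<tau>" unfolding \<tau>_def by simp
  have sub: "indicator (ball c r) y * indicator (ball c (5 * r)) y = (indicator (ball c r) y :: ennreal)" for y
    using assms(2) by (auto simp: indicator_def)
  have "ennreal \<tau> * emeasure lebesgue (ball c (5 * r)) = emeasure lebesgue (ball c r)"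
  proof -
    have r: "0 < 5 * r" using assms(2) by simp
    show ?thesis
      unfolding emeasure_lebesgue_ball[OF assms(2)] emeasure_lebesgue_ball[OF r] \<tau>_def
      using assms(2) by (simp add: power_mult_distrib flip: ennreal_mult)
  qed
  also have "\<dots> = (\<integral>\<^sup>+y\<in>ball c (5 * r). indicator (ball c r) y \<partial>lebesgue)"
    by (simp add: sub)
  finally have "ennreal (\<tau> powr q) * (\<integral>\<^sup>+y\<in>ball c (5 * r). w y \<partial>lebesgue) \<le>
     ennreal C * (\<integral>\<^sup>+y\<in>ball c (5 * r). indicator (ball c r) y ennpow q * w y \<partial>lebesgue)"
    by (intro ball_average_boundD[OF assms(1)] borel_measurable_indicator) (use assms(2) \<tau> in simp_all)
  also have "(\<integral>\<^sup>+y\<in>ball c (5 * r). indicator (ball c r) y ennpow q * w y \<partial>lebesgue) = (\<integral>\<^sup>+y\<in>ball c r. w y \<partial>lebesgue)"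
    using assms(2) by (intro nn_integral_cong) (auto simp: indicator_def ennpow_0 ennreal_powr_def)
  finally have "ennreal (5 powr (real ?n * q)) * (ennreal (\<tau> powr q) * (\<integral>\<^sup>+y\<in>ball c (5 * r). w y \<partial>lebesgue)) \<le>
     ennreal (5 powr (real ?n * q)) * (ennreal C * (\<integral>\<^sup>+y\<in>ball c r. w y \<partial>lebesgue))"
    by (rule mult_left_mono) simp
  moreover have "ennreal (5 powr (real ?n * q)) * ennreal (\<tau> powr q) = 1"
  proof -
    have "\<tau> = 5 powr (- real ?n)" unfolding \<tau>_def by (simp add: powr_minus powr_realpow)
    then show ?thesis by (simp add: powr_powr flip: ennreal_mult powr_add)
  qed
  ultimately show ?thesis
    by (simp add: mult.assoc[symmetric] ennreal_mult')
qed

text \<open>Only the part \<open>g\<close> of \<open>h\<close> above the level \<open>\<tau>\<close> matters: a ball on which \<open>h\<close> has average above \<open>2\<tau>\<close>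
  still gives \<open>g\<close> an average of at least \<open>\<tau>\<close>. This truncation is what makes the sum over dyadic levels
  converge later. The balls of bounded radius are covered by the Vitali lemma, and the bound on the
  radius is removed by monotone convergence.\<close>
lemma maxop_weak_type:
  fixes w h :: "real^'n \<Rightarrow> ennreal"
  assumes A: "ball_average_bound C q w" and C: "0 < C" and \<tau>: "0 < \<tau>"
    and [measurable]: "w \<in> borel_measurable lebesgue" "h \<in> borel_measurable lebesgue"
  shows "ennreal (\<tau> powr q) * (\<integral>\<^sup>+x\<in>{x. ennreal (2 * \<tau>) < maxop h x}. w x \<partial>lebesgue) \<le>
    ennreal (5 powr (real CARD('n) * q) * C * C) * (\<integral>\<^sup>+x\<in>{x. ennreal \<tau> < h x}. h x ennpow q * w x \<partial>lebesgue)"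
proof -
  let ?D = "5 powr (real CARD('n) * q) * C"
  define g where "g x = h x * indicator {x. ennreal \<tau> < h x} x" for x
  have [measurable]: "g \<in> borel_measurable lebesgue" unfolding g_def by measurable
  have ballm [measurable]: "ball c r \<in> sets lebesgue" for c :: "real^'n" and r by simp
  define P where "P = (\<lambda>(c, r). 0 < r \<and> ennreal \<tau> * emeasure lebesgue (ball c r) \<le> (\<integral>\<^sup>+y\<in>ball c r. g y \<partial>lebesgue))"
  define E where "E m = (\<Union>(c, r)\<in>{(c, r). P (c, r) \<and> r \<le> real m}. ball c r)" for m
  have openE: "open (E m)" for m unfolding E_def by auto
  have Em [measurable]: "E m \<in> sets lebesgue" for m using openE[of m] by (rule open_sets_lebesgue)
  have super: "{x. ennreal (2 * \<tau>) < maxop h x} \<subseteq> (\<Union>m. E m)"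
  proof
    fix x assume "x \<in> {x. ennreal (2 * \<tau>) < maxop h x}"
    then obtain c r where x: "x \<in> ball c r"
      and lt: "ennreal (2 * \<tau>) * emeasure lebesgue (ball c r) < (\<integral>\<^sup>+y\<in>ball c r. h y \<partial>lebesgue)"
      unfolding less_maxop_iff by auto
    have r: "0 < r" using x by (metis ball_eq_empty emptyE not_le)
    obtain v where v: "0 < v" "emeasure lebesgue (ball c r) = ennreal v"
      using that[OF _ emeasure_lebesgue_ball[OF r, of c]] r by (simp add: unit_ball_vol_pos)
    have "(\<integral>\<^sup>+y\<in>ball c r. h y \<partial>lebesgue) \<le> (\<integral>\<^sup>+y. g y * indicator (ball c r) y + ennreal \<tau> * indicator (ball c r) y \<partial>lebesgue)"
      by (intro nn_integral_mono) (auto simp: g_def indicator_def)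
    also have "\<dots> = (\<integral>\<^sup>+y\<in>ball c r. g y \<partial>lebesgue) + ennreal \<tau> * ennreal v"
      by (subst nn_integral_add) (auto simp: nn_integral_cmult v)
    finally have "(\<integral>\<^sup>+y\<in>ball c r. h y \<partial>lebesgue) \<le> (\<integral>\<^sup>+y\<in>ball c r. g y \<partial>lebesgue) + ennreal (\<tau> * v)"
      using v \<tau> by (simp add: ennreal_mult)
    moreover have "ennreal (\<tau> * v) + ennreal (\<tau> * v) = ennreal (2 * \<tau>) * emeasure lebesgue (ball c r)"
      unfolding v using v \<tau> by (simp add: ennreal_mult[symmetric] ennreal_plus[symmetric] del: ennreal_plus)
    ultimately have "ennreal (\<tau> * v) + ennreal (\<tau> * v) \<le> (\<integral>\<^sup>+y\<in>ball c r. g y \<partial>lebesgue) + ennreal (\<tau> * v)"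
      using order_trans[OF less_imp_le[OF lt]] by simp
    then have "ennreal (\<tau> * v) \<le> (\<integral>\<^sup>+y\<in>ball c r. g y \<partial>lebesgue)"
      using ennreal_add_left_cancel_le[of "ennreal (\<tau> * v)" "ennreal (\<tau> * v)" "\<integral>\<^sup>+y\<in>ball c r. g y \<partial>lebesgue"]
      by (simp only: add.commute ennreal_neq_top simp_thms) simp
    then have "P (c, r)" unfolding P_def using r v \<tau> by (simp add: ennreal_mult)
    moreover obtain m where "r \<le> real m" using real_arch_simple by blast
    ultimately show "x \<in> (\<Union>m. E m)" unfolding E_def using x by blast
  qed
  have local: "ennreal (\<tau> powr q) * (\<integral>\<^sup>+x\<in>E m. w x \<partial>lebesgue) \<le> ennreal (?D * C) * (\<integral>\<^sup>+x. g x ennpow q * w x \<partial>lebesgue)" for m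
  proof -
    obtain D where D: "countable D" "D \<subseteq> {(c, r). P (c, r) \<and> r \<le> real m}"
      and disj: "pairwise (\<lambda>i j. disjnt (ball (fst i) (snd i)) (ball (fst j) (snd j))) D"
      and cov: "E m \<subseteq> (\<Union>i\<in>D. ball (fst i) (5 * snd i))"
      using Vitali_covering_lemma_balls[where S="E m" and K="{(c, r). P (c, r) \<and> r \<le> real m}" and a=fst and r=snd and B="real m"]
      unfolding E_def P_def by (force simp: case_prod_beta)
    have DP: "0 < snd i" "ennreal \<tau> * emeasure lebesgue (ball (fst i) (snd i)) \<le> (\<integral>\<^sup>+y\<in>ball (fst i) (snd i). g y \<partial>lebesgue)"
      if "i \<in> D" for i using that D(2) unfolding P_def by auto
    have "(\<integral>\<^sup>+x\<in>E m. w x \<partial>lebesgue) \<le> (\<integral>\<^sup>+x. \<integral>\<^sup>+i. w x * indicator (ball (fst i) (5 * snd i)) x \<partial>count_space D \<partial>lebesgue)"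
    proof (rule nn_integral_mono)
      fix x
      show "w x * indicator (E m) x \<le> (\<integral>\<^sup>+i. w x * indicator (ball (fst i) (5 * snd i)) x \<partial>count_space D)"
      proof (cases "x \<in> E m")
        case True
        then obtain i where "i \<in> D" "x \<in> ball (fst i) (5 * snd i)" using cov by auto
        then show ?thesis using True nn_integral_ge_point[of i D "\<lambda>i. w x * indicator (ball (fst i) (5 * snd i)) x"] by auto
      qed auto
    qed
    also have "\<dots> = (\<integral>\<^sup>+i. (\<integral>\<^sup>+x\<in>ball (fst i) (5 * snd i). w x \<partial>lebesgue) \<partial>count_space D)"
      by (rule nn_integral_count_space_nn_integral[OF D(1)]) measurable
    finally have "ennreal (\<tau> powr q) * (\<integral>\<^sup>+x\<in>E m. w x \<partial>lebesgue) \<le>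
        ennreal (\<tau> powr q) * (\<integral>\<^sup>+i. (\<integral>\<^sup>+x\<in>ball (fst i) (5 * snd i). w x \<partial>lebesgue) \<partial>count_space D)"
      by (rule mult_left_mono) simp
    also have "\<dots> = (\<integral>\<^sup>+i. ennreal (\<tau> powr q) * (\<integral>\<^sup>+x\<in>ball (fst i) (5 * snd i). w x \<partial>lebesgue) \<partial>count_space D)"
      by (rule nn_integral_cmult[symmetric]) simp
    also have "\<dots> \<le> (\<integral>\<^sup>+i. ennreal (?D * C) * (\<integral>\<^sup>+x\<in>ball (fst i) (snd i). g x ennpow q * w x \<partial>lebesgue) \<partial>count_space D)"
    proof (rule nn_integral_mono)
      fix i assume "i \<in> space (count_space D)"
      then have i: "i \<in> D" by simp
      have "ennreal (\<tau> powr q) * (\<integral>\<^sup>+x\<in>ball (fst i) (5 * snd i). w x \<partial>lebesgue) \<le>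
          ennreal (\<tau> powr q) * (ennreal ?D * (\<integral>\<^sup>+x\<in>ball (fst i) (snd i). w x \<partial>lebesgue))"
        by (intro mult_left_mono ball_average_bound_doubling[OF A] DP i) simp
      also have "\<dots> = ennreal ?D * (ennreal (\<tau> powr q) * (\<integral>\<^sup>+x\<in>ball (fst i) (snd i). w x \<partial>lebesgue))"
        by (simp add: ac_simps)
      also have "\<dots> \<le> ennreal ?D * (ennreal C * (\<integral>\<^sup>+x\<in>ball (fst i) (snd i). g x ennpow q * w x \<partial>lebesgue))"
        by (intro mult_left_mono ball_average_boundD[OF A] DP[OF i] \<tau>) simp_all
      also have "\<dots> = ennreal (?D * C) * (\<integral>\<^sup>+x\<in>ball (fst i) (snd i). g x ennpow q * w x \<partial>lebesgue)"
        using C by (simp add: ennreal_mult mult.assoc)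
      finally show "ennreal (\<tau> powr q) * (\<integral>\<^sup>+x\<in>ball (fst i) (5 * snd i). w x \<partial>lebesgue) \<le> \<dots>" .
    qed
    also have "\<dots> = ennreal (?D * C) * (\<integral>\<^sup>+i. emeasure (density lebesgue (\<lambda>x. g x ennpow q * w x)) (ball (fst i) (snd i)) \<partial>count_space D)"
      by (subst nn_integral_cmult) (auto simp: emeasure_density)
    also have "\<dots> \<le> ennreal (?D * C) * (\<integral>\<^sup>+x. g x ennpow q * w x \<partial>lebesgue)"
    proof (rule mult_left_mono)
      have "(\<integral>\<^sup>+i. emeasure (density lebesgue (\<lambda>x. g x ennpow q * w x)) (ball (fst i) (snd i)) \<partial>count_space D) =
          emeasure (density lebesgue (\<lambda>x. g x ennpow q * w x)) (\<Union>i\<in>D. ball (fst i) (snd i))"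
        using disj D(1) by (intro emeasure_UN_countable[symmetric]) (auto simp: disjoint_family_on_def pairwise_def disjnt_def)
      also have "\<dots> \<le> emeasure (density lebesgue (\<lambda>x. g x ennpow q * w x)) UNIV"
        by (intro emeasure_mono) auto
      also have "\<dots> = (\<integral>\<^sup>+x. g x ennpow q * w x \<partial>lebesgue)"
        by (simp add: emeasure_density)
      finally show "(\<integral>\<^sup>+i. emeasure (density lebesgue (\<lambda>x. g x ennpow q * w x)) (ball (fst i) (snd i)) \<partial>count_space D)
          \<le> (\<integral>\<^sup>+x. g x ennpow q * w x \<partial>lebesgue)" .
    qed simp
    finally show ?thesis .
  qed
  have inc: "incseq E"
    unfolding E_def incseq_def by (intro allI impI UN_mono) auto
  have "(\<integral>\<^sup>+x\<in>{x. ennreal (2 * \<tau>) < maxop h x}. w x \<partial>lebesgue) \<le> emeasure (density lebesgue w) (\<Union>m. E m)"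
  proof -
    have "w x * indicator {x. ennreal (2 * \<tau>) < maxop h x} x \<le> w x * indicator (\<Union>m. E m) x" for x
    proof (cases "x \<in> {x. ennreal (2 * \<tau>) < maxop h x}")
      case True
      then have "x \<in> (\<Union>m. E m)" using super by (rule rev_subsetD)
      then have "indicator (\<Union>m. E m) x = (1::ennreal)" by (rule indicator_simps(1))
      then show ?thesis by (simp only: mult_left_mono indicator_simps(1)[OF True] order_refl)
    next
      case False
      then show ?thesis by (simp only: indicator_simps(2)[OF False] mult_zero_right zero_le)
    qed
    moreover have "(\<Union>m. E m) \<in> sets lebesgue" by measurable
    ultimately show ?thesis
      by (subst emeasure_density) (simp_all only: nn_integral_mono assms)
  qed
  also have "\<dots> = (SUP m. emeasure (density lebesgue w) (E m))"
    using inc by (intro SUP_emeasure_incseq[symmetric]) auto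
  also have "\<dots> = (SUP m. \<integral>\<^sup>+x\<in>E m. w x \<partial>lebesgue)"
    by (intro SUP_cong refl emeasure_density) measurable
  finally have "ennreal (\<tau> powr q) * (\<integral>\<^sup>+x\<in>{x. ennreal (2 * \<tau>) < maxop h x}. w x \<partial>lebesgue) \<le>
     ennreal (\<tau> powr q) * (SUP m. (\<integral>\<^sup>+x\<in>E m. w x \<partial>lebesgue))"
    by (rule mult_left_mono) simp
  also have "\<dots> = (SUP m. ennreal (\<tau> powr q) * (\<integral>\<^sup>+x\<in>E m. w x \<partial>lebesgue))"
    by (rule SUP_mult_left_ennreal)
  also have "\<dots> \<le> ennreal (?D * C) * (\<integral>\<^sup>+x. g x ennpow q * w x \<partial>lebesgue)"
    by (rule SUP_least) (rule local)
  also have "(\<integral>\<^sup>+x. g x ennpow q * w x \<partial>lebesgue) = (\<integral>\<^sup>+x\<in>{x. ennreal \<tau> < h x}. h x ennpow q * w x \<partial>lebesgue)"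
    by (intro nn_integral_cong) (auto simp: g_def indicator_def ennpow_0)
  finally show ?thesis .
qed

section \<open>The modular inequality for dyadic weights\<close>

text \<open>For weights \<open>w k = \<phi>(\<cdot>,2\<^sup>k\<^sup>/\<^sup>r)\<close> this is comparable with \<open>\<phi>(x,h(x)\<^sup>1\<^sup>/\<^sup>r)\<close>, but unlike the latter it is always
  measurable in \<open>x\<close>.\<close>
definition dyadic_sum :: "(int \<Rightarrow> real^'n \<Rightarrow> real) \<Rightarrow> (real^'n \<Rightarrow> ennreal) \<Rightarrow> real^'n \<Rightarrow> ennreal" where
  "dyadic_sum w h x = (\<integral>\<^sup>+k. ennreal (w k x) * indicator {x. ennreal (2 powr real_of_int k) < h x} x \<partial>count_space UNIV)"

text \<open>Enumerating the integers turns the integral over the counting measure into a series.\<close>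
lemma int_sum_measurable:
  fixes f :: "int \<Rightarrow> 'a \<Rightarrow> ennreal"
  assumes [measurable]: "\<And>k. f k \<in> borel_measurable M"
  shows "(\<lambda>x. \<integral>\<^sup>+k. f k x \<partial>count_space UNIV) \<in> borel_measurable M"
proof -
  have "(\<integral>\<^sup>+k. f k x \<partial>count_space UNIV) = (\<Sum>i. f (int_decode i) x)" for x
    using nn_integral_bij_count_space[OF bij_int_decode, of "\<lambda>k. f k x"]
    by (simp add: nn_integral_count_space_nat)
  then show ?thesis by simp
qed

lemma dyadic_sum_measurable:
  assumes [measurable]: "\<And>k. w k \<in> borel_measurable lebesgue" "h \<in> borel_measurable lebesgue"
  shows "dyadic_sum w h \<in> borel_measurable lebesgue"
  unfolding dyadic_sum_def by (rule int_sum_measurable) measurable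

lemma dyadic_bracket:
  fixes a :: real
  assumes "0 < a"
  obtains l :: int where "2 powr real_of_int l < a" "a \<le> 2 powr real_of_int (l + 1)"
proof
  show "2 powr real_of_int (\<lceil>log 2 a\<rceil> - 1) < a"
    using assms by (subst less_log_iff[symmetric]) (auto, linarith)
  show "a \<le> 2 powr real_of_int (\<lceil>log 2 a\<rceil> - 1 + 1)"
    using assms by (subst log_le_iff[symmetric]) auto
qed

lemma geometric_sum_below:
  fixes f :: "int \<Rightarrow> ennreal"
  assumes s: "0 < s" and le: "\<And>k. k \<le> l \<Longrightarrow> f k \<le> a * ennreal (2 powr (- s * real_of_int (l - k)))"
    and zero: "\<And>k. l < k \<Longrightarrow> f k = 0"
  shows "(\<integral>\<^sup>+k. f k \<partial>count_space UNIV) \<le> a * ennreal (1 / (1 - 2 powr - s))"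
proof -
  have b: "bij_betw (\<lambda>i. l - int i) UNIV {..l}"
    by (rule bij_betw_byWitness[where f'="\<lambda>k. nat (l - k)"]) auto
  have "(\<integral>\<^sup>+k. f k \<partial>count_space UNIV) = (\<integral>\<^sup>+k. f k \<partial>count_space {..l})"
    using zero by (intro nn_integral_count_space_eq) (auto simp: not_le)
  also have "\<dots> = (\<Sum>i. f (l - int i))"
    using nn_integral_bij_count_space[OF b, of f] by (simp add: nn_integral_count_space_nat)
  also have "\<dots> \<le> (\<Sum>i. a * ennreal ((2 powr - s) ^ i))"
    using le[of "l - int _"]
    by (intro suminf_le) (auto simp: powr_realpow[symmetric] powr_powr mult.commute)
  also have "\<dots> = a * (\<Sum>i. ennreal ((2 powr - s) ^ i))"
    by simp
  also have "(\<Sum>i. ennreal ((2 powr - s) ^ i)) = ennreal (1 / (1 - 2 powr - s))"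
    using s by (intro suminf_ennreal_eq geometric_sums) (auto simp: powr_less_one)
  finally show ?thesis .
qed

text \<open>The weights are sampled at dyadic levels: \<open>upper\<close> reflects the upper type, and \<open>lower\<close> a lower type that
  exceeds the Muckenhoupt exponent \<open>q\<close>.\<close>
locale dyadic_weights =
  fixes w :: "int \<Rightarrow> real^'n \<Rightarrow> real" and C D p q :: real
  assumes meas [measurable]: "\<And>k. w k \<in> borel_measurable lebesgue"
    and pos: "\<And>k x. 0 < w k x"
    and mono: "\<And>k l x. k \<le> l \<Longrightarrow> w k x \<le> w l x"
    and upper: "\<And>k x. w (k + 1) x \<le> D * w k x"
    and lower: "\<And>k l x. k \<le> l \<Longrightarrow> w k x \<le> D * 2 powr (- p * real_of_int (l - k)) * w l x"
    and C: "0 < C" and q: "0 < q" "q < p"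
    and average: "\<And>k. ball_average_bound C q (\<lambda>x. ennreal (w k x))"
begin

lemma D: "0 < D"
proof -
  have "0 < D * w 0 0" using upper[of 0 0] pos[of 1 0] by simp
  then show ?thesis using pos[of 0 0] by (simp add: zero_less_mult_iff)
qed

text \<open>The weights of index \<open>k \<ge> 0\<close> are bounded below by \<open>w 0 x > 0\<close>: like the modular, the dyadic sum is infinite
  wherever \<open>h\<close> is.\<close>
lemma dyadic_sum_top: "h x = top \<Longrightarrow> dyadic_sum w h x = top"
proof -
  assume h: "h x = top"
  have "(\<integral>\<^sup>+k. ennreal (w 0 x) \<partial>count_space {0::int..}) \<le> dyadic_sum w h x"
    unfolding dyadic_sum_def using h mono[of 0 _ x]
    by (subst nn_integral_count_space_indicator) (auto intro!: nn_integral_mono simp: indicator_def ennreal_leI)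
  moreover have "(\<integral>\<^sup>+k. ennreal (w 0 x) \<partial>count_space {0::int..}) = top"
    using pos[of 0 x] infinite_Ici[of "0::int"] by (simp add: ennreal_mult_eq_top_iff ennreal_mult_top)
  ultimately show ?thesis by (simp add: top_unique)
qed

lemma dyadic_sum_ge: "ennreal (2 powr real_of_int l) < h x \<Longrightarrow> ennreal (w l x) \<le> dyadic_sum w h x"
  unfolding dyadic_sum_def
  using nn_integral_ge_point[of l UNIV "\<lambda>k. ennreal (w k x) * indicator {x. ennreal (2 powr real_of_int k) < h x} x"]
  by simp

text \<open>If \<open>2\<^sup>l < h(x) \<le> 2\<^sup>l\<^sup>+\<^sup>1\<close>, the summand of index \<open>k \<le> l + 1\<close> is at most a constant times \<open>2\<^sup>-\<^sup>(\<^sup>p\<^sup>-\<^sup>q\<^sup>)\<^sup>(\<^sup>l\<^sup>+\<^sup>1\<^sup>-\<^sup>k\<^sup>) w l x\<close>,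
  and all others vanish. The gap \<open>q < p\<close> makes this geometric.\<close>
lemma dyadic_sum_levels:
  shows "(\<integral>\<^sup>+k. ennreal (2 powr (- q * real_of_int (k - 1))) * (indicator {x. ennreal (2 powr real_of_int (k - 1)) < h x} x * (h x ennpow q * ennreal (w k x))) \<partial>count_space UNIV)
     \<le> ennreal (D * D * 2 powr q / (1 - 2 powr - (p - q))) * dyadic_sum w h x"
proof (cases "h x")
  case top
  have "0 < D * D * 2 powr q / (1 - 2 powr - (p - q))"
    using D q by (auto intro!: divide_pos_pos mult_pos_pos simp: powr_less_one)
  then show ?thesis using dyadic_sum_top[of h x, OF top] D q by (simp add: ennreal_mult_top)
next
  case (real a)
  show ?thesis
  proof (cases "a = 0")
    case True
    then show ?thesis using real by (simp add: ennpow_0)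
  next
    case False
    with real have a: "0 < a" by simp
    obtain l where l: "2 powr real_of_int l < a" "a \<le> 2 powr real_of_int (l + 1)"
      using dyadic_bracket[OF a] .
    have wl: "w (l + 1) x \<le> D * w l x" by (rule upper)
    let ?b = "D * 2 powr q * (D * w l x)"
    have "(\<integral>\<^sup>+k. ennreal (2 powr (- q * real_of_int (k - 1))) * (indicator {x. ennreal (2 powr real_of_int (k - 1)) < h x} x * (h x ennpow q * ennreal (w k x))) \<partial>count_space UNIV)
      \<le> ennreal ?b * ennreal (1 / (1 - 2 powr - (p - q)))"
    proof (rule geometric_sum_below[where l="l + 1"])
      show "0 < p - q" using q by simp
    next
      fix k :: int assume k: "k \<le> l + 1"
      have "2 powr (- q * real_of_int (k - 1)) * (a powr q * w k x) \<le>
         2 powr (- q * real_of_int (k - 1)) * ((2 powr real_of_int (l + 1)) powr q * (D * 2 powr (- p * real_of_int (l + 1 - k)) * (D * w l x)))"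
        using a l(2) q wl pos[of k x] D k
        by (intro mult_left_mono mult_mono powr_mono2 order_trans[OF lower[OF k]]) auto
      also have "\<dots> = ?b * (2 powr (- q * real_of_int (k - 1)) * 2 powr (q * real_of_int (l + 1)) * 2 powr (- p * real_of_int (l + 1 - k)) * 2 powr (- q))"
        by (simp add: powr_powr mult_ac powr_minus)
      also have "\<dots> = ?b * 2 powr (- (p - q) * real_of_int (l + 1 - k))"
        by (simp add: powr_add[symmetric] algebra_simps)
      finally have *: "2 powr (- q * real_of_int (k - 1)) * (a powr q * w k x) \<le> ?b * 2 powr (- (p - q) * real_of_int (l + 1 - k))" .
      have "ennreal (2 powr (- q * real_of_int (k - 1))) * (indicator {x. ennreal (2 powr real_of_int (k - 1)) < h x} x * (h x ennpow q * ennreal (w k x)))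
          \<le> ennreal (2 powr (- q * real_of_int (k - 1)) * (a powr q * w k x))"
        using real pos[of k x] by (auto simp: indicator_def ennpow_ennreal ennreal_mult less_imp_le)
      also have "\<dots> \<le> ennreal (?b * 2 powr (- (p - q) * real_of_int (l + 1 - k)))"
        using * by (rule ennreal_leI)
      also have "\<dots> = ennreal ?b * ennreal (2 powr (- (p - q) * real_of_int (l + 1 - k)))"
        by (rule ennreal_mult'') simp
      finally show "ennreal (2 powr (- q * real_of_int (k - 1))) * (indicator {x. ennreal (2 powr real_of_int (k - 1)) < h x} x * (h x ennpow q * ennreal (w k x)))
          \<le> ennreal ?b * ennreal (2 powr (- (p - q) * real_of_int (l + 1 - k)))" .
    next
      fix k :: int assume k: "l + 1 < k"
      have "2 powr real_of_int (l + 1) \<le> 2 powr real_of_int (k - 1)" using k by (intro powr_mono) auto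
      then have "a \<le> 2 powr real_of_int (k - 1)" by (rule order_trans[OF l(2)])
      then have "\<not> ennreal (2 powr real_of_int (k - 1)) < h x"
        unfolding real not_less by (rule ennreal_leI)
      then show "ennreal (2 powr (- q * real_of_int (k - 1))) * (indicator {x. ennreal (2 powr real_of_int (k - 1)) < h x} x * (h x ennpow q * ennreal (w k x))) = 0"
        by simp
    qed
    also have "\<dots> = ennreal (D * D * 2 powr q / (1 - 2 powr - (p - q))) * ennreal (w l x)"
      using D pos[of l x] q by (simp add: ennreal_mult''[symmetric] ennreal_mult'[symmetric] powr_less_one less_imp_le mult_ac)
    also have "\<dots> \<le> ennreal (D * D * 2 powr q / (1 - 2 powr - (p - q))) * dyadic_sum w h x"
      using l(1) real by (intro mult_left_mono dyadic_sum_ge) (auto simp: ennreal_less_iff)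
    finally show ?thesis .
  qed
qed

text \<open>The weak type inequality at level \<open>2\<^sup>k\<close> with the weight \<open>w k\<close>, summed over \<open>k\<close>; after the interchange of
  sum and integral the pointwise bound above applies.\<close>
lemma dyadic_modular_maxop:
  "\<exists>K>0. \<forall>h\<in>borel_measurable lebesgue. 
     (\<integral>\<^sup>+x. dyadic_sum w (maxop h) x \<partial>lebesgue) \<le> ennreal K * (\<integral>\<^sup>+x. dyadic_sum w h x \<partial>lebesgue)"
proof -
  let ?A = "5 powr (real CARD('n) * q) * C * C"
  let ?B = "D * D * 2 powr q / (1 - 2 powr - (p - q))"
  have A: "0 < ?A" using C by simp
  have B: "0 < ?B" using D q by (auto intro!: divide_pos_pos mult_pos_pos simp: powr_less_one)
  show ?thesis
  proof (intro exI[of _ "?A * ?B"] conjI ballI)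
    show "0 < ?A * ?B" by (intro mult_pos_pos A B)
    fix h :: "real^'n \<Rightarrow> ennreal" assume [measurable]: "h \<in> borel_measurable lebesgue"
    let ?f = "\<lambda>k x. ennreal (2 powr (- q * real_of_int (k - 1))) * (indicator {x. ennreal (2 powr real_of_int (k - 1)) < h x} x * (h x ennpow q * ennreal (w k x)))"
    have "(\<integral>\<^sup>+x. dyadic_sum w (maxop h) x \<partial>lebesgue) =
        (\<integral>\<^sup>+k. \<integral>\<^sup>+x. ennreal (w k x) * indicator {x. ennreal (2 powr real_of_int k) < maxop h x} x \<partial>lebesgue \<partial>count_space UNIV)"
      unfolding dyadic_sum_def by (rule nn_integral_count_space_nn_integral) (auto, measurable)
    also have "\<dots> \<le> (\<integral>\<^sup>+k. ennreal ?A * (\<integral>\<^sup>+x. ?f k x \<partial>lebesgue) \<partial>count_space UNIV)"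
    proof (rule nn_integral_mono)
      fix k :: int
      let ?\<tau> = "2 powr real_of_int (k - 1)"
      let ?W = "\<integral>\<^sup>+x\<in>{x. ennreal (2 powr real_of_int k) < maxop h x}. ennreal (w k x) \<partial>lebesgue"
      have tau: "2 * ?\<tau> = 2 powr real_of_int k" by (simp add: powr_diff)
      have "ennreal (?\<tau> powr q) * ?W \<le> ennreal ?A * (\<integral>\<^sup>+x\<in>{x. ennreal ?\<tau> < h x}. h x ennpow q * ennreal (w k x) \<partial>lebesgue)"
        using maxop_weak_type[OF average C, of ?\<tau> k h] unfolding tau by simp
      then have le: "ennreal (2 powr (- q * real_of_int (k - 1))) * (ennreal (?\<tau> powr q) * ?W) \<le>
          ennreal (2 powr (- q * real_of_int (k - 1))) * (ennreal ?A * (\<integral>\<^sup>+x\<in>{x. ennreal ?\<tau> < h x}. h x ennpow q * ennreal (w k x) \<partial>lebesgue))"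
        by (rule mult_left_mono) simp
      have one: "ennreal (2 powr (- q * real_of_int (k - 1))) * ennreal (?\<tau> powr q) = 1"
        by (simp add: ennreal_mult[symmetric] powr_powr powr_add[symmetric] algebra_simps)
      have "?W \<le> ennreal ?A * (ennreal (2 powr (- q * real_of_int (k - 1))) * (\<integral>\<^sup>+x\<in>{x. ennreal ?\<tau> < h x}. h x ennpow q * ennreal (w k x) \<partial>lebesgue))"
        using le unfolding mult.assoc[symmetric] one mult_1 by (simp only: mult.commute[of "ennreal ?A"])
      also have "ennreal (2 powr (- q * real_of_int (k - 1))) * (\<integral>\<^sup>+x\<in>{x. ennreal ?\<tau> < h x}. h x ennpow q * ennreal (w k x) \<partial>lebesgue) = (\<integral>\<^sup>+x. ?f k x \<partial>lebesgue)"
        by (subst nn_integral_cmult[symmetric]) (auto simp: mult_ac)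
      finally show "(\<integral>\<^sup>+x. ennreal (w k x) * indicator {x. ennreal (2 powr real_of_int k) < maxop h x} x \<partial>lebesgue) \<le> ennreal ?A * (\<integral>\<^sup>+x. ?f k x \<partial>lebesgue)" .
    qed
    also have "\<dots> = ennreal ?A * (\<integral>\<^sup>+x. \<integral>\<^sup>+k. ?f k x \<partial>count_space UNIV \<partial>lebesgue)"
      by (subst nn_integral_cmult, simp, subst nn_integral_count_space_nn_integral) (simp, measurable)
    also have "\<dots> \<le> ennreal ?A * (\<integral>\<^sup>+x. ennreal ?B * dyadic_sum w h x \<partial>lebesgue)"
      by (intro mult_left_mono nn_integral_mono dyadic_sum_levels) simp
    also have "(\<integral>\<^sup>+x. ennreal ?B * dyadic_sum w h x \<partial>lebesgue) = ennreal ?B * (\<integral>\<^sup>+x. dyadic_sum w h x \<partial>lebesgue)"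
      by (intro nn_integral_cmult dyadic_sum_measurable) measurable
    finally show "(\<integral>\<^sup>+x. dyadic_sum w (maxop h) x \<partial>lebesgue) \<le> ennreal (?A * ?B) * (\<integral>\<^sup>+x. dyadic_sum w h x \<partial>lebesgue)"
      unfolding ennreal_mult''[OF less_imp_le[OF B], of ?A] mult.assoc[of "ennreal ?A"] .
  qed
qed

end

section \<open>The maximal operator on Musielak--Orlicz spaces\<close>

lemma ennpow_cmult:
  "0 < c \<Longrightarrow> (ennreal c * a) ennpow r = ennreal (c powr r) * a ennpow r"
  by (cases a) (auto simp: ennpow_ennreal ennpow_top ennreal_mult_top powr_mult simp flip: ennreal_mult)

lemma ennreal_divide_eq_mult: "0 < \<mu> \<Longrightarrow> a / ennreal \<mu> = ennreal (1 / \<mu>) * a"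
  by (simp add: divide_ennreal_def inverse_ennreal inverse_eq_divide mult.commute)

lemma dyadic_weights_of_growth:
  fixes \<phi> :: "real^'n \<Rightarrow> real \<Rightarrow> real"
  assumes G: "growth_function \<phi>" and low: "uniformly_lower_type \<phi> p0"
    and q: "1 \<le> q" "muckenhoupt \<phi> q" and r: "0 < r" "q < p0 / r"
  shows "\<exists>C D. dyadic_weights (\<lambda>k x. \<phi> x (2 powr (real_of_int k / r))) C D (p0 / r) q"
proof -
  have orl: "mono_on {0..} (\<phi> x)" "0 < t \<Longrightarrow> 0 < \<phi> x t" for x t
    using G unfolding growth_function_def orlicz_function_def by auto
  have meas: "0 < t \<Longrightarrow> (\<lambda>x. \<phi> x t) \<in> borel_measurable lebesgue" for t
    using G unfolding growth_function_def by auto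
  obtain C where C: "0 < C" and av: "\<And>t. 0 < t \<Longrightarrow> ball_average_bound C q (\<lambda>x. ennreal (\<phi> x t))"
    using muckenhoupt_ball_average[OF q orl(2) meas] by auto
  have "uniformly_upper_type \<phi> 1" using G unfolding growth_function_def by simp
  then obtain Cu where Cu: "0 < Cu" "\<And>x t s. 0 \<le> t \<Longrightarrow> 1 \<le> s \<Longrightarrow> \<phi> x (s * t) \<le> Cu * s powr 1 * \<phi> x t"
    unfolding uniformly_upper_type_def by auto
  obtain Cl where Cl: "0 < Cl" "\<And>x t s. 0 \<le> t \<Longrightarrow> 0 \<le> s \<Longrightarrow> s \<le> 1 \<Longrightarrow> \<phi> x (s * t) \<le> Cl * s powr p0 * \<phi> x t"
    using low unfolding uniformly_lower_type_def by auto
  define D where "D = max (Cu * 2 powr (1 / r)) Cl"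
  have "dyadic_weights (\<lambda>k x. \<phi> x (2 powr (real_of_int k / r))) C D (p0 / r) q"
  proof
    show "\<And>k. (\<lambda>x. \<phi> x (2 powr (real_of_int k / r))) \<in> borel_measurable lebesgue" by (rule meas) simp
    show "\<And>k x. 0 < \<phi> x (2 powr (real_of_int k / r))" by (rule orl) simp
    show "\<phi> x (2 powr (real_of_int k / r)) \<le> \<phi> x (2 powr (real_of_int l / r))" if "k \<le> l" for k l x
      using that r by (intro mono_onD[OF orl(1)]) (auto intro!: powr_mono divide_right_mono)
    show "\<phi> x (2 powr (real_of_int (k + 1) / r)) \<le> D * \<phi> x (2 powr (real_of_int k / r))" for k x
    proof -
      have e: "2 powr (real_of_int (k + 1) / r) = 2 powr (1 / r) * 2 powr (real_of_int k / r)"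
        by (simp add: powr_add[symmetric] add_divide_distrib add.commute)
      have "1 \<le> 2 powr (1 / r)" using r by (intro ge_one_powr_ge_zero) auto
      then have "\<phi> x (2 powr (real_of_int (k + 1) / r)) \<le> Cu * 2 powr (1 / r) * \<phi> x (2 powr (real_of_int k / r))"
        unfolding e using Cu(2)[of "2 powr (real_of_int k / r)" "2 powr (1 / r)" x] by simp
      also have "\<dots> \<le> D * \<phi> x (2 powr (real_of_int k / r))"
        unfolding D_def using orl(2)[of "2 powr (real_of_int k / r)" x] by (intro mult_right_mono) auto
      finally show ?thesis .
    qed
    show "\<phi> x (2 powr (real_of_int k / r)) \<le> D * 2 powr (- (p0 / r) * real_of_int (l - k)) * \<phi> x (2 powr (real_of_int l / r))"
      if kl: "k \<le> l" for k l x
    proof -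
      let ?s = "2 powr (- real_of_int (l - k) / r)"
      have e: "2 powr (real_of_int k / r) = ?s * 2 powr (real_of_int l / r)"
        by (simp add: powr_add[symmetric] add_divide_distrib[symmetric])
      have "2 powr (- real_of_int (l - k) / r) \<le> 2 powr 0" using kl r by (intro powr_mono) (auto simp: divide_le_0_iff)
      then have "?s \<le> 1" by simp
      then have "\<phi> x (2 powr (real_of_int k / r)) \<le> Cl * ?s powr p0 * \<phi> x (2 powr (real_of_int l / r))"
        unfolding e by (intro Cl) auto
      also have "?s powr p0 = 2 powr (- (p0 / r) * real_of_int (l - k))"
        by (simp add: powr_powr algebra_simps diff_divide_distrib)
      also have "Cl * 2 powr (- (p0 / r) * real_of_int (l - k)) * \<phi> x (2 powr (real_of_int l / r)) \<le>
         D * 2 powr (- (p0 / r) * real_of_int (l - k)) * \<phi> x (2 powr (real_of_int l / r))"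
        unfolding D_def using orl(2)[of "2 powr (real_of_int l / r)" x] by (intro mult_right_mono) auto
      finally show ?thesis .
    qed
  qed (use C q r av in auto)
  then show ?thesis by blast
qed

text \<open>If \<open>2\<^sup>l < b\<^sup>r \<le> 2\<^sup>l\<^sup>+\<^sup>1\<close>, then \<open>\<phi>(x,b)\<close> lies between the weights of index \<open>l\<close> and \<open>l + 1\<close>. The lower type bounds the
  dyadic sum by its last term, and the upper type compares consecutive weights.\<close>
lemma orlicz_dyadic:
  fixes \<phi> :: "real^'n \<Rightarrow> real \<Rightarrow> real"
  assumes G: "growth_function \<phi>" and r: "0 < r"
    and W: "dyadic_weights (\<lambda>k x. \<phi> x (2 powr (real_of_int k / r))) C D p q"
  shows "h x = b ennpow r \<Longrightarrow> dyadic_sum (\<lambda>k x. \<phi> x (2 powr (real_of_int k / r))) h x \<le> ennreal (D / (1 - 2 powr - p)) * orlicz_ext (\<phi> x) b" (is "_ \<Longrightarrow> ?A")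
    and "b ennpow r \<le> h x \<Longrightarrow> orlicz_ext (\<phi> x) b \<le> ennreal D * dyadic_sum (\<lambda>k x. \<phi> x (2 powr (real_of_int k / r))) h x" (is "_ \<Longrightarrow> ?B")
proof -
  interpret dyadic_weights "\<lambda>k x. \<phi> x (2 powr (real_of_int k / r))" C D p q by (rule W)
  have orl: "mono_on {0..} (\<phi> x)" "\<phi> x 0 = 0" for x
    using G unfolding growth_function_def orlicz_function_def by auto
  have p: "0 < p" using q by simp
  have K: "0 < D / (1 - 2 powr - p)" using D p by (auto intro!: divide_pos_pos simp: powr_less_one)
  { assume h: "h x = b ennpow r"
    show ?A
    proof (cases b)
      case top
      then show ?thesis using K D p by (simp add: orlicz_ext_def ennreal_mult_top)
    next
      case (real a)
      show ?thesis
      proof (cases "a = 0")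
        case True
        then show ?thesis using real h by (simp add: dyadic_sum_def ennpow_0)
      next
        case False
        with real have a: "0 < a" by simp
        then have "0 < a powr r" by simp
        then obtain l where l: "2 powr real_of_int l < a powr r" "a powr r \<le> 2 powr real_of_int (l + 1)"
          using dyadic_bracket by blast
        have hx: "h x = ennreal (a powr r)" using h real by (simp add: ennpow_ennreal)
        have "2 powr (real_of_int l / r) \<le> a"
        proof -
          have "(2 powr real_of_int l) powr (1 / r) \<le> (a powr r) powr (1 / r)"
            using l r by (intro powr_mono2) auto
          then show ?thesis using a r by (simp add: powr_powr)
        qed
        then have wl: "\<phi> x (2 powr (real_of_int l / r)) \<le> \<phi> x a"
          using a by (intro mono_onD[OF orl(1)]) auto
        have "dyadic_sum (\<lambda>k x. \<phi> x (2 powr (real_of_int k / r))) h x \<le> ennreal (D * \<phi> x a) * ennreal (1 / (1 - 2 powr - p))"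
          unfolding dyadic_sum_def
        proof (rule geometric_sum_below[OF p, where l=l])
          fix k assume k: "k \<le> l"
          have "ennreal (\<phi> x (2 powr (real_of_int k / r))) * indicator {x. ennreal (2 powr real_of_int k) < h x} x
              \<le> ennreal (\<phi> x (2 powr (real_of_int k / r)))" by (auto simp: indicator_def)
          also have "\<dots> \<le> ennreal ((D * 2 powr (- p * real_of_int (l - k))) * \<phi> x a)"
            using lower[OF k, of x] D wl by (intro ennreal_leI order_trans[OF lower[OF k]] mult_left_mono) auto
          also have "\<dots> = ennreal (D * \<phi> x a) * ennreal (2 powr (- p * real_of_int (l - k)))"
            by (subst ennreal_mult''[symmetric]) (auto simp: mult_ac)
          finally show "ennreal (\<phi> x (2 powr (real_of_int k / r))) * indicator {x. ennreal (2 powr real_of_int k) < h x} x \<le> \<dots>" .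
        next
          fix k assume k: "l < k"
          have "2 powr real_of_int (l + 1) \<le> 2 powr real_of_int k" using k by (intro powr_mono) auto
          then have "a powr r \<le> 2 powr real_of_int k" by (rule order_trans[OF l(2)])
          then have "\<not> ennreal (2 powr real_of_int k) < h x"
            unfolding hx not_less by (rule ennreal_leI)
          then show "ennreal (\<phi> x (2 powr (real_of_int k / r))) * indicator {x. ennreal (2 powr real_of_int k) < h x} x = 0"
            by simp
        qed
        also have "\<dots> = ennreal (D / (1 - 2 powr - p)) * orlicz_ext (\<phi> x) b"
          using real p K orl(1)[of x] a mono_onD[OF orl(1), of 0 a x] orl(2)[of x]
          by (simp add: orlicz_ext_def ennreal_mult''[symmetric] powr_less_one less_imp_le mult_ac)
        finally show ?thesis .
      qed
    qed }
  { assume h: "b ennpow r \<le> h x"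
    show ?B
    proof (cases "h x")
      case top
      then show ?thesis using dyadic_sum_top[of h x] D by (simp add: ennreal_mult_top)
    next
      case (real v)
      then obtain a where a: "0 \<le> a" "b = ennreal a" using h by (cases b) (auto simp: ennpow_top top_unique)
      have av: "a powr r \<le> v" using h a real by (simp add: ennpow_ennreal)
      show ?thesis
      proof (cases "a = 0")
        case True
        then show ?thesis using a orl(2) by (simp add: orlicz_ext_def)
      next
        case False
        with a have a0: "0 < a" by simp
        have "0 < a powr r" using a0 by simp
        with av have v: "0 < v" by linarith
        obtain l where l: "2 powr real_of_int l < v" "v \<le> 2 powr real_of_int (l + 1)"
          using dyadic_bracket[OF v] by blast
        have "(a powr r) powr (1 / r) \<le> (2 powr real_of_int (l + 1)) powr (1 / r)"
          using l av r by (intro powr_mono2) auto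
        then have "a \<le> 2 powr (real_of_int (l + 1) / r)" using a0 r by (simp add: powr_powr)
        then have "\<phi> x a \<le> \<phi> x (2 powr (real_of_int (l + 1) / r))"
          using a by (intro mono_onD[OF orl(1)]) auto
        also have "\<dots> \<le> D * \<phi> x (2 powr (real_of_int l / r))" by (rule upper)
        finally have "orlicz_ext (\<phi> x) b \<le> ennreal (D * \<phi> x (2 powr (real_of_int l / r)))"
          using a by (simp add: orlicz_ext_def ennreal_leI)
        also have "\<dots> = ennreal D * ennreal (\<phi> x (2 powr (real_of_int l / r)))"
          using D by (simp add: ennreal_mult')
        also have "\<dots> \<le> ennreal D * dyadic_sum (\<lambda>k x. \<phi> x (2 powr (real_of_int k / r))) h x"
          using l real by (intro mult_left_mono dyadic_sum_ge) (auto simp: ennreal_less_iff)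
        finally show ?thesis .
      qed
    qed }
qed

text \<open>The integrand \<open>\<phi>(x,g(x)/\<mu>)\<close> need not be measurable in \<open>x\<close>, because \<open>\<phi>(x,\<cdot>)\<close> may jump; its integral is then a lower
  integral, for which additivity fails. The measurable dyadic sums stand below it for \<open>g\<close> and
  above it for \<open>T\<close>, and the modular inequality for \<open>maxop\<close>, used twice, connects the two sums.\<close>
lemma musielak_norm_maxop:
  fixes \<phi> :: "real^'n \<Rightarrow> real \<Rightarrow> real"
  assumes G: "growth_function \<phi>" and low: "uniformly_lower_type \<phi> p0" and p0: "0 < p0"
    and q: "1 \<le> q" "muckenhoupt \<phi> q" and r: "0 < r" "q < p0 / r" and C0: "0 < C"
  shows "\<exists>K>0. \<forall>T g. g \<in> borel_measurable lebesgue \<longrightarrow>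
     (\<forall>x. T x ennpow r \<le> ennreal C * maxop (maxop (\<lambda>x. g x ennpow r)) x) \<longrightarrow>
     musielak_orlicz_norm \<phi> T \<le> ennreal K * musielak_orlicz_norm \<phi> g"
proof -
  let ?w = "\<lambda>k x. \<phi> x (2 powr (real_of_int k / r))"
  obtain C' D where W: "dyadic_weights ?w C' D (p0 / r) q"
    using dyadic_weights_of_growth[OF G low q r] by blast
  interpret dyadic_weights ?w C' D "p0 / r" q by (rule W)
  obtain M where M: "0 < M" "\<And>h. h \<in> borel_measurable lebesgue \<Longrightarrow>
     (\<integral>\<^sup>+x. dyadic_sum ?w (maxop h) x \<partial>lebesgue) \<le> ennreal M * (\<integral>\<^sup>+x. dyadic_sum ?w h x \<partial>lebesgue)"
    using dyadic_modular_maxop by blast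
  obtain Cl where Cl: "0 < Cl" "\<And>x t s. 0 \<le> t \<Longrightarrow> 0 \<le> s \<Longrightarrow> s \<le> 1 \<Longrightarrow> \<phi> x (s * t) \<le> Cl * s powr p0 * \<phi> x t"
    using low unfolding uniformly_lower_type_def by auto
  define K1 where "K1 = D / (1 - 2 powr - (p0 / r))"
  have K1: "0 < K1" unfolding K1_def using D p0 r by (auto intro!: divide_pos_pos simp: powr_less_one)
  define L where "L = Cl * D * (M * M * K1)"
  have L: "0 < L" unfolding L_def using Cl D M K1 by simp
  \<comment> \<open>The factor \<open>s1\<close> absorbs the constant of the pointwise hypothesis, the factor \<open>s2\<close> the constant of the
    modular inequality, by means of the lower type.\<close>
  define s1 where "s1 = C powr (- 1 / r)"
  define s2 where "s2 = min 1 (L powr (- 1 / p0))"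
  have s1: "0 < s1" "s1 powr r * C = 1" 
  proof -
    have "(C powr (- 1 / r)) powr r = C powr - 1" using r by (simp only: powr_powr) simp
    then show "s1 powr r * C = 1" unfolding s1_def using C0 by (simp add: powr_minus)
    show "0 < s1" unfolding s1_def using C0 by simp
  qed
  have s2: "0 < s2" "s2 \<le> 1" "s2 powr p0 * L \<le> 1"
  proof -
    show "0 < s2" "s2 \<le> 1" unfolding s2_def using L by auto
    have "s2 powr p0 \<le> (L powr (- 1 / p0)) powr p0"
      unfolding s2_def using L p0 by (intro powr_mono2) auto
    also have "\<dots> = L powr - 1" using p0 by (simp only: powr_powr) simp
    also have "\<dots> = inverse L" using L by (simp add: powr_minus)
    finally show "s2 powr p0 * L \<le> 1" using L by (simp add: field_simps)
  qed
  define K where "K = 1 / (s1 * s2)"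
  have K: "0 < K" unfolding K_def using s1 s2 by simp
  show ?thesis
  proof (intro exI[of _ K] conjI allI impI K)
    fix T g :: "real^'n \<Rightarrow> ennreal"
    assume g [measurable]: "g \<in> borel_measurable lebesgue"
      and T: "\<forall>x. T x ennpow r \<le> ennreal C * maxop (maxop (\<lambda>x. g x ennpow r)) x"
    have main: "musielak_orlicz_norm \<phi> T \<le> ennreal K * ennreal \<mu>"
      if \<mu>: "0 < \<mu>" and adm: "(\<integral>\<^sup>+x. orlicz_ext (\<phi> x) (g x / ennreal \<mu>) \<partial>lebesgue) \<le> 1" for \<mu>
    proof -
      define h where "h x = (g x / ennreal \<mu>) ennpow r" for x
      define V where "V = maxop (maxop h)"
      have [measurable]: "h \<in> borel_measurable lebesgue" unfolding h_def by measurable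
      have [measurable]: "V \<in> borel_measurable lebesgue" unfolding V_def by measurable
      note [measurable] = dyadic_sum_measurable[where w="?w", OF meas]
      have h: "h x = ennreal ((1 / \<mu>) powr r) * g x ennpow r" for x
        unfolding h_def ennreal_divide_eq_mult[OF \<mu>] using \<mu> by (simp add: ennpow_cmult)
      have V: "V x = ennreal ((1 / \<mu>) powr r) * maxop (maxop (\<lambda>x. g x ennpow r)) x" for x
      proof -
        have gm: "(\<lambda>x. g x ennpow r) \<in> borel_measurable lebesgue" by measurable
        have "maxop h = (\<lambda>x. ennreal ((1 / \<mu>) powr r) * maxop (\<lambda>x. g x ennpow r) x)"
          unfolding h[abs_def] by (rule ext) (rule maxop_cmult[OF gm])
        then show ?thesis unfolding V_def by (simp only: maxop_cmult[OF maxop_measurable])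
      qed
      have "dyadic_sum ?w h x \<le> ennreal K1 * orlicz_ext (\<phi> x) (g x / ennreal \<mu>)" for x
        unfolding K1_def by (rule orlicz_dyadic(1)[OF G r(1) W]) (simp add: h_def)
      then have "ennreal (1 / K1) * dyadic_sum ?w h x \<le> ennreal (1 / K1) * (ennreal K1 * orlicz_ext (\<phi> x) (g x / ennreal \<mu>))" for x
        by (intro mult_left_mono) auto
      then have le: "ennreal (1 / K1) * dyadic_sum ?w h x \<le> orlicz_ext (\<phi> x) (g x / ennreal \<mu>)" for x
        using K1 by (simp add: mult.assoc[symmetric] ennreal_mult[symmetric])
      have "ennreal (1 / K1) * (\<integral>\<^sup>+x. dyadic_sum ?w h x \<partial>lebesgue) = (\<integral>\<^sup>+x. ennreal (1 / K1) * dyadic_sum ?w h x \<partial>lebesgue)"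
        by (rule nn_integral_cmult[symmetric]) measurable
      also have "\<dots> \<le> 1" using le by (intro order_trans[OF nn_integral_mono adm])
      finally have "ennreal K1 * (ennreal (1 / K1) * (\<integral>\<^sup>+x. dyadic_sum ?w h x \<partial>lebesgue)) \<le> ennreal K1 * 1"
        by (rule mult_left_mono) simp
      then have h1: "(\<integral>\<^sup>+x. dyadic_sum ?w h x \<partial>lebesgue) \<le> ennreal K1"
        using K1 by (simp add: mult.assoc[symmetric] ennreal_mult[symmetric])
      have "(\<integral>\<^sup>+x. dyadic_sum ?w V x \<partial>lebesgue) \<le> ennreal M * (ennreal M * ennreal K1)"
        unfolding V_def using h1
        by (intro order_trans[OF M(2)] mult_left_mono) auto
      also have "\<dots> = ennreal (M * M * K1)" using M K1 by (simp add: ennreal_mult mult.assoc)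
      finally have V1: "(\<integral>\<^sup>+x. dyadic_sum ?w V x \<partial>lebesgue) \<le> ennreal (M * M * K1)" .
      have "orlicz_ext (\<phi> x) (T x / ennreal (K * \<mu>)) \<le> ennreal (Cl * s2 powr p0 * D) * dyadic_sum ?w V x" for x
      proof -
        define b where "b = ennreal (s1 * (1 / \<mu>)) * T x"
        have "T x / ennreal (K * \<mu>) = ennreal (s2 * (s1 * (1 / \<mu>))) * T x"
          using \<mu> K s1 s2 by (subst ennreal_divide_eq_mult) (auto simp: K_def mult_ac)
        also have "\<dots> = ennreal s2 * b" unfolding b_def by (simp only: ennreal_mult'[OF less_imp_le[OF s2(1)]] mult.assoc)
        finally have e: "T x / ennreal (K * \<mu>) = ennreal s2 * b" .
        have "b ennpow r = ennreal (s1 powr r * (1 / \<mu>) powr r) * T x ennpow r"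
          unfolding b_def using s1 \<mu> by (subst ennpow_cmult) (auto simp: powr_mult powr_divide)
        also have "\<dots> \<le> ennreal (s1 powr r * (1 / \<mu>) powr r) * (ennreal C * maxop (maxop (\<lambda>x. g x ennpow r)) x)"
          using T by (intro mult_left_mono) auto
        also have "\<dots> = ennreal ((s1 powr r * C) * (1 / \<mu>) powr r) * maxop (maxop (\<lambda>x. g x ennpow r)) x"
        proof -
          have "ennreal (s1 powr r * (1 / \<mu>) powr r) * ennreal C = ennreal ((s1 powr r * C) * (1 / \<mu>) powr r)"
            using C0 by (subst ennreal_mult''[symmetric]) (simp_all add: mult_ac)
          then show ?thesis by (simp only: mult.assoc[symmetric])
        qed
        also have "\<dots> = V x" unfolding s1 V by simp
        finally have B: "orlicz_ext (\<phi> x) b \<le> ennreal D * dyadic_sum ?w V x"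
          by (rule orlicz_dyadic(2)[OF G r(1) W])
        have "orlicz_ext (\<phi> x) (ennreal s2 * b) \<le> ennreal (Cl * s2 powr p0) * orlicz_ext (\<phi> x) b"
        proof (cases b)
          case (real a)
          then show ?thesis using Cl(2)[of a s2 x] s2 Cl(1)
            by (simp add: orlicz_ext_def ennreal_mult[symmetric] ennreal_mult'[symmetric] ennreal_leI)
        next
          case top
          then show ?thesis using s2 Cl(1) by (simp add: orlicz_ext_def ennreal_mult_top)
        qed
        also have "\<dots> \<le> ennreal (Cl * s2 powr p0) * (ennreal D * dyadic_sum ?w V x)"
          using B by (rule mult_left_mono) simp
        also have "\<dots> = ennreal (Cl * s2 powr p0 * D) * dyadic_sum ?w V x"
          unfolding ennreal_mult''[OF less_imp_le[OF D], of "Cl * s2 powr p0"] mult.assoc[of "ennreal (Cl * s2 powr p0)"] ..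
        finally show ?thesis unfolding e .
      qed
      then have "(\<integral>\<^sup>+x. orlicz_ext (\<phi> x) (T x / ennreal (K * \<mu>)) \<partial>lebesgue) \<le> (\<integral>\<^sup>+x. ennreal (Cl * s2 powr p0 * D) * dyadic_sum ?w V x \<partial>lebesgue)"
        by (intro nn_integral_mono)
      also have "\<dots> = ennreal (Cl * s2 powr p0 * D) * (\<integral>\<^sup>+x. dyadic_sum ?w V x \<partial>lebesgue)"
        by (rule nn_integral_cmult) measurable
      also have "\<dots> \<le> ennreal (Cl * s2 powr p0 * D) * ennreal (M * M * K1)"
        using V1 by (rule mult_left_mono) simp
      also have "\<dots> = ennreal (s2 powr p0 * L)"
        unfolding L_def using M(1) K1 by (subst ennreal_mult''[symmetric]) (simp_all add: mult_ac)
      also have "\<dots> \<le> ennreal 1" using s2 by (intro ennreal_leI)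
      finally have "(\<integral>\<^sup>+x. orlicz_ext (\<phi> x) (T x / ennreal (K * \<mu>)) \<partial>lebesgue) \<le> 1" by simp
      then have "musielak_orlicz_norm \<phi> T \<le> ennreal (K * \<mu>)"
        unfolding musielak_orlicz_norm_def using K \<mu> by (intro Inf_lower) auto
      then show ?thesis using K \<mu> by (simp add: ennreal_mult)
    qed
    have "ennreal (1 / K) * musielak_orlicz_norm \<phi> T \<le> musielak_orlicz_norm \<phi> g"
      unfolding musielak_orlicz_norm_def[of \<phi> g]
    proof (rule Inf_greatest, clarify)
      fix \<mu> :: real assume "0 < \<mu>" "(\<integral>\<^sup>+x. orlicz_ext (\<phi> x) (g x / ennreal \<mu>) \<partial>lebesgue) \<le> 1"
      then have "ennreal (1 / K) * musielak_orlicz_norm \<phi> T \<le> ennreal (1 / K) * (ennreal K * ennreal \<mu>)"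
        by (intro mult_left_mono main) auto
      also have "\<dots> = ennreal \<mu>" using K by (simp add: mult.assoc[symmetric] ennreal_mult[symmetric])
      finally show "ennreal (1 / K) * musielak_orlicz_norm \<phi> T \<le> ennreal \<mu>" .
    qed
    then have "ennreal K * (ennreal (1 / K) * musielak_orlicz_norm \<phi> T) \<le> ennreal K * musielak_orlicz_norm \<phi> g"
      by (rule mult_left_mono) simp
    then show "musielak_orlicz_norm \<phi> T \<le> ennreal K * musielak_orlicz_norm \<phi> g"
      using K by (simp add: mult.assoc[symmetric] ennreal_mult[symmetric])
  qed
qed

section \<open>Schwartz functions\<close>

text \<open>Real-valued, hence only meaningful on Schwartz functions.\<close>
definition snorm :: "nat \<Rightarrow> nat \<Rightarrow> (real^'n \<Rightarrow> complex) \<Rightarrow> real" where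
  "snorm k l u = enn2real (schwartz_seminorm k l u)"

lemma snorm_nonneg [simp]: "0 \<le> snorm k l u"
  by (simp add: snorm_def)

lemma seminorm_eq_snorm: "u \<in> schwartz \<Longrightarrow> schwartz_seminorm k l u = ennreal (snorm k l u)"
  unfolding snorm_def schwartz_def by simp

lemma snorm_bound:
  assumes "u \<in> schwartz" "length \<beta> \<le> l"
  shows "(1 + norm x) ^ k * cmod (partial_derivs \<beta> u x) \<le> snorm k l u"
proof -
  have "ennreal ((1 + norm x) ^ k * cmod (partial_derivs \<beta> u x)) \<le> schwartz_seminorm k l u"
    unfolding schwartz_seminorm_def using assms(2) by (intro SUP_upper2[of x] SUP_upper2[of \<beta>]) auto
  then show ?thesis
    unfolding seminorm_eq_snorm[OF assms(1)] by (simp add: ennreal_le_iff)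
qed

lemma seminorm_le:
  assumes "\<And>x \<beta>. length \<beta> \<le> l \<Longrightarrow> (1 + norm x) ^ k * cmod (partial_derivs \<beta> u x) \<le> c"
  shows "schwartz_seminorm k l u \<le> ennreal c"
  unfolding schwartz_seminorm_def using assms by (intro SUP_least ennreal_leI) auto

lemma partial_derivs_Nil [simp]: "partial_derivs [] u = u"
  and partial_derivs_Cons: "partial_derivs (i # \<beta>) u = partial_deriv i (partial_derivs \<beta> u)"
  and partial_derivs_append: "partial_derivs (\<beta> @ \<gamma>) u = partial_derivs \<beta> (partial_derivs \<gamma> u)"
  by (simp_all add: partial_derivs_def)

lemma snorm_le:
  fixes u :: "real^'n \<Rightarrow> complex"
  assumes "\<And>x \<beta>. length \<beta> \<le> l \<Longrightarrow> (1 + norm x) ^ k * cmod (partial_derivs \<beta> u x) \<le> c"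
  shows "snorm k l u \<le> c"
proof -
  have "0 \<le> cmod (u 0)" by simp
  also have "\<dots> \<le> c" using assms[of "[]" 0] by simp
  finally have "0 \<le> c" .
  then show ?thesis unfolding snorm_def using seminorm_le[of l k u c, OF assms]
    by (simp add: enn2real_leI)
qed

lemma snorm_mono:
  fixes u :: "real^'n \<Rightarrow> complex"
  assumes "u \<in> schwartz" "k \<le> k'" "l \<le> l'"
  shows "snorm k l u \<le> snorm k' l' u"
proof (rule snorm_le)
  fix x :: "real^'n" and \<beta> :: "'n list" assume \<beta>: "length \<beta> \<le> l"
  have "(1 + norm x) ^ k \<le> (1 + norm x) ^ k'" using assms by (intro power_increasing) auto
  then have "(1 + norm x) ^ k * cmod (partial_derivs \<beta> u x) \<le> (1 + norm x) ^ k' * cmod (partial_derivs \<beta> u x)"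
    by (rule mult_right_mono) simp
  also have "\<dots> \<le> snorm k' l' u" using assms \<beta> by (intro snorm_bound) auto
  finally show "(1 + norm x) ^ k * cmod (partial_derivs \<beta> u x) \<le> snorm k' l' u" .
qed

lemma schwartzI:
  assumes "smooth u"
    and "\<And>k l x \<beta>. length \<beta> \<le> l \<Longrightarrow> (1 + norm x) ^ k * cmod (partial_derivs \<beta> u x) \<le> c k l"
  shows "u \<in> schwartz"
proof -
  have "schwartz_seminorm k l u < top" for k l
    using seminorm_le[of l k u "c k l", OF assms(2)] ennreal_less_top le_less_trans by blast
  then show ?thesis unfolding schwartz_def using assms(1) by simp
qed

text \<open>There are only finitely many lists of coordinates of bounded length.\<close>
lemma schwartzI_each:
  fixes u :: "real^'n \<Rightarrow> complex"
  assumes "smooth u" "\<And>k \<beta>. \<exists>c. \<forall>x. (1 + norm x) ^ k * cmod (partial_derivs \<beta> u x) \<le> c"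
  shows "u \<in> schwartz"
proof -
  obtain c where c: "\<And>k \<beta> x. (1 + norm x) ^ k * cmod (partial_derivs \<beta> u x) \<le> c k \<beta>"
    using assms(2) by metis
  let ?B = "\<lambda>l. {\<beta> :: 'n list. length \<beta> \<le> l}"
  have fin: "finite (?B l)" for l using finite_lists_length_le[of "UNIV :: 'n set" l] by simp
  have "(1 + norm x) ^ k * cmod (partial_derivs \<beta> u x) \<le> Max (c k ` ?B l)" if "length \<beta> \<le> l" for k l x \<beta>
  proof -
    have "c k \<beta> \<le> Max (c k ` ?B l)" using fin that by (intro Max_ge) auto
    then show ?thesis using c[of x k \<beta>] by linarith
  qed
  then show ?thesis by (rule schwartzI[OF assms(1)])
qed

lemma smooth_partial_derivs: "smooth u \<Longrightarrow> smooth (partial_derivs \<gamma> u)"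
  unfolding smooth_def partial_derivs_append[symmetric] by blast

lemma partial_deriv_eq: "partial_deriv i u = partial_derivs [i] u"
  by (simp add: partial_derivs_def)

lemma smooth_has_derivative:
  fixes u :: "real^'n \<Rightarrow> complex"
  assumes "smooth u"
  shows "(u has_derivative (\<lambda>h. \<Sum>i\<in>UNIV. h $ i *\<^sub>R partial_deriv i u x)) (at x)"
proof -
  have "u differentiable (at x)"
    using assms[unfolded smooth_def, rule_format, of "[]"] by (simp add: differentiable_on_def)
  then have D: "(u has_derivative frechet_derivative u (at x)) (at x)"
    by (simp add: frechet_derivative_works)
  interpret bounded_linear "frechet_derivative u (at x)" using D by (rule has_derivative_bounded_linear)
  have "frechet_derivative u (at x) h = (\<Sum>i\<in>UNIV. h $ i *\<^sub>R partial_deriv i u x)" for h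
  proof -
    have "h = (\<Sum>i\<in>UNIV. h $ i *\<^sub>R axis i 1)"
      using basis_expansion[of h] by (simp add: scalar_mult_eq_scaleR)
    then have "frechet_derivative u (at x) h = frechet_derivative u (at x) (\<Sum>i\<in>UNIV. h $ i *\<^sub>R axis i 1)"
      by simp
    then show ?thesis by (simp add: sum scaleR partial_deriv_def)
  qed
  then have "frechet_derivative u (at x) = (\<lambda>h. \<Sum>i\<in>UNIV. h $ i *\<^sub>R partial_deriv i u x)" by (rule ext)
  with D show ?thesis by simp
qed

lemma partial_deriv_of_has_derivative:
  assumes "(u has_derivative (\<lambda>h. \<Sum>i\<in>UNIV. h $ i *\<^sub>R c i)) (at x)"
  shows "partial_deriv i u x = c i"
proof -
  have "frechet_derivative u (at x) = (\<lambda>h. \<Sum>i\<in>UNIV. h $ i *\<^sub>R c i)"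
    using assms by (rule frechet_derivative_at[symmetric])
  then have "partial_deriv i u x = (\<Sum>j\<in>UNIV. axis i 1 $ j *\<^sub>R c j)" by (simp add: partial_deriv_def)
  also have "\<dots> = (\<Sum>j\<in>UNIV. if j = i then c j else 0)"
    by (intro sum.cong) (auto simp: axis_def)
  also have "\<dots> = c i" by simp
  finally show ?thesis .
qed

lemma smooth_continuous: "smooth u \<Longrightarrow> continuous_on S u"
  by (intro continuous_at_imp_continuous_on ballI has_derivative_continuous[OF smooth_has_derivative])

lemma smoothI:
  assumes "\<And>\<beta> y. \<exists>D. (partial_derivs \<beta> u has_derivative D) (at y)"
  shows "smooth u"
  unfolding smooth_def differentiable_on_def differentiable_def using assms by simp

text \<open>The formula for derivatives of order \<open>|\<beta>|\<close> and the differentiability of its right-hand side go together: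
  the next derivative can only be read off from the formula.\<close>
lemma partial_derivs_affine_aux:
  fixes u :: "real^'n \<Rightarrow> complex"
  assumes "smooth u"
  shows "partial_derivs \<beta> (\<lambda>y. u (a + c *\<^sub>R y)) = (\<lambda>y. of_real (c ^ length \<beta>) * partial_derivs \<beta> u (a + c *\<^sub>R y)) \<and>
    ((\<lambda>y. of_real (c ^ length \<beta>) * partial_derivs \<beta> u (a + c *\<^sub>R y)) has_derivative
       (\<lambda>h. \<Sum>i\<in>UNIV. h $ i *\<^sub>R (of_real (c ^ Suc (length \<beta>)) * partial_deriv i (partial_derivs \<beta> u) (a + c *\<^sub>R y)))) (at y)"
proof -
  have D: "((\<lambda>y. of_real (c ^ length \<beta>) * partial_derivs \<beta> u (a + c *\<^sub>R y)) has_derivative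
       (\<lambda>h. \<Sum>i\<in>UNIV. h $ i *\<^sub>R (of_real (c ^ Suc (length \<beta>)) * partial_deriv i (partial_derivs \<beta> u) (a + c *\<^sub>R y)))) (at y)"
    for \<beta> :: "'n list" and y
  proof -
    have "((\<lambda>y. partial_derivs \<beta> u (a + c *\<^sub>R y)) has_derivative
      (\<lambda>h. \<Sum>i\<in>UNIV. (c *\<^sub>R h) $ i *\<^sub>R partial_deriv i (partial_derivs \<beta> u) (a + c *\<^sub>R y))) (at y)"
      by (rule has_derivative_compose[OF _ smooth_has_derivative[OF smooth_partial_derivs[OF assms]]])
         (auto intro!: derivative_eq_intros)
    from has_derivative_mult_right[OF this, of "of_real (c ^ length \<beta>)"]
    show ?thesis by (rule has_derivative_eq_rhs) (auto simp: fun_eq_iff sum_distrib_left scaleR_conv_of_real[where 'a=complex] mult_ac)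
  qed
  have "partial_derivs \<beta> (\<lambda>y. u (a + c *\<^sub>R y)) = (\<lambda>y. of_real (c ^ length \<beta>) * partial_derivs \<beta> u (a + c *\<^sub>R y))"
  proof (induction \<beta>)
    case (Cons i \<beta>)
    show ?case
    proof
      fix y
      show "partial_derivs (i # \<beta>) (\<lambda>y. u (a + c *\<^sub>R y)) y = of_real (c ^ length (i # \<beta>)) * partial_derivs (i # \<beta>) u (a + c *\<^sub>R y)"
        unfolding partial_derivs_Cons Cons.IH partial_deriv_of_has_derivative[OF D] by simp
    qed
  qed simp
  then show ?thesis using D by blast
qed

lemma partial_derivs_affine:
  "smooth u \<Longrightarrow> partial_derivs \<beta> (\<lambda>y. u (a + c *\<^sub>R y)) = (\<lambda>y. of_real (c ^ length \<beta>) * partial_derivs \<beta> u (a + c *\<^sub>R y))"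
  using partial_derivs_affine_aux by blast

lemma smooth_affine:
  assumes "smooth u" shows "smooth (\<lambda>y. u (a + c *\<^sub>R y))"
proof (rule smoothI)
  fix \<beta> y
  show "\<exists>D. (partial_derivs \<beta> (\<lambda>y. u (a + c *\<^sub>R y)) has_derivative D) (at y)"
    unfolding partial_derivs_affine[OF assms]
    by (rule exI) (rule partial_derivs_affine_aux[OF assms, THEN conjunct2])
qed

lemma partial_derivs_lincomb_aux:
  fixes u v :: "real^'n \<Rightarrow> complex"
  assumes "smooth u" "smooth v"
  shows "partial_derivs \<beta> (\<lambda>x. a * u x + b * v x) = (\<lambda>x. a * partial_derivs \<beta> u x + b * partial_derivs \<beta> v x) \<and>
    ((\<lambda>x. a * partial_derivs \<beta> u x + b * partial_derivs \<beta> v x) has_derivative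
       (\<lambda>h. \<Sum>i\<in>UNIV. h $ i *\<^sub>R (a * partial_deriv i (partial_derivs \<beta> u) y + b * partial_deriv i (partial_derivs \<beta> v) y))) (at y)"
proof -
  have D: "((\<lambda>x. a * partial_derivs \<beta> u x + b * partial_derivs \<beta> v x) has_derivative
       (\<lambda>h. \<Sum>i\<in>UNIV. h $ i *\<^sub>R (a * partial_deriv i (partial_derivs \<beta> u) y + b * partial_deriv i (partial_derivs \<beta> v) y))) (at y)"
    for \<beta> :: "'n list" and y
  proof -
    note d = smooth_has_derivative[OF smooth_partial_derivs]
    have "((\<lambda>x. a * partial_derivs \<beta> u x + b * partial_derivs \<beta> v x) has_derivative
       (\<lambda>h. a * (\<Sum>i\<in>UNIV. h $ i *\<^sub>R partial_deriv i (partial_derivs \<beta> u) y) + b * (\<Sum>i\<in>UNIV. h $ i *\<^sub>R partial_deriv i (partial_derivs \<beta> v) y))) (at y)"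
      by (intro has_derivative_add has_derivative_mult_right d assms)
    then show ?thesis
      by (rule has_derivative_eq_rhs) (auto simp: fun_eq_iff sum_distrib_left scaleR_right_distrib sum.distrib mult_scaleR_right)
  qed
  have "partial_derivs \<beta> (\<lambda>x. a * u x + b * v x) = (\<lambda>x. a * partial_derivs \<beta> u x + b * partial_derivs \<beta> v x)"
  proof (induction \<beta>)
    case (Cons i \<beta>)
    show ?case
      unfolding partial_derivs_Cons Cons.IH by (rule ext) (rule partial_deriv_of_has_derivative[OF D])
  qed simp
  then show ?thesis using D by blast
qed

lemma partial_derivs_lincomb:
  "smooth u \<Longrightarrow> smooth v \<Longrightarrow> partial_derivs \<beta> (\<lambda>x. a * u x + b * v x) = (\<lambda>x. a * partial_derivs \<beta> u x + b * partial_derivs \<beta> v x)"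
  using partial_derivs_lincomb_aux by blast

lemma smooth_lincomb:
  assumes "smooth u" "smooth v" shows "smooth (\<lambda>x. a * u x + b * v x)"
proof (rule smoothI)
  fix \<beta> y
  show "\<exists>D. (partial_derivs \<beta> (\<lambda>x. a * u x + b * v x) has_derivative D) (at y)"
    unfolding partial_derivs_lincomb[OF assms]
    by (rule exI) (rule partial_derivs_lincomb_aux[OF assms, THEN conjunct2])
qed

lemma schwartz_smooth: "u \<in> schwartz \<Longrightarrow> smooth u"
  by (simp add: schwartz_def)

lemma
  assumes "u \<in> schwartz" "v \<in> schwartz"
  shows schwartz_lincomb: "(\<lambda>x. a * u x + b * v x) \<in> schwartz"
    and snorm_lincomb: "snorm k l (\<lambda>x. a * u x + b * v x) \<le> cmod a * snorm k l u + cmod b * snorm k l v"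
proof -
  have *: "(1 + norm x) ^ k * cmod (partial_derivs \<beta> (\<lambda>x. a * u x + b * v x) x) \<le> cmod a * snorm k l u + cmod b * snorm k l v"
    if "length \<beta> \<le> l" for k l x \<beta>
  proof -
    have "(1 + norm x) ^ k * cmod (partial_derivs \<beta> (\<lambda>x. a * u x + b * v x) x) \<le>
       (1 + norm x) ^ k * (cmod a * cmod (partial_derivs \<beta> u x) + cmod b * cmod (partial_derivs \<beta> v x))"
      unfolding partial_derivs_lincomb[OF assms[THEN schwartz_smooth]]
      by (intro mult_left_mono order_trans[OF norm_triangle_ineq]) (auto simp: norm_mult)
    also have "\<dots> = cmod a * ((1 + norm x) ^ k * cmod (partial_derivs \<beta> u x)) + cmod b * ((1 + norm x) ^ k * cmod (partial_derivs \<beta> v x))"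
      by (simp add: algebra_simps)
    also have "\<dots> \<le> cmod a * snorm k l u + cmod b * snorm k l v"
      using that assms by (intro add_mono mult_left_mono snorm_bound) auto
    finally show ?thesis .
  qed
  show "(\<lambda>x. a * u x + b * v x) \<in> schwartz"
    by (rule schwartzI[OF _ *]) (intro smooth_lincomb assms[THEN schwartz_smooth])
  show "snorm k l (\<lambda>x. a * u x + b * v x) \<le> cmod a * snorm k l u + cmod b * snorm k l v"
    using * by (rule snorm_le)
qed

lemma schwartz_diff:
  assumes "u \<in> schwartz" "v \<in> schwartz"
  shows "(\<lambda>x. u x - v x) \<in> schwartz"
  using schwartz_lincomb[OF assms, where a=1 and b="-1"] by simp

lemma schwartz_partial_derivs:
  assumes u: "u \<in> schwartz"
  shows "partial_derivs \<gamma> u \<in> schwartz"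
proof -
  have *: "(1 + norm x) ^ k * cmod (partial_derivs \<beta> (partial_derivs \<gamma> u) x) \<le> snorm k (l + length \<gamma>) u"
    if "length \<beta> \<le> l" for k l x \<beta>
    unfolding partial_derivs_append[symmetric] using that u by (intro snorm_bound) auto
  show ?thesis
    by (rule schwartzI[OF _ *]) (intro smooth_partial_derivs schwartz_smooth u)
qed

lemma one_plus_norm_mult: "1 + norm (x + y) \<le> (1 + norm x) * (1 + norm y)"
proof -
  have "1 + norm (x + y) \<le> 1 + norm x + norm y" using norm_triangle_ineq[of x y] by simp
  also have "\<dots> \<le> (1 + norm x) * (1 + norm y)" by (simp add: algebra_simps)
  finally show ?thesis .
qed

lemma
  fixes u :: "real^'n \<Rightarrow> complex"
  assumes u: "u \<in> schwartz" and c: "c \<noteq> 0"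
  shows schwartz_affine: "(\<lambda>y. u (a + c *\<^sub>R y)) \<in> schwartz"
    and snorm_affine: "snorm k l (\<lambda>y. u (a + c *\<^sub>R y)) \<le> (1 + norm a) ^ k * (1 + \<bar>1 / c\<bar>) ^ k * (1 + \<bar>c\<bar>) ^ l * snorm k l u"
proof -
  have *: "(1 + norm x) ^ k * cmod (partial_derivs \<beta> (\<lambda>y. u (a + c *\<^sub>R y)) x) \<le> (1 + norm a) ^ k * (1 + \<bar>1 / c\<bar>) ^ k * (1 + \<bar>c\<bar>) ^ l * snorm k l u"
    if \<beta>: "length \<beta> \<le> l" for k l x \<beta>
  proof -
    have "1 + norm x \<le> (1 + norm (a + c *\<^sub>R x)) * ((1 + norm a) * (1 + \<bar>1 / c\<bar>))"
    proof -
      have "c *\<^sub>R x = (a + c *\<^sub>R x) + (- a)" by simp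
      then have "1 + norm (c *\<^sub>R x) \<le> (1 + norm (a + c *\<^sub>R x)) * (1 + norm a)"
        using one_plus_norm_mult[of "a + c *\<^sub>R x" "- a"] by simp
      then have "(1 + norm (c *\<^sub>R x)) * (1 + \<bar>1 / c\<bar>) \<le> (1 + norm (a + c *\<^sub>R x)) * (1 + norm a) * (1 + \<bar>1 / c\<bar>)"
        by (rule mult_right_mono) simp
      moreover have "1 + norm x \<le> (1 + norm (c *\<^sub>R x)) * (1 + \<bar>1 / c\<bar>)"
        using c by (simp add: algebra_simps abs_mult[symmetric] add_increasing2)
      ultimately show ?thesis by (simp add: mult.assoc)
    qed
    then have "(1 + norm x) ^ k \<le> ((1 + norm (a + c *\<^sub>R x)) * ((1 + norm a) * (1 + \<bar>1 / c\<bar>))) ^ k"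
      by (intro power_mono) auto
    moreover have "\<bar>c\<bar> ^ length \<beta> \<le> (1 + \<bar>c\<bar>) ^ l"
    proof -
      have "\<bar>c\<bar> ^ length \<beta> \<le> (1 + \<bar>c\<bar>) ^ length \<beta>" by (intro power_mono) auto
      also have "\<dots> \<le> (1 + \<bar>c\<bar>) ^ l" using \<beta> by (intro power_increasing) auto
      finally show ?thesis .
    qed
    ultimately have "(1 + norm x) ^ k * (\<bar>c\<bar> ^ length \<beta> * cmod (partial_derivs \<beta> u (a + c *\<^sub>R x))) \<le>
       ((1 + norm (a + c *\<^sub>R x)) * ((1 + norm a) * (1 + \<bar>1 / c\<bar>))) ^ k * ((1 + \<bar>c\<bar>) ^ l * cmod (partial_derivs \<beta> u (a + c *\<^sub>R x)))"
      by (intro mult_mono) auto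
    also have "\<dots> = (1 + norm a) ^ k * (1 + \<bar>1 / c\<bar>) ^ k * (1 + \<bar>c\<bar>) ^ l * ((1 + norm (a + c *\<^sub>R x)) ^ k * cmod (partial_derivs \<beta> u (a + c *\<^sub>R x)))"
      by (simp add: power_mult_distrib mult_ac)
    also have "\<dots> \<le> (1 + norm a) ^ k * (1 + \<bar>1 / c\<bar>) ^ k * (1 + \<bar>c\<bar>) ^ l * snorm k l u"
      using u \<beta> by (intro mult_left_mono snorm_bound) auto
    finally show ?thesis
      unfolding partial_derivs_affine[OF schwartz_smooth[OF u]] by (simp add: norm_mult norm_power)
  qed
  show "(\<lambda>y. u (a + c *\<^sub>R y)) \<in> schwartz"
    by (rule schwartzI[OF _ *]) (intro smooth_affine schwartz_smooth u)
  show "snorm k l (\<lambda>y. u (a + c *\<^sub>R y)) \<le> (1 + norm a) ^ k * (1 + \<bar>1 / c\<bar>) ^ k * (1 + \<bar>c\<bar>) ^ l * snorm k l u"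
    using * by (rule snorm_le)
qed

lemma schwartz_zero: "(\<lambda>x :: real^'n. 0) \<in> schwartz"
proof -
  have "partial_derivs \<beta> (\<lambda>x::real^'n. 0 :: complex) = (\<lambda>x. 0)" for \<beta> :: "'n list"
    by (induction \<beta>) (simp_all add: partial_derivs_Cons partial_deriv_def[abs_def] frechet_derivative_const)
  then show ?thesis by (intro schwartzI[where c="\<lambda>k l. 0"]) (auto simp: smooth_def)
qed

text \<open>Mean value theorem on the segment from \<open>a\<close> to \<open>b\<close>. The weight is taken at the endpoint \<open>a\<close>, and moving it to
  the intermediate point costs the factor \<open>(1 + |b - a|)\<^sup>k\<close>.\<close>
lemma schwartz_lipschitz:
  fixes u :: "real^'n \<Rightarrow> complex"
  assumes u: "u \<in> schwartz" and \<beta>: "length \<beta> \<le> l"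
  shows "(1 + norm a) ^ k * cmod (partial_derivs \<beta> u b - partial_derivs \<beta> u a) \<le>
    real CARD('n) * norm (b - a) * (1 + norm (b - a)) ^ k * snorm k (Suc l) u"
proof -
  define B where "B = (1 + norm (b - a)) ^ k / (1 + norm a) ^ k * snorm k (Suc l) u"
  have pos: "0 < (1 + norm z) ^ k" for z :: "real^'n"
    by (intro zero_less_power) (simp add: add_pos_nonneg)
  have Bi: "cmod (partial_deriv i (partial_derivs \<beta> u) \<xi>) \<le> B" if \<xi>: "\<xi> \<in> closed_segment a b" for \<xi> i
  proof -
    have "norm (a - \<xi>) \<le> norm (b - a)" using \<xi> segment_bound[of \<xi> a b] by (simp add: norm_minus_commute)
    moreover have "1 + norm (\<xi> + (a - \<xi>)) \<le> (1 + norm \<xi>) * (1 + norm (a - \<xi>))" by (rule one_plus_norm_mult)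
    ultimately have "1 + norm a \<le> (1 + norm \<xi>) * (1 + norm (b - a))"
      by (simp add: order_trans[OF _ mult_left_mono])
    then have p: "(1 + norm a) ^ k \<le> (1 + norm \<xi>) ^ k * (1 + norm (b - a)) ^ k"
      unfolding power_mult_distrib[symmetric] by (intro power_mono) auto
    have "(1 + norm a) ^ k * cmod (partial_deriv i (partial_derivs \<beta> u) \<xi>) \<le>
        ((1 + norm \<xi>) ^ k * (1 + norm (b - a)) ^ k) * cmod (partial_derivs (i # \<beta>) u \<xi>)"
      using p by (simp add: partial_derivs_Cons mult_right_mono)
    also have "\<dots> = (1 + norm (b - a)) ^ k * ((1 + norm \<xi>) ^ k * cmod (partial_derivs (i # \<beta>) u \<xi>))"
      by simp
    also have "\<dots> \<le> (1 + norm (b - a)) ^ k * snorm k (Suc l) u"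
      using u \<beta> by (intro mult_left_mono snorm_bound) auto
    finally show ?thesis unfolding B_def using pos[of a] by (simp add: field_simps)
  qed
  have "norm (partial_derivs \<beta> u b - partial_derivs \<beta> u a) \<le> (real CARD('n) * B) * norm (b - a)"
  proof (rule differentiable_bound[where S="closed_segment a b"])
    fix \<xi> assume \<xi>: "\<xi> \<in> closed_segment a b"
    show "(partial_derivs \<beta> u has_derivative (\<lambda>h. \<Sum>i\<in>UNIV. h $ i *\<^sub>R partial_deriv i (partial_derivs \<beta> u) \<xi>)) (at \<xi> within closed_segment a b)"
      by (rule has_derivative_at_withinI[OF smooth_has_derivative[OF smooth_partial_derivs[OF schwartz_smooth[OF u]]]])
    show "onorm (\<lambda>h. \<Sum>i\<in>UNIV. h $ i *\<^sub>R partial_deriv i (partial_derivs \<beta> u) \<xi>) \<le> real CARD('n) * B"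
    proof (rule onorm_le)
      fix h :: "real^'n"
      have "norm (\<Sum>i\<in>UNIV. h $ i *\<^sub>R partial_deriv i (partial_derivs \<beta> u) \<xi>) \<le> (\<Sum>i\<in>(UNIV :: 'n set). norm h * B)"
        using Bi[OF \<xi>] by (intro sum_norm_le) (auto intro!: mult_mono component_le_norm_cart)
      then show "norm (\<Sum>i\<in>UNIV. h $ i *\<^sub>R partial_deriv i (partial_derivs \<beta> u) \<xi>) \<le> real CARD('n) * B * norm h"
        by (simp add: mult_ac)
    qed
  qed auto
  then have "(1 + norm a) ^ k * cmod (partial_derivs \<beta> u b - partial_derivs \<beta> u a) \<le> (1 + norm a) ^ k * (real CARD('n) * B * norm (b - a))"
    using pos[of a] by (intro mult_left_mono) auto
  also have "\<dots> = real CARD('n) * norm (b - a) * (1 + norm (b - a)) ^ k * snorm k (Suc l) u"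
  proof -
    have "1 + norm a \<noteq> 0" using norm_ge_zero[of a] by linarith
    then show ?thesis unfolding B_def by simp
  qed
  finally show ?thesis .
qed

text \<open>A remainder that is quadratic uniformly in \<open>x\<close> allows convolutions to be differentiated by
  integrating this estimate.\<close>
lemma schwartz_taylor:
  fixes u :: "real^'n \<Rightarrow> complex"
  assumes u: "u \<in> schwartz"
  shows "cmod (u (x + h) - u x - (\<Sum>i\<in>UNIV. h $ i *\<^sub>R partial_deriv i u x)) \<le>
    (real CARD('n))\<^sup>2 * snorm 0 2 u * (norm h)\<^sup>2"
proof -
  let ?n = "real CARD('n)"
  define G where "G y = u y - (\<Sum>i\<in>UNIV. y $ i *\<^sub>R partial_deriv i u x)" for y
  have Bi: "cmod (partial_deriv i u \<xi> - partial_deriv i u x) \<le> ?n * norm h * snorm 0 2 u" if \<xi>: "\<xi> \<in> closed_segment x (x + h)" for \<xi> i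
  proof -
    have "norm (\<xi> - x) \<le> norm h" using \<xi> segment_bound[of \<xi> x "x + h"] by simp
    moreover have "cmod (partial_deriv i u \<xi> - partial_deriv i u x) \<le> ?n * norm (\<xi> - x) * snorm 0 2 u"
      using schwartz_lipschitz[OF u, of "[i]" 1 x 0 \<xi>] by (simp add: partial_derivs_Cons numeral_2_eq_2)
    moreover have "?n * norm (\<xi> - x) * snorm 0 2 u \<le> ?n * norm h * snorm 0 2 u"
      using calculation(1) by (intro mult_right_mono mult_left_mono) auto
    ultimately show ?thesis by linarith
  qed
  have "norm (G (x + h) - G x) \<le> (?n * (?n * norm h * snorm 0 2 u)) * norm (x + h - x)"
  proof (rule differentiable_bound[where S="closed_segment x (x + h)"])
    fix \<xi> assume \<xi>: "\<xi> \<in> closed_segment x (x + h)"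
    have "(G has_derivative (\<lambda>h. (\<Sum>i\<in>UNIV. h $ i *\<^sub>R partial_deriv i u \<xi>) - (\<Sum>i\<in>UNIV. h $ i *\<^sub>R partial_deriv i u x))) (at \<xi> within closed_segment x (x + h))"
      unfolding G_def
      by (intro has_derivative_diff has_derivative_at_withinI[OF smooth_has_derivative] schwartz_smooth u
        has_derivative_sum has_derivative_scaleR_left bounded_linear.has_derivative[OF bounded_linear_vec_nth] has_derivative_ident)
    then show "(G has_derivative (\<lambda>h. \<Sum>i\<in>UNIV. h $ i *\<^sub>R (partial_deriv i u \<xi> - partial_deriv i u x))) (at \<xi> within closed_segment x (x + h))"
      by (simp add: sum_subtractf scaleR_right_diff_distrib)
    show "onorm (\<lambda>h. \<Sum>i\<in>UNIV. h $ i *\<^sub>R (partial_deriv i u \<xi> - partial_deriv i u x)) \<le> ?n * (?n * norm h * snorm 0 2 u)"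
    proof (rule onorm_le)
      fix k :: "real^'n"
      have "norm (\<Sum>i\<in>UNIV. k $ i *\<^sub>R (partial_deriv i u \<xi> - partial_deriv i u x)) \<le> (\<Sum>i\<in>(UNIV :: 'n set). norm k * (?n * norm h * snorm 0 2 u))"
        using Bi[OF \<xi>] by (intro sum_norm_le) (auto intro!: mult_mono component_le_norm_cart)
      then show "norm (\<Sum>i\<in>UNIV. k $ i *\<^sub>R (partial_deriv i u \<xi> - partial_deriv i u x)) \<le> ?n * (?n * norm h * snorm 0 2 u) * norm k"
        by (simp add: mult_ac)
    qed
  qed auto
  moreover have "G (x + h) - G x = u (x + h) - u x - (\<Sum>i\<in>UNIV. h $ i *\<^sub>R partial_deriv i u x)"
    unfolding G_def by (simp add: scaleR_left_distrib sum.distrib)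
  ultimately show ?thesis by (simp add: power2_eq_square mult_ac)
qed

section \<open>Tempered distributions\<close>

lemma tempered_lincomb:
  "f \<in> tempered_distributions \<Longrightarrow> u \<in> schwartz \<Longrightarrow> v \<in> schwartz \<Longrightarrow>
     f (\<lambda>x. a * u x + b * v x) = a * f u + b * f v"
  unfolding tempered_distributions_def by blast

lemma tempered_zero: "f \<in> tempered_distributions \<Longrightarrow> f (\<lambda>x. 0) = 0"
  using tempered_lincomb[of f "\<lambda>x. 0" "\<lambda>x. 0" 0 0] schwartz_zero by simp

lemma tempered_diff:
  "f \<in> tempered_distributions \<Longrightarrow> u \<in> schwartz \<Longrightarrow> v \<in> schwartz \<Longrightarrow> f (\<lambda>x. u x - v x) = f u - f v"
  using tempered_lincomb[of f u v 1 "-1"] by simp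

lemma tempered_sum:
  assumes f: "f \<in> tempered_distributions" and A: "finite A" and h: "\<And>c. c \<in> A \<Longrightarrow> h c \<in> schwartz"
  shows "(\<lambda>x. \<Sum>c\<in>A. a c * h c x) \<in> schwartz \<and> f (\<lambda>x. \<Sum>c\<in>A. a c * h c x) = (\<Sum>c\<in>A. a c * f (h c))"
  using A h
proof (induction A)
  case empty
  then show ?case using f by (simp add: schwartz_zero tempered_zero)
next
  case (insert c A)
  then have IH: "(\<lambda>x. \<Sum>c\<in>A. a c * h c x) \<in> schwartz" "f (\<lambda>x. \<Sum>c\<in>A. a c * h c x) = (\<Sum>c\<in>A. a c * f (h c))" "h c \<in> schwartz"
    by auto
  show ?case
    using schwartz_lincomb[OF IH(3,1), of "a c" 1] tempered_lincomb[OF f IH(3,1), of "a c" 1] IH(2) insert.hyps by simp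
qed

text \<open>The balls that generate the topology have arbitrary centres and seminorms; the triangle inequality
  yields a ball around the origin inside each of those that contain it.\<close>
lemma schwartz_topology_nhds:
  fixes U :: "(real^'n \<Rightarrow> complex) set"
  assumes "openin schwartz_topology U" "(\<lambda>x. 0) \<in> U"
  shows "\<exists>k l e. 0 < e \<and> (\<forall>v\<in>schwartz. snorm k l v < e \<longrightarrow> v \<in> U)"
proof -
  let ?S = "{{v \<in> schwartz. schwartz_seminorm k l (\<lambda>x. v x - u x) < \<epsilon>} | (u :: real^'n \<Rightarrow> complex) k l \<epsilon>. u \<in> schwartz \<and> 0 < \<epsilon>}"
  have "generate_topology_on ?S U"
    using assms(1) unfolding schwartz_topology_def openin_topology_generated_by_iff .
  then show ?thesis using assms(2)
  proof (induction)
    case Empty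
    then show ?case by simp
  next
    case (Int a b)
    then obtain k l e k' l' e' where e: "0 < e" "\<forall>v\<in>schwartz. snorm k l v < e \<longrightarrow> v \<in> a"
      and e': "0 < e'" "\<forall>v\<in>schwartz. snorm k' l' v < e' \<longrightarrow> v \<in> b" by blast
    have "v \<in> a \<inter> b" if v: "v \<in> schwartz" "snorm (max k k') (max l l') v < min e e'" for v
    proof -
      have "snorm k l v \<le> snorm (max k k') (max l l') v" "snorm k' l' v \<le> snorm (max k k') (max l l') v"
        using v(1) by (intro snorm_mono; simp)+
      then show ?thesis using e e' v by auto
    qed
    then show ?case using e e' by (intro exI[of _ "max k k'"] exI[of _ "max l l'"] exI[of _ "min e e'"]) auto
  next
    case (UN K)
    then obtain k where k: "k \<in> K" "(\<lambda>x. 0) \<in> k" by blast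
    then have "\<exists>k' l e. 0 < e \<and> (\<forall>v\<in>schwartz. snorm k' l v < e \<longrightarrow> v \<in> k)" using UN.IH by blast
    then show ?case using k(1) by blast
  next
    case (Basis s)
    then obtain u :: "real^'n \<Rightarrow> complex" and k l \<epsilon> where s: "s = {v \<in> schwartz. schwartz_seminorm k l (\<lambda>x. v x - u x) < \<epsilon>}"
      and u: "u \<in> schwartz" "0 < \<epsilon>" by blast
    let ?u = "\<lambda>x. 0 - u x"
    have mu: "?u \<in> schwartz" by (rule schwartz_diff[OF schwartz_zero u(1)])
    have "ennreal (snorm k l ?u) < \<epsilon>" using Basis(2) unfolding s seminorm_eq_snorm[OF mu, symmetric] by simp
    then obtain b where b: "ennreal (snorm k l ?u) < b" "b < \<epsilon>" using dense by blast
    then obtain b' where b': "b = ennreal b'" "0 \<le> b'" by (cases b) auto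
    have lt: "snorm k l ?u < b'" using b(1) unfolding b' by (simp add: ennreal_less_iff)
    have "v \<in> s" if v: "v \<in> schwartz" "snorm k l v < b' - snorm k l ?u" for v
    proof -
      have eq: "(\<lambda>x. v x - u x) = (\<lambda>x. 1 * v x + 1 * ?u x)" by auto
      have d: "(\<lambda>x. v x - u x) \<in> schwartz" by (rule schwartz_diff[OF v(1) u(1)])
      have "snorm k l (\<lambda>x. v x - u x) \<le> snorm k l v + snorm k l ?u"
        unfolding eq using snorm_lincomb[OF v(1) mu, where a=1 and b=1 and k=k and l=l] by simp
      then have "snorm k l (\<lambda>x. v x - u x) \<le> b'" using v by simp
      then have "schwartz_seminorm k l (\<lambda>x. v x - u x) \<le> b"
        unfolding seminorm_eq_snorm[OF d] b' by (rule ennreal_leI)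
      then show ?thesis unfolding s using v b by auto
    qed
    then show ?case using lt by (intro exI[of _ k] exI[of _ l] exI[of _ "b' - snorm k l ?u"]) auto
  qed
qed

text \<open>Continuity at the origin and homogeneity. A function of vanishing seminorm may be scaled
  arbitrarily, so \<open>f\<close> vanishes on it.\<close>
lemma tempered_bound:
  fixes f :: "(real^'n \<Rightarrow> complex) \<Rightarrow> complex"
  assumes f: "f \<in> tempered_distributions"
  obtains C k l where "0 < C" "\<And>u. u \<in> schwartz \<Longrightarrow> cmod (f u) \<le> C * snorm k l u"
proof -
  have cont: "continuous_map schwartz_topology euclidean f"
    using f unfolding tempered_distributions_def by simp
  have sub: "schwartz \<subseteq> topspace (schwartz_topology :: (real^'n \<Rightarrow> complex) topology)"
  proof
    fix u :: "real^'n \<Rightarrow> complex" assume u: "u \<in> schwartz"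
    have "(\<lambda>x. u x - u x) = (\<lambda>x. 0)" by simp
    then have "schwartz_seminorm 0 0 (\<lambda>x. u x - u x) \<le> ennreal 0"
      by (intro seminorm_le) simp
    then have "u \<in> {v \<in> schwartz. schwartz_seminorm 0 0 (\<lambda>x. v x - u x) < 1}" using u by auto
    then show "u \<in> topspace schwartz_topology"
      unfolding schwartz_topology_def topology_generated_by_topspace using u zero_less_one by blast
  qed
  have "openin schwartz_topology {u \<in> topspace schwartz_topology. f u \<in> ball 0 1}"
    by (rule openin_continuous_map_preimage[OF cont]) simp
  from schwartz_topology_nhds[OF this] obtain k l e where e: "0 < e"
    and lt: "\<And>v. v \<in> schwartz \<Longrightarrow> snorm k l v < e \<Longrightarrow> cmod (f v) < 1"
    using tempered_zero[OF f] subsetD[OF sub schwartz_zero] subsetD[OF sub] by (auto, blast)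
  have scale: "c * cmod (f u) < 1" if u: "u \<in> schwartz" and c: "0 < c" "c * snorm k l u < e" for u c
  proof -
    have "snorm k l (\<lambda>x. of_real c * u x + 0 * u x) \<le> c * snorm k l u"
      using snorm_lincomb[OF u u, where a="of_real c" and b=0 and k=k and l=l] c by simp
    then have "cmod (f (\<lambda>x. of_real c * u x + 0 * u x)) < 1"
      using c by (intro lt schwartz_lincomb u) auto
    then show ?thesis unfolding tempered_lincomb[OF f u u] using c by (simp add: norm_mult)
  qed
  show ?thesis
  proof (rule that[of "2 / e" k l])
    fix u :: "real^'n \<Rightarrow> complex" assume u: "u \<in> schwartz"
    show "cmod (f u) \<le> 2 / e * snorm k l u"
    proof (cases "snorm k l u = 0")
      case True
      have "cmod (f u) = 0"
      proof (rule ccontr)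
        assume "cmod (f u) \<noteq> 0"
        then show False using scale[OF u, of "1 / cmod (f u)"] True e by simp
      qed
      then show ?thesis using True by simp
    next
      case False
      then have N: "0 < snorm k l u" using snorm_nonneg[of k l u] by linarith
      have "e / (2 * snorm k l u) * cmod (f u) < 1"
        using N e by (intro scale u) auto
      then show ?thesis using N e by (simp add: field_simps)
    qed
  qed (use e in simp)
qed

lemma temperedI:
  fixes f :: "(real^'n \<Rightarrow> complex) \<Rightarrow> complex"
  assumes lin: "\<And>u v a b. u \<in> schwartz \<Longrightarrow> v \<in> schwartz \<Longrightarrow> f (\<lambda>x. a * u x + b * v x) = a * f u + b * f v"
    and C: "0 < C" and bound: "\<And>u. u \<in> schwartz \<Longrightarrow> cmod (f u) \<le> C * snorm k l u"
  shows "f \<in> tempered_distributions"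
proof -
  have top: "topspace (schwartz_topology :: (real^'n \<Rightarrow> complex) topology) \<subseteq> schwartz"
    unfolding schwartz_topology_def topology_generated_by_topspace by blast
  have "continuous_map schwartz_topology euclidean f"
    unfolding continuous_map_def
  proof (intro conjI allI impI)
    fix U :: "complex set" assume "openin euclidean U"
    then have U: "open U" by simp
    show "openin schwartz_topology {x \<in> topspace schwartz_topology. f x \<in> U}"
    proof (subst openin_subopen, intro ballI)
      fix u assume "u \<in> {x \<in> topspace schwartz_topology. f x \<in> U}"
      then have u: "u \<in> schwartz" "f u \<in> U" using top by auto
      obtain e where e: "0 < e" "ball (f u) e \<subseteq> U" using U u(2) open_contains_ball by blast
      let ?T = "{v \<in> schwartz. schwartz_seminorm k l (\<lambda>x. v x - u x) < ennreal (e / C)}"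
      have T: "openin schwartz_topology ?T"
        unfolding schwartz_topology_def openin_topology_generated_by_iff
        using u(1) e C
        by (intro generate_topology_on.Basis CollectI exI[of _ "ennreal (e / C)"] exI[of _ l] exI[of _ k] exI[of _ u]) simp
      have "(\<lambda>x. u x - u x) = (\<lambda>x. 0)" by simp
      then have "schwartz_seminorm k l (\<lambda>x. u x - u x) \<le> ennreal 0"
      proof -
        have "snorm k l (\<lambda>x. u x - u x) \<le> 0"
          using snorm_lincomb[OF u(1) u(1), where a=0 and b=0 and k=k and l=l] by simp
        then have "snorm k l (\<lambda>x. u x - u x) = 0" using snorm_nonneg by (rule antisym)
        then show ?thesis using seminorm_eq_snorm[OF schwartz_diff[OF u(1) u(1)], of k l] by simp
      qed
      then have "u \<in> ?T" using u e C by (simp add: le_less_trans)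
      moreover have "?T \<subseteq> {x \<in> topspace schwartz_topology. f x \<in> U}"
      proof
        fix v assume v: "v \<in> ?T"
        then have vs: "v \<in> schwartz" by simp
        have d: "(\<lambda>x. v x - u x) \<in> schwartz" by (rule schwartz_diff[OF vs u(1)])
        have "snorm k l (\<lambda>x. v x - u x) < e / C"
          using v by (simp add: seminorm_eq_snorm[OF d] ennreal_less_iff)
        then have "C * snorm k l (\<lambda>x. v x - u x) < e" using C by (simp add: field_simps)
        moreover have "f (\<lambda>x. v x - u x) = f v - f u" using lin[OF vs u(1), of 1 "-1"] by simp
        ultimately have "dist (f u) (f v) < e"
          using bound[OF d] by (simp add: dist_norm norm_minus_commute)
        then show "v \<in> {x \<in> topspace schwartz_topology. f x \<in> U}"
          using e(2) openin_subset[OF T] v by auto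
      qed
      ultimately show "\<exists>T. openin schwartz_topology T \<and> u \<in> T \<and> T \<subseteq> {x \<in> topspace schwartz_topology. f x \<in> U}"
        using T by blast
    qed
  qed auto
  then show ?thesis unfolding tempered_distributions_def using lin by blast
qed

lemma dyadic_dilation_eq: "dyadic_dilation u j = (\<lambda>x. of_real (2 powi (j * int CARD('n))) * u (0 + (2 powi j) *\<^sub>R x))"
  for u :: "real^'n \<Rightarrow> complex"
  by (simp add: dyadic_dilation_def[abs_def])

lemma
  assumes "u \<in> schwartz"
  shows schwartz_cmult: "(\<lambda>x. a * u x) \<in> schwartz" and snorm_cmult: "snorm k l (\<lambda>x. a * u x) \<le> cmod a * snorm k l u"
  using schwartz_lincomb[OF assms assms, where a=a and b=0] snorm_lincomb[OF assms assms, where a=a and b=0 and k=k and l=l]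
  by simp_all

lemma schwartz_dyadic_dilation:
  assumes "u \<in> schwartz" shows "dyadic_dilation u j \<in> schwartz"
  unfolding dyadic_dilation_eq by (intro schwartz_cmult schwartz_affine assms) simp

lemma schwartz_dilation:
  fixes u :: "real^'n \<Rightarrow> complex"
  assumes "u \<in> schwartz" "0 < t" shows "dilation u t \<in> schwartz"
proof -
  have "dilation u t = (\<lambda>x. of_real (inverse (t ^ CARD('n))) * u (0 + inverse t *\<^sub>R x))"
    by (simp add: dilation_def[abs_def])
  moreover have "(\<lambda>x. of_real (inverse (t ^ CARD('n))) * u (0 + inverse t *\<^sub>R x)) \<in> schwartz"
    using assms by (intro schwartz_cmult schwartz_affine) auto
  ultimately show ?thesis by simp
qed

lemma tempered_rescale:
  fixes f :: "(real^'n \<Rightarrow> complex) \<Rightarrow> complex"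
  assumes f: "f \<in> tempered_distributions"
  shows "(\<lambda>u. f (dyadic_dilation u j)) \<in> tempered_distributions"
proof -
  obtain C k l where C: "0 < C" "\<And>u. u \<in> schwartz \<Longrightarrow> cmod (f u) \<le> C * snorm k l u"
    using tempered_bound[OF f] by blast
  let ?K = "cmod (of_real (2 powi (j * int CARD('n)))) * ((1 + norm (0::real^'n)) ^ k * (1 + \<bar>1 / 2 powi j\<bar>) ^ k * (1 + \<bar>2 powi j\<bar>) ^ l)"
  show ?thesis
  proof (rule temperedI[where C="C * ?K" and k=k and l=l])
    show "0 < C * ?K" using C(1) by (intro mult_pos_pos zero_less_power) (auto simp: add_pos_nonneg)
  next
    fix u v :: "real^'n \<Rightarrow> complex" and a b
    assume u: "u \<in> schwartz" and v: "v \<in> schwartz"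
    have "dyadic_dilation (\<lambda>x. a * u x + b * v x) j = (\<lambda>x. a * dyadic_dilation u j x + b * dyadic_dilation v j x)"
      by (simp add: dyadic_dilation_def[abs_def] algebra_simps)
    then show "f (dyadic_dilation (\<lambda>x. a * u x + b * v x) j) = a * f (dyadic_dilation u j) + b * f (dyadic_dilation v j)"
      using tempered_lincomb[OF f schwartz_dyadic_dilation[OF u] schwartz_dyadic_dilation[OF v]] by simp
  next
    fix u :: "real^'n \<Rightarrow> complex"
    assume u: "u \<in> schwartz"
    have "snorm k l (dyadic_dilation u j) \<le> ?K * snorm k l u"
      unfolding dyadic_dilation_eq
      by (rule order_trans[OF snorm_cmult[OF schwartz_affine[OF u]]])
         (simp, simp only: mult.assoc, intro mult_left_mono order_trans[OF snorm_affine[OF u]], simp_all)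
    then have "C * snorm k l (dyadic_dilation u j) \<le> C * (?K * snorm k l u)" using C(1) by (intro mult_left_mono) auto
    then show "cmod (f (dyadic_dilation u j)) \<le> C * ?K * snorm k l u"
      using C(2)[OF schwartz_dyadic_dilation[OF u, of j]] by (simp only: mult.assoc)
  qed
qed

lemma schwartz_reflect: "u \<in> schwartz \<Longrightarrow> (\<lambda>y. u (x - y)) \<in> schwartz"
  using schwartz_affine[where u=u and c="-1" and a=x] by simp

lemma partial_derivs_reflect:
  assumes "u \<in> schwartz"
  shows "partial_derivs \<beta> (\<lambda>y. u (x - y)) = (\<lambda>y. (-1) ^ length \<beta> * partial_derivs \<beta> u (x - y))"
  using partial_derivs_affine[OF schwartz_smooth[OF assms], of \<beta> x "-1"] by simp

text \<open>Dependence of \<open>u(x - \<cdot>)\<close> on \<open>x\<close>. Both the continuity of \<open>x \<mapsto> f * u(x)\<close> and the interchange of \<open>f\<close> with a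
  convolution integral rest on it.\<close>
lemma translate_difference_bound:
  fixes u :: "real^'n \<Rightarrow> complex"
  assumes u: "u \<in> schwartz" and \<beta>: "length \<beta> \<le> l"
  shows "(1 + norm y) ^ k * cmod (partial_derivs \<beta> u (x' - y) - partial_derivs \<beta> u (x - y)) \<le>
     (1 + norm x) ^ k * (real CARD('n) * norm (x' - x) * (1 + norm (x' - x)) ^ k * snorm k (Suc l) u)"
proof -
  have "1 + norm (x + (y - x)) \<le> (1 + norm x) * (1 + norm (y - x))" by (rule one_plus_norm_mult)
  then have "(1 + norm y) ^ k \<le> ((1 + norm x) * (1 + norm (x - y))) ^ k"
    by (intro power_mono) (auto simp: norm_minus_commute)
  then have "(1 + norm y) ^ k * cmod (partial_derivs \<beta> u (x' - y) - partial_derivs \<beta> u (x - y)) \<le>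
     (1 + norm x) ^ k * ((1 + norm (x - y)) ^ k * cmod (partial_derivs \<beta> u (x' - y) - partial_derivs \<beta> u (x - y)))"
    unfolding power_mult_distrib mult.assoc[symmetric] by (rule mult_right_mono) simp
  also have "\<dots> \<le> (1 + norm x) ^ k * (real CARD('n) * norm (x' - x) * (1 + norm (x' - x)) ^ k * snorm k (Suc l) u)"
    using schwartz_lipschitz[OF u \<beta>, of "x - y" k "x' - y"] by (intro mult_left_mono) (auto simp: algebra_simps)
  finally show ?thesis .
qed

lemma dist_conv_growth:
  fixes f :: "(real^'n \<Rightarrow> complex) \<Rightarrow> complex"
  assumes f: "f \<in> tempered_distributions" and u: "u \<in> schwartz"
  obtains C k where "0 \<le> C" "\<And>x. cmod (dist_conv u f x) \<le> C * (1 + norm x) ^ k"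
proof -
  obtain C k l where C: "0 < C" "\<And>u. u \<in> schwartz \<Longrightarrow> cmod (f u) \<le> C * snorm k l u"
    using tempered_bound[OF f] by blast
  show ?thesis
  proof (rule that[of "C * 2 ^ k * 2 ^ l * snorm k l u" k])
    fix x :: "real^'n"
    have "cmod (dist_conv u f x) \<le> C * snorm k l (\<lambda>y. u (x - y))"
      unfolding dist_conv_def by (intro C schwartz_reflect u)
    also have "snorm k l (\<lambda>y. u (x - y)) \<le> (1 + norm x) ^ k * 2 ^ k * 2 ^ l * snorm k l u"
      using snorm_affine[OF u, where c="-1" and k=k and l=l and a=x] by simp
    finally show "cmod (dist_conv u f x) \<le> C * 2 ^ k * 2 ^ l * snorm k l u * (1 + norm x) ^ k"
      using C(1) by (simp add: mult_ac)
  qed (use C(1) in simp)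
qed

lemma dist_conv_continuous:
  fixes f :: "(real^'n \<Rightarrow> complex) \<Rightarrow> complex"
  assumes f: "f \<in> tempered_distributions" and u: "u \<in> schwartz"
  shows "continuous_on UNIV (dist_conv u f)"
proof -
  obtain C k l where C: "0 < C" "\<And>u. u \<in> schwartz \<Longrightarrow> cmod (f u) \<le> C * snorm k l u"
    using tempered_bound[OF f] by blast
  have "isCont (dist_conv u f) x" for x
  proof -
    let ?b = "\<lambda>x'. C * ((1 + norm x) ^ k * (real CARD('n) * norm (x' - x) * (1 + norm (x' - x)) ^ k * snorm k (Suc l) u))"
    have le: "norm (dist_conv u f x' - dist_conv u f x) \<le> ?b x'" for x'
    proof -
      let ?d = "\<lambda>y. u (x' - y) - u (x - y)"
      have d: "?d \<in> schwartz" by (intro schwartz_diff schwartz_reflect u)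
      have "dist_conv u f x' - dist_conv u f x = f ?d"
        unfolding dist_conv_def by (rule tempered_diff[symmetric, OF f schwartz_reflect[OF u] schwartz_reflect[OF u]])
      also have "norm (f ?d) \<le> C * snorm k l ?d" by (rule C(2)[OF d])
      also have "\<dots> \<le> ?b x'"
      proof (intro mult_left_mono snorm_le)
        fix y and \<beta> :: "'n list" assume \<beta>: "length \<beta> \<le> l"
        have "partial_derivs \<beta> ?d = (\<lambda>y. (-1) ^ length \<beta> * (partial_derivs \<beta> u (x' - y) - partial_derivs \<beta> u (x - y)))"
          using partial_derivs_lincomb[OF schwartz_smooth[OF schwartz_reflect[OF u]] schwartz_smooth[OF schwartz_reflect[OF u]], of \<beta> 1 x' "-1" x]
          unfolding partial_derivs_reflect[OF u] by (simp add: algebra_simps)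
        then show "(1 + norm y) ^ k * cmod (partial_derivs \<beta> ?d y) \<le> (1 + norm x) ^ k * (real CARD('n) * norm (x' - x) * (1 + norm (x' - x)) ^ k * snorm k (Suc l) u)"
          using translate_difference_bound[OF u \<beta>, of y k x' x] by (simp add: norm_mult norm_power)
      qed (use C(1) in simp)
      finally show ?thesis .
    qed
    have "((\<lambda>x'. ?b x') \<longlongrightarrow> 0) (at x)"
      by (rule tendsto_eq_intros refl | simp)+
    then have "((\<lambda>x'. dist_conv u f x' - dist_conv u f x) \<longlongrightarrow> 0) (at x)"
      by (rule Lim_null_comparison[rotated]) (use le in auto)
    then show ?thesis unfolding isCont_def by (simp add: LIM_zero_iff)
  qed
  then show ?thesis by (simp add: continuous_at_imp_continuous_on)
qed

lemma test_functions_subset_schwartz: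
  fixes u :: "real^'n \<Rightarrow> complex"
  assumes "u \<in> test_functions"
  shows "u \<in> schwartz"
proof (rule schwartzI_each)
  show sm: "smooth u" using assms unfolding test_functions_def by simp
  fix k and \<beta> :: "'n list"
  have K: "compact (supp u)" using assms unfolding test_functions_def by simp
  have zero: "partial_derivs \<beta> u x = 0" if "x \<notin> supp u" for x \<beta>
    using that
  proof (induction \<beta> arbitrary: x)
    case Nil
    then show ?case unfolding supp_def using closure_subset[of "{x. u x \<noteq> 0}"] by auto
  next
    case (Cons i \<beta>)
    have "open (- supp u)" using K by (simp add: compact_imp_closed open_Compl)
    then have "((\<lambda>x. 0) has_derivative (\<lambda>h. \<Sum>i\<in>UNIV. h $ i *\<^sub>R partial_deriv i (partial_derivs \<beta> u) x)) (at x)"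
      using Cons by (intro has_derivative_transform_within_open[OF smooth_has_derivative[OF smooth_partial_derivs[OF sm]], of "- supp u"]) auto
    then have "(\<lambda>h. \<Sum>i\<in>UNIV. h $ i *\<^sub>R partial_deriv i (partial_derivs \<beta> u) x) = (\<lambda>h. 0)"
      using has_derivative_unique has_derivative_const by blast
    then have "((\<lambda>x. 0 :: complex) has_derivative (\<lambda>h. \<Sum>i\<in>UNIV. h $ i *\<^sub>R partial_deriv i (partial_derivs \<beta> u) x)) (at x)" by simp
    then have "partial_deriv i (\<lambda>x. 0 :: complex) x = partial_deriv i (partial_derivs \<beta> u) x"
      by (rule partial_deriv_of_has_derivative)
    then show ?case unfolding partial_derivs_Cons by (simp add: partial_deriv_def frechet_derivative_const)
  qed
  have "continuous_on (supp u) (\<lambda>x. (1 + norm x) ^ k *\<^sub>R partial_derivs \<beta> u x)"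
    by (intro continuous_intros smooth_continuous smooth_partial_derivs sm)
  then have "bounded ((\<lambda>x. (1 + norm x) ^ k *\<^sub>R partial_derivs \<beta> u x) ` supp u)"
    using K compact_continuous_image compact_imp_bounded by blast
  then obtain c where c: "0 < c" "\<And>x. x \<in> supp u \<Longrightarrow> norm ((1 + norm x) ^ k *\<^sub>R partial_derivs \<beta> u x) \<le> c"
    by (auto simp: bounded_pos)
  have "(1 + norm x) ^ k * cmod (partial_derivs \<beta> u x) \<le> c" for x
    using c(2)[of x] zero[of x \<beta>] c(1) by (cases "x \<in> supp u") (auto simp: norm_power)
  then show "\<exists>c. \<forall>x. (1 + norm x) ^ k * cmod (partial_derivs \<beta> u x) \<le> c" by blast
qed

section \<open>Integrable kernels and mollification\<close>

lemma nn_integral_lebesgue_affine: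
  fixes f :: "real^'n \<Rightarrow> ennreal"
  assumes f [measurable]: "f \<in> borel_measurable lebesgue" and c: "c \<noteq> 0"
  shows "(\<integral>\<^sup>+x. f x \<partial>lebesgue) = ennreal (\<bar>c\<bar> ^ CARD('n)) * (\<integral>\<^sup>+x. f (a + c *\<^sub>R x) \<partial>lebesgue)"
proof -
  have T: "(\<lambda>x :: real^'n. a + (\<Sum>j\<in>Basis. (c * (x \<bullet> j)) *\<^sub>R j)) = (\<lambda>x. a + c *\<^sub>R x)"
    unfolding scaleR_scaleR[symmetric] scaleR_sum_right[symmetric] euclidean_representation ..
  have m [measurable]: "(\<lambda>x :: real^'n. a + c *\<^sub>R x) \<in> lebesgue \<rightarrow>\<^sub>M lebesgue"
    using lebesgue_affine_measurable[of "\<lambda>_ :: real^'n. c" a] c unfolding T by simp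
  have L: "lebesgue = density (distr lebesgue lebesgue (\<lambda>x :: real^'n. a + c *\<^sub>R x)) (\<lambda>_. ennreal (\<bar>c\<bar> ^ CARD('n)))"
    using lebesgue_affine_euclidean[of "\<lambda>_ :: real^'n. c" a] c unfolding T by simp
  show ?thesis
    by (subst L) (simp add: nn_integral_density nn_integral_distr nn_integral_cmult)
qed

lemma integral_lborel_affine:
  fixes f :: "real^'n \<Rightarrow> complex"
  assumes f [measurable]: "f \<in> borel_measurable borel" and c: "c \<noteq> 0"
  shows "(LINT x|lborel. f x) = \<bar>c\<bar> ^ CARD('n) *\<^sub>R (LINT x|lborel. f (a + c *\<^sub>R x))"
  by (subst lborel_affine[OF c, of a]) (simp add: integral_density integral_distr)

lemma term_le_suminf: "f i \<le> (\<Sum>i. f i)" for f :: "nat \<Rightarrow> ennreal"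
  using sum_le_suminf[of f "{i}"] by simp

text \<open>The kernel is dominated by \<open>2\<^sup>n\<^sup>+\<^sup>1 \<Sum>\<^sub>i 2\<^sup>-\<^sup>i\<^sup>(\<^sup>n\<^sup>+\<^sup>1\<^sup>) 1\<^sub>B\<^sub>(\<^sub>y\<^sub>,\<^sub>2\<^sup>i\<^sub>)\<close>, and the ball of radius \<open>2\<^sup>i + 2\<close> about \<open>y\<close> contains \<open>x\<close> and has
  volume at most a constant times \<open>2\<^sup>n\<^sup>i\<close>.\<close>
lemma polynomial_kernel_maxop:
  fixes h :: "real^'n \<Rightarrow> ennreal"
  shows "\<exists>K>0. \<forall>(h :: real^'n \<Rightarrow> ennreal) x y. h \<in> borel_measurable lebesgue \<longrightarrow> dist x y < 2 \<longrightarrow>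
    (\<integral>\<^sup>+z. ennreal (1 / (1 + norm (y - z)) ^ (CARD('n) + 1)) * h z \<partial>lebesgue) \<le> ennreal K * maxop h x"
proof -
  let ?n = "CARD('n)"
  let ?v = "unit_ball_vol (real ?n)"
  let ?c = "\<lambda>i::nat. 2 ^ (?n + 1) * (1 / 2 ^ (?n + 1)) ^ i :: real"
  have v: "0 < ?v" by (simp add: unit_ball_vol_pos)
  have ballm [measurable]: "ball c r \<in> sets lebesgue" for c :: "real^'n" and r by simp
  have point: "ennreal (1 / (1 + norm (y - z)) ^ (?n + 1)) \<le> (\<Sum>i. ennreal (?c i) * indicator (ball y (2 ^ i)) z)" for y z :: "real^'n"
  proof -
    obtain j where j: "norm (y - z) < 2 ^ j" using real_arch_pow[of 2] by auto
    define i where "i = (LEAST i. norm (y - z) < 2 ^ i)"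
    have i: "norm (y - z) < 2 ^ i" unfolding i_def using j by (rule LeastI)
    have "(2::real) ^ i \<le> 2 * (1 + norm (y - z))"
    proof (cases i)
      case (Suc k)
      then have "\<not> norm (y - z) < 2 ^ k" using not_less_Least[of k "\<lambda>i. norm (y - z) < 2 ^ i"] unfolding i_def by simp
      then show ?thesis using Suc by simp
    qed simp
    then have "((2::real) ^ i) ^ (?n + 1) \<le> (2 * (1 + norm (y - z))) ^ (?n + 1)"
      by (intro power_mono) auto
    then have le: "((2::real) ^ i) ^ (?n + 1) \<le> 2 ^ (?n + 1) * (1 + norm (y - z)) ^ (?n + 1)"
      by (simp only: power_mult_distrib)
    have p: "0 < (1 + norm (y - z)) ^ (?n + 1)" by (intro zero_less_power) (simp add: add_pos_nonneg)
    have "1 / (1 + norm (y - z)) ^ (?n + 1) \<le> ?c i"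
    proof -
      have "?c i = 2 ^ (?n + 1) / ((2::real) ^ i) ^ (?n + 1)"
        by (simp add: power_divide power_mult[symmetric] mult.commute)
      then show ?thesis using le p by (simp add: field_simps)
    qed
    then have "ennreal (1 / (1 + norm (y - z)) ^ (?n + 1)) \<le> ennreal (?c i) * indicator (ball y (2 ^ i)) z"
      using i by (simp add: dist_norm ennreal_leI)
    also have "\<dots> \<le> (\<Sum>i. ennreal (?c i) * indicator (ball y (2 ^ i)) z)"
      by (rule term_le_suminf)
    finally show ?thesis .
  qed
  show ?thesis
  proof (intro exI[of _ "2 ^ (?n + 1) * (?v * 3 ^ ?n) * 2"] conjI allI impI)
    show "0 < 2 ^ (?n + 1) * (?v * 3 ^ ?n) * 2" using v by simp
    fix h :: "real^'n \<Rightarrow> ennreal" and x y :: "real^'n"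
    assume h [measurable]: "h \<in> borel_measurable lebesgue" and xy: "dist x y < 2"
    have ball: "(\<integral>\<^sup>+z\<in>ball y (2 ^ i). h z \<partial>lebesgue) \<le> ennreal (?v * 3 ^ ?n * (2 ^ ?n) ^ i) * maxop h x" for i :: nat
    proof -
      have one: "(1::real) \<le> 2 ^ i" by simp
      have xin: "x \<in> ball y (2 ^ i + 2)" unfolding mem_ball using xy one by (subst dist_commute) linarith
      have "(\<integral>\<^sup>+z\<in>ball y (2 ^ i). h z \<partial>lebesgue) \<le> (\<integral>\<^sup>+z\<in>ball y (2 ^ i + 2). h z \<partial>lebesgue)"
        by (intro nn_integral_mono mult_left_mono) (auto simp: indicator_def)
      also have "\<dots> \<le> emeasure lebesgue (ball y (2 ^ i + 2)) * maxop h x"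
        by (rule integral_ball_le_maxop[OF xin])
      also have "\<dots> \<le> ennreal (?v * 3 ^ ?n * (2 ^ ?n) ^ i) * maxop h x"
      proof (rule mult_right_mono)
        have "0 < (2::real) ^ i + 2" by (simp add: add_pos_pos)
        then have "emeasure lebesgue (ball y (2 ^ i + 2)) = ennreal (?v * (2 ^ i + 2) ^ ?n)"
          by (rule emeasure_lebesgue_ball)
        also have "\<dots> \<le> ennreal (?v * (3 * 2 ^ i) ^ ?n)"
          using v one by (intro ennreal_leI mult_left_mono power_mono) auto
        also have "?v * (3 * 2 ^ i) ^ ?n = ?v * 3 ^ ?n * (2 ^ ?n) ^ i"
          by (simp add: power_mult_distrib power_mult[symmetric] mult.commute)
        finally show "emeasure lebesgue (ball y (2 ^ i + 2)) \<le> ennreal (?v * 3 ^ ?n * (2 ^ ?n) ^ i)" .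
      qed simp
      finally show ?thesis .
    qed
    have "(\<integral>\<^sup>+z. ennreal (1 / (1 + norm (y - z)) ^ (?n + 1)) * h z \<partial>lebesgue) \<le>
       (\<integral>\<^sup>+z. (\<Sum>i. ennreal (?c i) * (h z * indicator (ball y (2 ^ i)) z)) \<partial>lebesgue)"
    proof (rule nn_integral_mono)
      fix z
      have "ennreal (1 / (1 + norm (y - z)) ^ (?n + 1)) * h z \<le> (\<Sum>i. ennreal (?c i) * indicator (ball y (2 ^ i)) z) * h z"
        by (rule mult_right_mono[OF point]) simp
      also have "\<dots> = (\<Sum>i. ennreal (?c i) * (h z * indicator (ball y (2 ^ i)) z))"
        by (simp add: ennreal_suminf_multc[symmetric] mult_ac)
      finally show "ennreal (1 / (1 + norm (y - z)) ^ (?n + 1)) * h z \<le> (\<Sum>i. ennreal (?c i) * (h z * indicator (ball y (2 ^ i)) z))" .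
    qed
    also have "\<dots> = (\<Sum>i. ennreal (?c i) * (\<integral>\<^sup>+z\<in>ball y (2 ^ i). h z \<partial>lebesgue))"
      by (subst nn_integral_suminf) (auto simp: nn_integral_cmult)
    also have "\<dots> \<le> (\<Sum>i. ennreal (?c i) * (ennreal (?v * 3 ^ ?n * (2 ^ ?n) ^ i) * maxop h x))"
      by (intro suminf_le mult_left_mono ball) auto
    also have "\<dots> = (\<Sum>i. ennreal (2 ^ (?n + 1) * (?v * 3 ^ ?n)) * maxop h x * ennreal ((1 / 2) ^ i))"
    proof (rule suminf_cong)
      fix i
      have "?c i * (?v * 3 ^ ?n * (2 ^ ?n) ^ i) = 2 ^ (?n + 1) * (?v * 3 ^ ?n) * (1 / 2) ^ i"
        by (simp add: power_divide power_mult_distrib)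
      moreover have B: "0 \<le> ?v * 3 ^ ?n * (2 ^ ?n) ^ i" "0 \<le> ((1::real) / 2) ^ i" using v by auto
      ultimately have X: "ennreal (?c i) * ennreal (?v * 3 ^ ?n * (2 ^ ?n) ^ i) = ennreal (2 ^ (?n + 1) * (?v * 3 ^ ?n)) * ennreal ((1 / 2) ^ i)"
        unfolding ennreal_mult''[OF B(1), symmetric] ennreal_mult''[OF B(2), symmetric] by simp
      show "ennreal (?c i) * (ennreal (?v * 3 ^ ?n * (2 ^ ?n) ^ i) * maxop h x) =
          ennreal (2 ^ (?n + 1) * (?v * 3 ^ ?n)) * maxop h x * ennreal ((1 / 2) ^ i)"
        unfolding mult.assoc[symmetric, of "ennreal (?c i)"] X by (simp only: mult_ac)
    qed
    also have "\<dots> = ennreal (2 ^ (?n + 1) * (?v * 3 ^ ?n)) * maxop h x * (\<Sum>i. ennreal ((1 / 2) ^ i))"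
      by (rule ennreal_suminf_cmult)
    also have "(\<Sum>i. ennreal ((1 / 2) ^ i)) = ennreal 2"
      using geometric_sums[of "1/2 :: real"] by (intro suminf_ennreal_eq) auto
    finally show "(\<integral>\<^sup>+z. ennreal (1 / (1 + norm (y - z)) ^ (?n + 1)) * h z \<partial>lebesgue) \<le> ennreal (2 ^ (?n + 1) * (?v * 3 ^ ?n) * 2) * maxop h x"
      using v by (simp add: ennreal_mult'' mult_ac)
  qed
qed

text \<open>With this bound, the kernel estimate for \<open>h = 1\<close> says that the kernel is integrable.\<close>
lemma maxop_one: "maxop (\<lambda>x :: real^'n. 1) x \<le> 1"
  unfolding maxop_def
proof (rule SUP_least, clarify)
  fix c :: "real^'n" and r assume "x \<in> ball c r"
  then have r: "0 < r" by (metis ball_eq_empty emptyE not_le)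
  have m: "ball c r \<in> sets lebesgue" by simp
  have "(\<integral>\<^sup>+y\<in>ball c r. 1 \<partial>lebesgue) = emeasure lebesgue (ball c r)"
    using m by (simp only: mult_1 nn_integral_indicator)
  then show "(\<integral>\<^sup>+y\<in>ball c r. 1 \<partial>lebesgue) / emeasure lebesgue (ball c r) \<le> 1"
    using ennreal_divide_self[of "emeasure lebesgue (ball c r)"] emeasure_ball_pos_finite[OF r, of c] by simp
qed

lemma integrable_of_decay:
  fixes g :: "real^'n \<Rightarrow> 'b::{banach, second_countable_topology}"
  assumes [measurable]: "g \<in> borel_measurable borel"
    and le: "\<And>z. (1 + norm z) ^ (CARD('n) + 1) * norm (g z) \<le> C"
  shows "integrable lborel g"
proof (rule integrableI_bounded)
  show "g \<in> borel_measurable lborel" by simp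
  have C: "0 \<le> C" using le[of 0] order_trans[OF _ le[of 0], of 0] by simp
  obtain K where K: "0 < K" "\<And>(h :: real^'n \<Rightarrow> ennreal) x y. h \<in> borel_measurable lebesgue \<Longrightarrow> dist x y < 2 \<Longrightarrow>
    (\<integral>\<^sup>+z. ennreal (1 / (1 + norm (y - z)) ^ (CARD('n) + 1)) * h z \<partial>lebesgue) \<le> ennreal K * maxop h x"
    using polynomial_kernel_maxop by blast
  have point: "ennreal (norm (g z)) \<le> ennreal C * (ennreal (1 / (1 + norm ((0::real^'n) - z)) ^ (CARD('n) + 1)) * 1)" for z
  proof -
    have p: "0 < (1 + norm z) ^ (CARD('n) + 1)" by (intro zero_less_power) (simp add: add_pos_nonneg)
    have "norm (g z) \<le> C * (1 / (1 + norm z) ^ (CARD('n) + 1))"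
      using le[of z] p by (simp add: field_simps)
    then show ?thesis using C by (simp add: ennreal_mult'[symmetric] ennreal_leI)
  qed
  have "(\<integral>\<^sup>+z. ennreal (norm (g z)) \<partial>lebesgue) \<le> (\<integral>\<^sup>+z. ennreal C * (ennreal (1 / (1 + norm ((0::real^'n) - z)) ^ (CARD('n) + 1)) * 1) \<partial>lebesgue)"
    by (rule nn_integral_mono) (rule point)
  also have "\<dots> = ennreal C * (\<integral>\<^sup>+z. (ennreal (1 / (1 + norm ((0::real^'n) - z)) ^ (CARD('n) + 1)) * 1) \<partial>lebesgue)"
    by (rule nn_integral_cmult) (rule measurable_completion, measurable)
  also have "\<dots> \<le> ennreal C * (ennreal K * 1)"
    by (intro mult_left_mono order_trans[OF K(2)[of "\<lambda>_. 1" 0 0]] maxop_one) auto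
  also have "\<dots> < \<infinity>" by (simp add: ennreal_mult_less_top)
  finally show "(\<integral>\<^sup>+z. ennreal (norm (g z)) \<partial>lborel) < \<infinity>"
    by (subst (asm) nn_integral_completion) auto
qed

lemma schwartz_measurable [measurable]: "u \<in> schwartz \<Longrightarrow> u \<in> borel_measurable borel"
  by (intro borel_measurable_continuous_onI smooth_continuous schwartz_smooth)

lemma cmod_one_plus_norm [simp]: "cmod (1 + complex_of_real (norm x)) = 1 + norm x"
proof -
  have "cmod (complex_of_real (1 + norm x)) = 1 + norm x" unfolding norm_of_real by simp
  then show ?thesis by simp
qed

lemma schwartz_times_growth_integrable:
  fixes u :: "real^'n \<Rightarrow> complex" and g :: "real^'n \<Rightarrow> complex"
  assumes u: "u \<in> schwartz" and g [measurable]: "g \<in> borel_measurable borel"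
    and le: "\<And>z. norm (g z) \<le> C * (1 + norm z) ^ k"
  shows "integrable lborel (\<lambda>z. u z * g z)"
proof (rule integrable_of_decay)
  show "(\<lambda>z. u z * g z) \<in> borel_measurable borel" using u by measurable
  fix z
  have C: "0 \<le> C" using le[of 0] order_trans[OF norm_ge_zero le[of 0]] by simp
  have "(1 + norm z) ^ (CARD('n) + 1) * norm (u z * g z) \<le> (1 + norm z) ^ (CARD('n) + 1) * (norm (u z) * (C * (1 + norm z) ^ k))"
    unfolding norm_mult by (intro mult_left_mono le) auto
  also have "\<dots> = C * ((1 + norm z) ^ (CARD('n) + 1 + k) * cmod (partial_derivs [] u z))"
    by (simp add: power_add mult_ac)
  also have "\<dots> \<le> C * snorm (CARD('n) + 1 + k) 0 u"
    using C by (intro mult_left_mono snorm_bound u) auto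
  finally show "(1 + norm z) ^ (CARD('n) + 1) * norm (u z * g z) \<le> C * snorm (CARD('n) + 1 + k) 0 u" .
qed

definition absmoment :: "(real^'n \<Rightarrow> complex) \<Rightarrow> nat \<Rightarrow> real" where
  "absmoment u k = (LINT z|lborel. cmod (u z) * (1 + norm z) ^ k)"

lemma absmoment_integrable:
  fixes u :: "real^'n \<Rightarrow> complex"
  assumes u: "u \<in> schwartz"
  shows "integrable lborel (\<lambda>z. cmod (u z) * (1 + norm z) ^ k)"
proof -
  have "integrable lborel (\<lambda>z. u z * of_real ((1 + norm z) ^ k))"
    by (rule schwartz_times_growth_integrable[OF u, where C=1 and k=k]) (auto simp: norm_power)
  from integrable_norm[OF this] show ?thesis by (simp add: norm_mult norm_power)
qed

lemma absmoment_nonneg: "0 \<le> absmoment u k"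
  unfolding absmoment_def by (intro integral_nonneg_AE) auto

lemma norm_integral_le_absmoment:
  fixes u g :: "real^'n \<Rightarrow> complex"
  assumes u: "u \<in> schwartz" and g: "g \<in> borel_measurable borel"
    and le: "\<And>z. norm (g z) \<le> C * (1 + norm z) ^ k"
  shows "cmod (LINT z|lborel. u z * g z) \<le> C * absmoment u k"
proof -
  have "cmod (LINT z|lborel. u z * g z) \<le> (LINT z|lborel. norm (u z * g z))"
    by (rule integral_norm_bound)
  also have "\<dots> \<le> (LINT z|lborel. C * (cmod (u z) * (1 + norm z) ^ k))"
  proof (rule integral_mono)
    show "integrable lborel (\<lambda>z. norm (u z * g z))"
      by (rule integrable_norm[OF schwartz_times_growth_integrable[OF u g le]])
    show "integrable lborel (\<lambda>z. C * (cmod (u z) * (1 + norm z) ^ k))"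
      by (intro integrable_mult_right absmoment_integrable u)
    show "norm (u z * g z) \<le> C * (cmod (u z) * (1 + norm z) ^ k)" for z
      using mult_left_mono[OF le[of z], of "cmod (u z)"] by (simp add: norm_mult mult_ac)
  qed
  also have "\<dots> = C * absmoment u k" unfolding absmoment_def by simp
  finally show ?thesis .
qed

text \<open>The convolution \<open>\<phi>\<^sub>s * u\<close> with \<open>\<phi>\<^sub>s = s\<^sup>-\<^sup>n \<phi>(\<cdot>/s)\<close>, after a change of variables that puts the scale into the
  argument of \<open>u\<close>: in this form differentiation, smallness in \<open>s\<close> and commutation are immediate.\<close>
definition mollify :: "(real^'n \<Rightarrow> complex) \<Rightarrow> real \<Rightarrow> (real^'n \<Rightarrow> complex) \<Rightarrow> real^'n \<Rightarrow> complex" where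
  "mollify \<phi> s u x = (LINT w|lborel. \<phi> w * u (x - s *\<^sub>R w))"

lemma snorm_sup: "u \<in> schwartz \<Longrightarrow> cmod (u x) \<le> snorm 0 0 u"
  using snorm_bound[of u "[]" 0 x 0] by simp

lemma schwartz_comp_measurable:
  assumes "u \<in> schwartz" shows "(\<lambda>w. u (x - s *\<^sub>R w)) \<in> borel_measurable borel"
  using schwartz_measurable[OF assms] by measurable

lemma mollify_integrable:
  fixes \<phi> u :: "real^'n \<Rightarrow> complex"
  assumes "\<phi> \<in> schwartz" "u \<in> schwartz"
  shows "integrable lborel (\<lambda>w. \<phi> w * u (x - s *\<^sub>R w))"
  by (rule schwartz_times_growth_integrable[OF assms(1) schwartz_comp_measurable[OF assms(2)], where k=0 and C="snorm 0 0 u"])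
     (simp add: snorm_sup assms)

lemma mollify_has_derivative:
  fixes \<phi> u :: "real^'n \<Rightarrow> complex"
  assumes \<phi>: "\<phi> \<in> schwartz" and u: "u \<in> schwartz"
  shows "(mollify \<phi> s u has_derivative (\<lambda>h. \<Sum>i\<in>UNIV. h $ i *\<^sub>R mollify \<phi> s (partial_deriv i u) x)) (at x)"
proof -
  let ?D = "\<lambda>h. \<Sum>i\<in>UNIV. h $ i *\<^sub>R mollify \<phi> s (partial_deriv i u) x"
  let ?K = "(real CARD('n))\<^sup>2 * snorm 0 2 u * absmoment \<phi> 0"
  have du: "partial_deriv i u \<in> schwartz" for i unfolding partial_deriv_eq by (rule schwartz_partial_derivs[OF u])
  have lin: "bounded_linear ?D"
    by (intro bounded_linear_sum bounded_linear_compose[OF bounded_linear_scaleR_left] bounded_linear_vec_nth)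
  have est: "norm (mollify \<phi> s u (x + h) - mollify \<phi> s u x - ?D h) \<le> ?K * (norm h)\<^sup>2" for h
  proof -
    have "mollify \<phi> s u (x + h) - mollify \<phi> s u x - ?D h =
       (LINT w|lborel. \<phi> w * u (x + h - s *\<^sub>R w)) - (LINT w|lborel. \<phi> w * u (x - s *\<^sub>R w))
        - (LINT w|lborel. (\<Sum>i\<in>UNIV. h $ i *\<^sub>R (\<phi> w * partial_deriv i u (x - s *\<^sub>R w))))"
      unfolding mollify_def using mollify_integrable[OF \<phi> du] by (subst Bochner_Integration.integral_sum) auto
    also have "\<dots> = (LINT w|lborel. \<phi> w * u (x + h - s *\<^sub>R w) - \<phi> w * u (x - s *\<^sub>R w)
        - (\<Sum>i\<in>UNIV. h $ i *\<^sub>R (\<phi> w * partial_deriv i u (x - s *\<^sub>R w))))"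
      using mollify_integrable[OF \<phi> du] mollify_integrable[OF \<phi> u] by (simp add: Bochner_Integration.integral_diff)
    also have "\<dots> = (LINT w|lborel. \<phi> w * (u ((x - s *\<^sub>R w) + h) - u (x - s *\<^sub>R w) - (\<Sum>i\<in>UNIV. h $ i *\<^sub>R partial_deriv i u (x - s *\<^sub>R w))))"
      by (intro Bochner_Integration.integral_cong) (auto simp: algebra_simps sum_distrib_left)
    also have "norm \<dots> \<le> ((real CARD('n))\<^sup>2 * snorm 0 2 u * (norm h)\<^sup>2) * absmoment \<phi> 0"
    proof (rule norm_integral_le_absmoment[OF \<phi>])
      have [measurable]: "u \<in> borel_measurable borel" "\<And>i. partial_deriv i u \<in> borel_measurable borel"
        using u du by (auto intro: schwartz_measurable)
      show "(\<lambda>w. u ((x - s *\<^sub>R w) + h) - u (x - s *\<^sub>R w) - (\<Sum>i\<in>UNIV. h $ i *\<^sub>R partial_deriv i u (x - s *\<^sub>R w))) \<in> borel_measurable borel"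
        by measurable
    qed (use schwartz_taylor[OF u] in simp)
    finally show ?thesis by (simp add: mult_ac)
  qed
  have "((\<lambda>y. norm (mollify \<phi> s u y - mollify \<phi> s u x - ?D (y - x)) / norm (y - x)) \<longlongrightarrow> 0) (at x)"
  proof (rule Lim_null_comparison)
    show "\<forall>\<^sub>F y in at x. norm (norm (mollify \<phi> s u y - mollify \<phi> s u x - ?D (y - x)) / norm (y - x)) \<le> ?K * norm (y - x)"
    proof (rule eventually_at_filter[THEN iffD2], rule always_eventually, intro allI impI)
      fix y assume "y \<noteq> x"
      then show "norm (norm (mollify \<phi> s u y - mollify \<phi> s u x - ?D (y - x)) / norm (y - x)) \<le> ?K * norm (y - x)"
        using est[of "y - x"] by (simp add: divide_le_eq power2_eq_square mult.assoc)
    qed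
    show "((\<lambda>y. ?K * norm (y - x)) \<longlongrightarrow> 0) (at x)"
      by (rule tendsto_eq_intros refl | simp)+
  qed
  then show ?thesis unfolding has_derivative_iff_norm using lin by blast
qed

lemma partial_derivs_mollify:
  fixes \<phi> u :: "real^'n \<Rightarrow> complex"
  assumes \<phi>: "\<phi> \<in> schwartz" and u: "u \<in> schwartz"
  shows "partial_derivs \<beta> (mollify \<phi> s u) = mollify \<phi> s (partial_derivs \<beta> u)"
proof (induction \<beta>)
  case (Cons i \<beta>)
  show ?case
    unfolding partial_derivs_Cons Cons.IH
    by (rule ext) (rule partial_deriv_of_has_derivative[OF mollify_has_derivative[OF \<phi> schwartz_partial_derivs[OF u]]])
qed simp

lemma smooth_mollify:
  fixes \<phi> u :: "real^'n \<Rightarrow> complex"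
  assumes \<phi>: "\<phi> \<in> schwartz" and u: "u \<in> schwartz"
  shows "smooth (mollify \<phi> s u)"
  by (rule smoothI) (unfold partial_derivs_mollify[OF assms], rule exI, rule mollify_has_derivative[OF \<phi> schwartz_partial_derivs[OF u]])

lemma mollify_schwartz:
  fixes \<phi> u :: "real^'n \<Rightarrow> complex"
  assumes \<phi>: "\<phi> \<in> schwartz" and u: "u \<in> schwartz" and s: "0 \<le> s" "s \<le> 1"
  shows "mollify \<phi> s u \<in> schwartz"
proof -
  have *: "(1 + norm x) ^ k * cmod (partial_derivs \<beta> (mollify \<phi> s u) x) \<le> absmoment \<phi> k * snorm k l u"
    if \<beta>: "length \<beta> \<le> l" for k l x \<beta>
  proof -
    let ?v = "partial_derivs \<beta> u"
    have v: "?v \<in> schwartz" by (rule schwartz_partial_derivs[OF u])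
    have "(1 + norm x) ^ k * cmod (partial_derivs \<beta> (mollify \<phi> s u) x) = cmod (LINT w|lborel. \<phi> w * (of_real ((1 + norm x) ^ k) * ?v (x - s *\<^sub>R w)))"
    proof -
      have "(LINT w|lborel. \<phi> w * (of_real ((1 + norm x) ^ k) * ?v (x - s *\<^sub>R w))) = of_real ((1 + norm x) ^ k) * mollify \<phi> s ?v x"
        unfolding mollify_def by (subst integral_mult_right_zero[symmetric]) (auto intro!: Bochner_Integration.integral_cong simp: mult_ac)
      then show ?thesis unfolding partial_derivs_mollify[OF \<phi> u] by (simp add: norm_mult norm_power)
    qed
    also have "\<dots> \<le> snorm k l u * absmoment \<phi> k"
    proof (rule norm_integral_le_absmoment[OF \<phi>])
      have [measurable]: "?v \<in> borel_measurable borel" using v by (rule schwartz_measurable)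
      show "(\<lambda>w. of_real ((1 + norm x) ^ k) * ?v (x - s *\<^sub>R w)) \<in> borel_measurable borel" by measurable
      fix w
      have "1 + norm x \<le> (1 + norm (x - s *\<^sub>R w)) * (1 + norm (s *\<^sub>R w))"
        using one_plus_norm_mult[of "x - s *\<^sub>R w" "s *\<^sub>R w"] by simp
      also have "\<dots> \<le> (1 + norm (x - s *\<^sub>R w)) * (1 + norm w)"
        using s by (intro mult_left_mono) (auto simp: mult_left_le_one_le)
      finally have "(1 + norm x) ^ k \<le> ((1 + norm (x - s *\<^sub>R w)) * (1 + norm w)) ^ k"
        by (intro power_mono) auto
      then have "(1 + norm x) ^ k * cmod (?v (x - s *\<^sub>R w)) \<le> (1 + norm (x - s *\<^sub>R w)) ^ k * (1 + norm w) ^ k * cmod (?v (x - s *\<^sub>R w))"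
        unfolding power_mult_distrib by (rule mult_right_mono) simp
      also have "\<dots> = ((1 + norm (x - s *\<^sub>R w)) ^ k * cmod (?v (x - s *\<^sub>R w))) * (1 + norm w) ^ k"
        by simp
      also have "\<dots> \<le> snorm k l u * (1 + norm w) ^ k"
        by (intro mult_right_mono snorm_bound[OF u \<beta>]) auto
      finally show "norm (of_real ((1 + norm x) ^ k) * ?v (x - s *\<^sub>R w)) \<le> snorm k l u * (1 + norm w) ^ k"
        by (simp add: norm_mult norm_power)
    qed
    finally show ?thesis by (simp add: mult.commute)
  qed
  show ?thesis
    by (rule schwartzI[OF smooth_mollify[OF \<phi> u] *])
qed

text \<open>As \<open>\<integral>\<phi> = 1\<close>, the difference is \<open>\<integral>\<phi>(w) (u(x) - u(x - s w)) dw\<close>. The Lipschitz bound yields the factor \<open>s\<close>, at the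
  price of one derivative of \<open>u\<close> and one moment of \<open>\<phi>\<close>.\<close>
lemma snorm_diff_mollify:
  fixes \<phi> u :: "real^'n \<Rightarrow> complex"
  assumes \<phi>: "\<phi> \<in> schwartz" and u: "u \<in> schwartz" and s: "0 \<le> s" "s \<le> 1" and one: "(LINT w|lborel. \<phi> w) = 1"
  shows "snorm k l (\<lambda>x. u x - mollify \<phi> s u x) \<le> s * (real CARD('n) * absmoment \<phi> (Suc k)) * snorm k (Suc l) u"
proof (rule snorm_le)
  fix x :: "real^'n" and \<beta> :: "'n list" assume \<beta>: "length \<beta> \<le> l"
  let ?v = "partial_derivs \<beta> u"
  have v: "?v \<in> schwartz" by (rule schwartz_partial_derivs[OF u])
  have [measurable]: "?v \<in> borel_measurable borel" using v by (rule schwartz_measurable)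
  have i\<phi>: "integrable lborel \<phi>"
    using schwartz_times_growth_integrable[OF \<phi>, of "\<lambda>_. 1" 1 0] by simp
  have "partial_derivs \<beta> (\<lambda>x. u x - mollify \<phi> s u x) x = ?v x - mollify \<phi> s ?v x"
    using partial_derivs_lincomb[OF schwartz_smooth[OF u] smooth_mollify[OF \<phi> u], of \<beta> 1 "-1" s]
    unfolding partial_derivs_mollify[OF \<phi> u] by simp
  also have "\<dots> = (LINT w|lborel. \<phi> w * ?v x) - (LINT w|lborel. \<phi> w * ?v (x - s *\<^sub>R w))"
    unfolding mollify_def using one i\<phi> by simp
  also have "\<dots> = (LINT w|lborel. \<phi> w * ?v x - \<phi> w * ?v (x - s *\<^sub>R w))"
    using i\<phi> mollify_integrable[OF \<phi> v] by (intro Bochner_Integration.integral_diff[symmetric]) auto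
  finally have e: "partial_derivs \<beta> (\<lambda>x. u x - mollify \<phi> s u x) x = \<dots>" .
  have "(1 + norm x) ^ k * cmod (partial_derivs \<beta> (\<lambda>x. u x - mollify \<phi> s u x) x) = cmod (LINT w|lborel. \<phi> w * (of_real ((1 + norm x) ^ k) * (?v x - ?v (x - s *\<^sub>R w))))"
  proof -
    have "(LINT w|lborel. \<phi> w * (of_real ((1 + norm x) ^ k) * (?v x - ?v (x - s *\<^sub>R w)))) = of_real ((1 + norm x) ^ k) * partial_derivs \<beta> (\<lambda>x. u x - mollify \<phi> s u x) x"
      unfolding e by (subst integral_mult_right_zero[symmetric]) (auto intro!: Bochner_Integration.integral_cong simp: algebra_simps)
    then show ?thesis by (simp add: norm_mult norm_power)
  qed
  also have "\<dots> \<le> (s * real CARD('n) * snorm k (Suc l) u) * absmoment \<phi> (Suc k)"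
  proof (rule norm_integral_le_absmoment[OF \<phi>])
    show "(\<lambda>w. of_real ((1 + norm x) ^ k) * (?v x - ?v (x - s *\<^sub>R w))) \<in> borel_measurable borel" by measurable
    fix w :: "real^'n"
    have sw: "norm (s *\<^sub>R w) \<le> norm w" using s by (simp add: mult_left_le_one_le)
    have "(1 + norm x) ^ k * cmod (?v (x - s *\<^sub>R w) - ?v x) \<le> real CARD('n) * norm (s *\<^sub>R w) * (1 + norm (s *\<^sub>R w)) ^ k * snorm k (Suc l) u"
      using schwartz_lipschitz[OF u \<beta>, of x k "x - s *\<^sub>R w"] by simp
    also have "\<dots> \<le> real CARD('n) * (s * (1 + norm w)) * (1 + norm w) ^ k * snorm k (Suc l) u"
    proof -
      have "norm (s *\<^sub>R w) \<le> s * (1 + norm w)" using s by (simp add: algebra_simps)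
      moreover have "(1 + norm (s *\<^sub>R w)) ^ k \<le> (1 + norm w) ^ k" using sw by (intro power_mono) auto
      ultimately show ?thesis using s by (intro mult_right_mono mult_mono mult_left_mono) auto
    qed
    also have "\<dots> = (s * real CARD('n) * snorm k (Suc l) u) * (1 + norm w) ^ Suc k" by simp
    finally show "norm (of_real ((1 + norm x) ^ k) * (?v x - ?v (x - s *\<^sub>R w))) \<le> (s * real CARD('n) * snorm k (Suc l) u) * (1 + norm w) ^ Suc k"
      by (simp add: norm_mult norm_power norm_minus_commute)
  qed
  finally show "(1 + norm x) ^ k * cmod (partial_derivs \<beta> (\<lambda>x. u x - mollify \<phi> s u x) x) \<le> s * (real CARD('n) * absmoment \<phi> (Suc k)) * snorm k (Suc l) u"
    by (simp add: mult_ac)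
qed

lemma mollify_diff:
  fixes \<phi> u v :: "real^'n \<Rightarrow> complex"
  assumes "\<phi> \<in> schwartz" "u \<in> schwartz" "v \<in> schwartz"
  shows "mollify \<phi> s (\<lambda>x. u x - v x) = (\<lambda>x. mollify \<phi> s u x - mollify \<phi> s v x)"
proof
  fix x
  show "mollify \<phi> s (\<lambda>x. u x - v x) x = mollify \<phi> s u x - mollify \<phi> s v x"
    unfolding mollify_def right_diff_distrib using mollify_integrable[OF assms(1,2)] mollify_integrable[OF assms(1,3)]
    by (intro Bochner_Integration.integral_diff)
qed

lemma mollify_commute:
  fixes \<phi> u :: "real^'n \<Rightarrow> complex"
  assumes \<phi>: "\<phi> \<in> schwartz" and u: "u \<in> schwartz"
  shows "mollify \<phi> s (mollify \<phi> t u) = mollify \<phi> t (mollify \<phi> s u)"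
proof
  fix x
  have [measurable]: "\<phi> \<in> borel_measurable borel" "u \<in> borel_measurable borel"
    using \<phi> u by (auto intro: schwartz_measurable)
  let ?F = "\<lambda>(w, z). \<phi> w * (\<phi> z * u (x - s *\<^sub>R w - t *\<^sub>R z))"
  have i\<phi>: "integrable lborel (\<lambda>z. cmod (\<phi> z))"
    using absmoment_integrable[OF \<phi>, of 0] by simp
  have int: "integrable (lborel \<Otimes>\<^sub>M lborel) ?F"
  proof (rule Bochner_Integration.integrable_bound)
    show "integrable (lborel \<Otimes>\<^sub>M lborel) (\<lambda>(w, z). cmod (\<phi> w) * (cmod (\<phi> z) * snorm 0 0 u))"
      using i\<phi> by (intro lborel_pair.Fubini_integrable) (auto simp: abs_mult)
    show "?F \<in> borel_measurable (lborel \<Otimes>\<^sub>M lborel)" by measurable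
    show "AE p in lborel \<Otimes>\<^sub>M lborel. norm (?F p) \<le> norm (case p of (w, z) \<Rightarrow> cmod (\<phi> w) * (cmod (\<phi> z) * snorm 0 0 u))"
      using snorm_sup[OF u] by (auto simp: norm_mult intro!: AE_I2 mult_left_mono)
  qed
  have "mollify \<phi> s (mollify \<phi> t u) x = (LINT w|lborel. LINT z|lborel. \<phi> w * (\<phi> z * u (x - s *\<^sub>R w - t *\<^sub>R z)))"
    unfolding mollify_def by simp
  also have "\<dots> = (LINT z|lborel. LINT w|lborel. \<phi> w * (\<phi> z * u (x - s *\<^sub>R w - t *\<^sub>R z)))"
    using lborel_pair.Fubini_integral[OF int] by simp
  also have "\<dots> = (LINT z|lborel. LINT w|lborel. \<phi> z * (\<phi> w * u (x - t *\<^sub>R z - s *\<^sub>R w)))"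
    by (simp add: algebra_simps)
  also have "\<dots> = mollify \<phi> t (mollify \<phi> s u) x"
    unfolding mollify_def by simp
  finally show "mollify \<phi> s (mollify \<phi> t u) x = mollify \<phi> t (mollify \<phi> s u) x" .
qed

text \<open>The roles of the two factors are exchanged, so that a distribution can be paired with the dilated
  \<open>\<phi>\<close> under the integral.\<close>
lemma mollify_swap:
  fixes \<phi> u :: "real^'n \<Rightarrow> complex"
  assumes \<phi>: "\<phi> \<in> schwartz" and u: "u \<in> schwartz" and s: "0 < s"
  shows "mollify \<phi> s u = mollify u 1 (dilation \<phi> s)"
proof
  fix x
  have [measurable]: "\<phi> \<in> borel_measurable borel" "u \<in> borel_measurable borel"
    using \<phi> u by (auto intro: schwartz_measurable)
  have "mollify \<phi> s u x = \<bar>- (1 / s)\<bar> ^ CARD('n) *\<^sub>R (LINT w|lborel. \<phi> ((1 / s) *\<^sub>R x + (- (1 / s)) *\<^sub>R w) * u (x - s *\<^sub>R ((1 / s) *\<^sub>R x + (- (1 / s)) *\<^sub>R w)))"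
    unfolding mollify_def using s by (intro integral_lborel_affine) auto
  also have "\<dots> = (LINT w|lborel. u w * dilation \<phi> s (x - w))"
    using s by (subst integral_scaleR_right[symmetric])
      (auto intro!: Bochner_Integration.integral_cong simp: dilation_def scaleR_conv_of_real[where 'a=complex] power_divide divide_inverse power_inverse algebra_simps)
  finally show "mollify \<phi> s u x = mollify u 1 (dilation \<phi> s) x" unfolding mollify_def by simp
qed

section \<open>Convolution of a distribution with a mollified function\<close>

lemma partial_derivs_sum:
  assumes A: "finite A" and h: "\<And>c. c \<in> A \<Longrightarrow> h c \<in> schwartz"
  shows "(\<lambda>x. \<Sum>c\<in>A. a c * h c x) \<in> schwartz \<and>
    partial_derivs \<beta> (\<lambda>x. \<Sum>c\<in>A. a c * h c x) = (\<lambda>x. \<Sum>c\<in>A. a c * partial_derivs \<beta> (h c) x)"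
  using A h
proof (induction A)
  case empty
  have "partial_derivs \<beta> (\<lambda>x. 0 * (\<lambda>x. 0) x + 0 * (\<lambda>x. 0) x) = (\<lambda>x. 0)"
    using partial_derivs_lincomb[OF schwartz_smooth[OF schwartz_zero] schwartz_smooth[OF schwartz_zero], of \<beta> 0 0] by simp
  then show ?case by (simp add: schwartz_zero)
next
  case (insert c A)
  then have IH: "(\<lambda>x. \<Sum>c\<in>A. a c * h c x) \<in> schwartz"
      "partial_derivs \<beta> (\<lambda>x. \<Sum>c\<in>A. a c * h c x) = (\<lambda>x. \<Sum>c\<in>A. a c * partial_derivs \<beta> (h c) x)" "h c \<in> schwartz"
    by auto
  show ?case
    using schwartz_lincomb[OF IH(3,1), of "a c" 1]
      partial_derivs_lincomb[OF schwartz_smooth[OF IH(3)] schwartz_smooth[OF IH(1)], of \<beta> "a c" 1] IH(2) insert.hyps by simp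
qed

text \<open>If the variable in \<open>k\<close> is rounded by a simple function, the integral is a finite sum, through
  which a linear functional can be moved.\<close>
lemma integral_times_simple:
  fixes v k :: "real^'n \<Rightarrow> complex" and S :: "real^'n \<Rightarrow> real^'n"
  assumes v: "v \<in> schwartz" and S: "simple_function lborel S"
  shows "(LINT z|lborel. v z * k (S z)) = (\<Sum>c\<in>range S. (LINT z|lborel. v z * indicator {z. S z = c} z) * k c)"
proof -
  have fin: "finite (range S)" using simple_functionD(1)[OF S] by simp
  have m: "{z. S z = c} \<in> sets borel" for c
    using simple_functionD(2)[OF S, of "{c}"] by (simp add: vimage_def)
  have int: "integrable lborel (\<lambda>z. v z * indicator {z. S z = c} z)" for c
    using m by (intro schwartz_times_growth_integrable[OF v, where C=1 and k=0] borel_measurable_indicator)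
      (auto simp: indicator_def)
  have "v z * k (S z) = (\<Sum>c\<in>range S. (v z * indicator {z. S z = c} z) * k c)" for z
  proof -
    have "(\<Sum>c\<in>range S. (v z * indicator {z. S z = c} z) * k c) = (\<Sum>c\<in>range S. if c = S z then v z * k c else 0)"
      by (intro sum.cong) (auto simp: indicator_def)
    also have "\<dots> = v z * k (S z)" using fin by simp
    finally show ?thesis by simp
  qed
  then have "(LINT z|lborel. v z * k (S z)) = (LINT z|lborel. (\<Sum>c\<in>range S. (v z * indicator {z. S z = c} z) * k c))"
    by simp
  also have "\<dots> = (\<Sum>c\<in>range S. (LINT z|lborel. (v z * indicator {z. S z = c} z) * k c))"
    using int by (intro Bochner_Integration.integral_sum) auto
  finally show ?thesis using int by simp
qed

text \<open>Interchange of \<open>f\<close> with the convolution integral. Let \<open>F\<^sub>i\<close> be simple functions with \<open>F\<^sub>i(z) \<rightarrow> z\<close> and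
  \<open>|F\<^sub>i(z)| \<le> 2|z|\<close>. For the rounded integrals \<open>B\<^sub>i = \<integral>v(z) \<eta>(y - \<cdot> - F\<^sub>i(z)) dz\<close> the identity is finite linearity. Dominated
  convergence gives \<open>B\<^sub>i \<rightarrow> B\<close> in the seminorm that controls \<open>f\<close>, and also the limit of the right-hand
  side, because \<open>f * \<eta>\<close> is continuous of polynomial growth.\<close>
lemma dist_conv_mollify:
  fixes f :: "(real^'n \<Rightarrow> complex) \<Rightarrow> complex"
  assumes f: "f \<in> tempered_distributions" and v: "v \<in> schwartz" and \<eta>: "\<eta> \<in> schwartz"
  shows "dist_conv (mollify v 1 \<eta>) f y = (LINT z|lborel. v z * dist_conv \<eta> f (y - z))"
proof -
  obtain C k l where C: "0 < C" "\<And>u. u \<in> schwartz \<Longrightarrow> cmod (f u) \<le> C * snorm k l u"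
    using tempered_bound[OF f] by blast
  obtain C' k' where C': "0 \<le> C'" "\<And>x. cmod (dist_conv \<eta> f x) \<le> C' * (1 + norm x) ^ k'"
    using dist_conv_growth[OF f \<eta>] by blast
  obtain F :: "nat \<Rightarrow> real^'n \<Rightarrow> real^'n" where F: "\<And>i. simple_function lborel (F i)"
    "\<And>z. (\<lambda>i. F i z) \<longlonglongrightarrow> z" "\<And>i z. norm (F i z) \<le> 2 * norm z"
    using borel_measurable_implies_sequence_metric[of "\<lambda>z::real^'n. z" lborel 0] by auto
  have Fm [measurable]: "F i \<in> borel_measurable borel" for i
    using borel_measurable_simple_function[OF F(1)[of i]] by simp
  have [measurable]: "v \<in> borel_measurable borel" "\<And>\<beta>. partial_derivs \<beta> \<eta> \<in> borel_measurable borel"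
    using v schwartz_partial_derivs[OF \<eta>] by (auto intro: schwartz_measurable)
  let ?g = "dist_conv \<eta> f"
  have g_cont: "continuous_on UNIV ?g" by (rule dist_conv_continuous[OF f \<eta>])
  have [measurable]: "?g \<in> borel_measurable borel" using g_cont by (rule borel_measurable_continuous_onI)
  have cvS: "mollify v 1 \<eta> \<in> schwartz" by (rule mollify_schwartz[OF v \<eta>]) auto
  define B where "B = (\<lambda>y'. mollify v 1 \<eta> (y - y'))"
  have B: "B \<in> schwartz" unfolding B_def by (rule schwartz_reflect[OF cvS])
  define a where "a i c = (LINT z|lborel. v z * indicator {z. F i z = c} z)" for i c
  define Bi where "Bi i = (\<lambda>y'. \<Sum>c\<in>range (F i). a i c * \<eta> ((y - c) - y'))" for i
  have fin: "finite (range (F i))" for i using simple_functionD(1)[OF F(1)[of i]] by simp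
  note rs = partial_derivs_sum[OF fin, of _ "\<lambda>c y'. \<eta> ((y - c) - y')", OF schwartz_reflect[OF \<eta>]]
  have Bi: "Bi i \<in> schwartz" for i unfolding Bi_def using rs by blast
  have fBi: "f (Bi i) = (LINT z|lborel. v z * ?g (y - F i z))" for i
  proof -
    have "f (Bi i) = (\<Sum>c\<in>range (F i). a i c * ?g (y - c))"
      unfolding Bi_def dist_conv_def
      using tempered_sum[OF f fin, of _ "\<lambda>c y'. \<eta> ((y - c) - y')", OF schwartz_reflect[OF \<eta>]] by blast
    then show ?thesis unfolding a_def integral_times_simple[OF v F(1), of "\<lambda>c. ?g (y - c)"] .
  qed
  \<comment> \<open>Bound for the weighted rounding error at \<open>z\<close>, uniform in the free variable of \<open>B\<^sub>i\<close>.\<close>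
  define \<omega> where "\<omega> i z = (1 + norm (y - z)) ^ k * (norm (F i z - z) * (1 + norm (F i z - z)) ^ k)" for i z
  define N where "N = real CARD('n) * snorm k (Suc l) \<eta>"
  have N: "0 \<le> N" unfolding N_def by simp
  have \<omega>_le: "\<omega> i z \<le> (1 + norm y) ^ k * 3 ^ Suc k * (1 + norm z) ^ (2 * k + 1)" and \<omega>_pos: "0 \<le> \<omega> i z" for i z
  proof -
    have d: "norm (F i z - z) \<le> 3 * norm z"
      using norm_triangle_ineq4[of "F i z" z] F(3)[of i z] by linarith
    have "(1 + norm (y - z)) ^ k \<le> ((1 + norm y) * (1 + norm z)) ^ k"
      using one_plus_norm_mult[of y "- z"] by (intro power_mono) auto
    moreover have "norm (F i z - z) \<le> 3 * (1 + norm z)" using d by (simp add: algebra_simps)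
    moreover have "(1 + norm (F i z - z)) ^ k \<le> (3 * (1 + norm z)) ^ k" using d norm_ge_zero[of z] by (intro power_mono) auto
    ultimately have "\<omega> i z \<le> ((1 + norm y) * (1 + norm z)) ^ k * (3 * (1 + norm z) * (3 * (1 + norm z)) ^ k)"
      unfolding \<omega>_def by (intro mult_mono) auto
    also have "\<dots> = (1 + norm y) ^ k * 3 ^ Suc k * (1 + norm z) ^ (2 * k + 1)"
    proof -
      have "(1 + norm z) ^ (2 * k + 1) = (1 + norm z) ^ k * (1 + norm z) ^ k * (1 + norm z)"
        by (simp add: power_add mult_2)
      then show ?thesis by (simp only: power_mult_distrib power_Suc mult_ac)
    qed
    finally show "\<omega> i z \<le> (1 + norm y) ^ k * 3 ^ Suc k * (1 + norm z) ^ (2 * k + 1)" .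
    show "0 \<le> \<omega> i z" unfolding \<omega>_def by simp
  qed
  have \<omega>_lim: "(\<lambda>i. \<omega> i z) \<longlonglongrightarrow> 0" for z
  proof -
    have "(\<lambda>i. \<omega> i z) \<longlonglongrightarrow> (1 + norm (y - z)) ^ k * (norm (z - z) * (1 + norm (z - z)) ^ k)"
      unfolding \<omega>_def by (intro tendsto_intros F(2))
    then show ?thesis by simp
  qed
  have \<omega>_int: "integrable lborel (\<lambda>z. cmod (v z) * \<omega> i z)" for i
  proof -
    have "integrable lborel (\<lambda>z. v z * of_real (\<omega> i z))"
    proof (rule schwartz_times_growth_integrable[OF v])
      show "(\<lambda>z. complex_of_real (\<omega> i z)) \<in> borel_measurable borel" unfolding \<omega>_def by measurable
      show "norm (complex_of_real (\<omega> i z)) \<le> (1 + norm y) ^ k * 3 ^ Suc k * (1 + norm z) ^ (2 * k + 1)" for z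
        using \<omega>_le[of i z] \<omega>_pos[of i z] by simp
    qed
    from integrable_norm[OF this] show ?thesis using \<omega>_pos by (simp add: norm_mult)
  qed
  have diff: "snorm k l (\<lambda>x. Bi i x - B x) \<le> N * (LINT z|lborel. cmod (v z) * \<omega> i z)" for i
  proof (rule snorm_le)
    fix y' and \<beta> :: "'n list" assume \<beta>: "length \<beta> \<le> l"
    let ?\<eta> = "partial_derivs \<beta> \<eta>"
    have cS: "?\<eta> \<in> schwartz" by (rule schwartz_partial_derivs[OF \<eta>])
    have i1: "integrable lborel (\<lambda>z. v z * ?\<eta> (y - F i z - y'))"
      by (rule schwartz_times_growth_integrable[OF v, where C="snorm 0 0 ?\<eta>" and k=0]) (auto simp: snorm_sup[OF cS])
    have i2: "integrable lborel (\<lambda>z. v z * ?\<eta> (y - z - y'))"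
      by (rule schwartz_times_growth_integrable[OF v, where C="snorm 0 0 ?\<eta>" and k=0]) (auto simp: snorm_sup[OF cS])
    have "partial_derivs \<beta> (Bi i) y' = (\<Sum>c\<in>range (F i). a i c * ((-1) ^ length \<beta> * ?\<eta> (y - c - y')))"
      unfolding Bi_def rs[THEN conjunct2] unfolding partial_derivs_reflect[OF \<eta>] by simp
    also have "\<dots> = (-1) ^ length \<beta> * (LINT z|lborel. v z * ?\<eta> (y - F i z - y'))"
      unfolding a_def integral_times_simple[OF v F(1), of "\<lambda>c. ?\<eta> (y - c - y')"] by (simp add: sum_distrib_left mult_ac)
    finally have pBi: "partial_derivs \<beta> (Bi i) y' = (-1) ^ length \<beta> * (LINT z|lborel. v z * ?\<eta> (y - F i z - y'))" .
    have "partial_derivs \<beta> B y' = (-1) ^ length \<beta> * (LINT z|lborel. v z * ?\<eta> (y - z - y'))"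
      unfolding B_def partial_derivs_reflect[OF cvS] partial_derivs_mollify[OF v \<eta>] unfolding mollify_def
      by (simp add: algebra_simps)
    then have "partial_derivs \<beta> (\<lambda>x. Bi i x - B x) y' = (-1) ^ length \<beta> * ((LINT z|lborel. v z * ?\<eta> (y - F i z - y')) - (LINT z|lborel. v z * ?\<eta> (y - z - y')))"
      using partial_derivs_lincomb[OF schwartz_smooth[OF Bi] schwartz_smooth[OF B], of \<beta> 1 i "-1"] pBi by (simp add: right_diff_distrib)
    also have "(LINT z|lborel. v z * ?\<eta> (y - F i z - y')) - (LINT z|lborel. v z * ?\<eta> (y - z - y')) =
       (LINT z|lborel. v z * ?\<eta> (y - F i z - y') - v z * ?\<eta> (y - z - y'))"
      using i1 i2 by (rule Bochner_Integration.integral_diff[symmetric])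
    finally have "cmod (partial_derivs \<beta> (\<lambda>x. Bi i x - B x) y') = cmod (LINT z|lborel. v z * ?\<eta> (y - F i z - y') - v z * ?\<eta> (y - z - y'))"
      by (simp add: norm_mult norm_power)
    also have "\<dots> \<le> (LINT z|lborel. cmod (v z * ?\<eta> (y - F i z - y') - v z * ?\<eta> (y - z - y')))"
      by (rule integral_norm_bound)
    finally have "(1 + norm y') ^ k * cmod (partial_derivs \<beta> (\<lambda>x. Bi i x - B x) y') \<le>
       (1 + norm y') ^ k * (LINT z|lborel. cmod (v z * ?\<eta> (y - F i z - y') - v z * ?\<eta> (y - z - y')))"
      by (rule mult_left_mono) simp
    also have "\<dots> = (LINT z|lborel. (1 + norm y') ^ k * cmod (v z * ?\<eta> (y - F i z - y') - v z * ?\<eta> (y - z - y')))"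
      by simp
    also have "\<dots> \<le> (LINT z|lborel. N * (cmod (v z) * \<omega> i z))"
    proof (rule integral_mono)
      show "integrable lborel (\<lambda>z. (1 + norm y') ^ k * cmod (v z * ?\<eta> (y - F i z - y') - v z * ?\<eta> (y - z - y')))"
        using i1 i2 by (intro integrable_mult_right integrable_norm Bochner_Integration.integrable_diff)
      show "integrable lborel (\<lambda>z. N * (cmod (v z) * \<omega> i z))"
        by (intro integrable_mult_right \<omega>_int)
      fix z
      have "(1 + norm y') ^ k * cmod (v z * ?\<eta> (y - F i z - y') - v z * ?\<eta> (y - z - y')) =
        cmod (v z) * ((1 + norm y') ^ k * cmod (?\<eta> (y - F i z - y') - ?\<eta> (y - z - y')))"
        by (simp add: right_diff_distrib[symmetric] norm_mult)
      also have "\<dots> \<le> cmod (v z) * ((1 + norm (y - z)) ^ k * (real CARD('n) * norm ((y - F i z) - (y - z)) * (1 + norm ((y - F i z) - (y - z))) ^ k * snorm k (Suc l) \<eta>))"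
        by (intro mult_left_mono translate_difference_bound[OF \<eta> \<beta>]) auto
      also have "\<dots> = N * (cmod (v z) * \<omega> i z)"
        unfolding N_def \<omega>_def by (simp add: norm_minus_commute mult_ac)
      finally show "(1 + norm y') ^ k * cmod (v z * ?\<eta> (y - F i z - y') - v z * ?\<eta> (y - z - y')) \<le> N * (cmod (v z) * \<omega> i z)" .
    qed
    also have "\<dots> = N * (LINT z|lborel. cmod (v z) * \<omega> i z)" by simp
    finally show "(1 + norm y') ^ k * cmod (partial_derivs \<beta> (\<lambda>x. Bi i x - B x) y') \<le> N * (LINT z|lborel. cmod (v z) * \<omega> i z)" .
  qed
  have "(\<lambda>i. LINT z|lborel. cmod (v z) * \<omega> i z) \<longlonglongrightarrow> (LINT z|(lborel :: (real^'n) measure). (0::real))"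
  proof (rule integral_dominated_convergence)
    show "integrable lborel (\<lambda>z. ((1 + norm y) ^ k * 3 ^ Suc k) * (cmod (v z) * (1 + norm z) ^ (2 * k + 1)))"
      by (intro integrable_mult_right absmoment_integrable v)
    show "AE z in lborel. (\<lambda>i. cmod (v z) * \<omega> i z) \<longlonglongrightarrow> 0"
      using tendsto_mult_right_zero[OF \<omega>_lim] by auto
    show "AE z in lborel. norm (cmod (v z) * \<omega> i z) \<le> ((1 + norm y) ^ k * 3 ^ Suc k) * (cmod (v z) * (1 + norm z) ^ (2 * k + 1))" for i
    proof (rule AE_I2)
      fix z
      have "cmod (v z) * \<omega> i z \<le> cmod (v z) * ((1 + norm y) ^ k * 3 ^ Suc k * (1 + norm z) ^ (2 * k + 1))"
        by (intro mult_left_mono \<omega>_le) auto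
      then show "norm (cmod (v z) * \<omega> i z) \<le> ((1 + norm y) ^ k * 3 ^ Suc k) * (cmod (v z) * (1 + norm z) ^ (2 * k + 1))"
        using \<omega>_pos[of i z] by (simp add: abs_mult mult_ac)
    qed
  qed (use borel_measurable_integrable[OF \<omega>_int] in simp_all)
  then have eps: "(\<lambda>i. C * (N * (LINT z|lborel. cmod (v z) * \<omega> i z))) \<longlonglongrightarrow> 0"
    by (auto intro!: tendsto_mult_right_zero)
  have "(\<lambda>i. f (Bi i) - f B) \<longlonglongrightarrow> 0"
  proof (rule Lim_null_comparison[OF always_eventually eps], rule allI)
    fix i
    have d: "(\<lambda>x. Bi i x - B x) \<in> schwartz" by (rule schwartz_diff[OF Bi B])
    have "norm (f (Bi i) - f B) \<le> C * snorm k l (\<lambda>x. Bi i x - B x)"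
      unfolding tempered_diff[OF f Bi B, symmetric] by (rule C(2)[OF d])
    also have "\<dots> \<le> C * (N * (LINT z|lborel. cmod (v z) * \<omega> i z))"
      using diff C(1) by (intro mult_left_mono) auto
    finally show "norm (f (Bi i) - f B) \<le> C * (N * (LINT z|lborel. cmod (v z) * \<omega> i z))" .
  qed
  then have lim1: "(\<lambda>i. f (Bi i)) \<longlonglongrightarrow> f B" by (simp add: LIM_zero_iff)
  have lim2: "(\<lambda>i. f (Bi i)) \<longlonglongrightarrow> (LINT z|lborel. v z * ?g (y - z))"
    unfolding fBi
  proof (rule integral_dominated_convergence)
    show "integrable lborel (\<lambda>z. (C' * (1 + norm y) ^ k' * 2 ^ k') * (cmod (v z) * (1 + norm z) ^ k'))"
      by (intro integrable_mult_right absmoment_integrable v)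
    show "AE z in lborel. (\<lambda>i. v z * ?g (y - F i z)) \<longlonglongrightarrow> v z * ?g (y - z)"
    proof (rule AE_I2)
      fix z
      have "isCont ?g (y - z)" using g_cont by (simp add: continuous_on_eq_continuous_at)
      then show "(\<lambda>i. v z * ?g (y - F i z)) \<longlonglongrightarrow> v z * ?g (y - z)"
        by (intro tendsto_mult tendsto_const isCont_tendsto_compose[where g="?g"] tendsto_diff F(2))
    qed
    show "AE z in lborel. norm (v z * ?g (y - F i z)) \<le> (C' * (1 + norm y) ^ k' * 2 ^ k') * (cmod (v z) * (1 + norm z) ^ k')" for i
    proof (rule AE_I2)
      fix z
      have "1 + norm (y - F i z) \<le> (1 + norm y) * (1 + norm (F i z))" using one_plus_norm_mult[of y "- F i z"] by simp
      also have "\<dots> \<le> (1 + norm y) * (2 * (1 + norm z))" using F(3)[of i z] by (intro mult_left_mono) auto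
      finally have "(1 + norm (y - F i z)) ^ k' \<le> ((1 + norm y) * (2 * (1 + norm z))) ^ k'" by (intro power_mono) auto
      then have "C' * (1 + norm (y - F i z)) ^ k' \<le> C' * ((1 + norm y) * (2 * (1 + norm z))) ^ k'"
        using C'(1) by (rule mult_left_mono)
      then have "cmod (?g (y - F i z)) \<le> C' * ((1 + norm y) * (2 * (1 + norm z))) ^ k'"
        using C'(2)[of "y - F i z"] by linarith
      then have "cmod (v z) * cmod (?g (y - F i z)) \<le> cmod (v z) * (C' * ((1 + norm y) * (2 * (1 + norm z))) ^ k')"
        by (rule mult_left_mono) simp
      then show "norm (v z * ?g (y - F i z)) \<le> (C' * (1 + norm y) ^ k' * 2 ^ k') * (cmod (v z) * (1 + norm z) ^ k')"
        by (simp only: norm_mult power_mult_distrib mult_ac)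
    qed
  qed measurable
  have "dist_conv (mollify v 1 \<eta>) f y = f B" unfolding dist_conv_def B_def ..
  then show ?thesis using LIMSEQ_unique[OF lim1 lim2] by simp
qed

text \<open>Average the hypothesis over the ball of radius \<open>\<rho>\<close> about \<open>z\<close> and enlarge this ball until it contains \<open>x\<close>; the
  factor is the ratio of the volumes.\<close>
lemma maxop_peetre:
  fixes G :: "real^'n \<Rightarrow> ennreal"
  assumes G: "G \<in> borel_measurable lebesgue" and \<rho>: "0 < \<rho>" and le: "\<And>w. dist z w < \<rho> \<Longrightarrow> a \<le> c * G w"
  shows "a \<le> c * (ennreal ((1 + dist z x / \<rho>) ^ CARD('n)) * maxop G x)"
proof -
  let ?n = "CARD('n)"
  let ?v = "unit_ball_vol (real ?n)"
  have v: "0 < ?v" by (simp add: unit_ball_vol_pos)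
  then have v0: "?v \<noteq> 0" by linarith
  note [measurable] = G
  have [measurable]: "ball c r \<in> sets lebesgue" for c :: "real^'n" and r by simp
  have \<rho>': "0 < \<rho> + dist z x" using \<rho> by (simp add: add_pos_nonneg)
  have xin: "x \<in> ball z (\<rho> + dist z x)" using \<rho> by simp
  have "a * emeasure lebesgue (ball z \<rho>) = (\<integral>\<^sup>+w\<in>ball z \<rho>. a \<partial>lebesgue)"
    by (rule nn_integral_cmult_indicator[symmetric]) measurable
  also have "\<dots> \<le> (\<integral>\<^sup>+w. c * (G w * indicator (ball z (\<rho> + dist z x)) w) \<partial>lebesgue)"
  proof (rule nn_integral_mono)
    fix w
    show "a * indicator (ball z \<rho>) w \<le> c * (G w * indicator (ball z (\<rho> + dist z x)) w)"
    proof (cases "dist z w < \<rho>")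
      case True
      then have "dist z w < \<rho> + dist z x" using zero_le_dist[of z x] by linarith
      then show ?thesis using le[OF True] True by simp
    qed simp
  qed
  also have "\<dots> = c * (\<integral>\<^sup>+w\<in>ball z (\<rho> + dist z x). G w \<partial>lebesgue)"
    by (rule nn_integral_cmult) measurable
  also have "\<dots> \<le> c * (emeasure lebesgue (ball z (\<rho> + dist z x)) * maxop G x)"
    by (intro mult_left_mono integral_ball_le_maxop[OF xin]) auto
  finally have *: "a * ennreal (?v * \<rho> ^ ?n) \<le> c * (ennreal (?v * (\<rho> + dist z x) ^ ?n) * maxop G x)"
    unfolding emeasure_lebesgue_ball[OF \<rho>] emeasure_lebesgue_ball[OF \<rho>'] .
  let ?i = "ennreal (1 / (?v * \<rho> ^ ?n))"
  have p: "0 < ?v * \<rho> ^ ?n" using v \<rho> by simp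
  have "?i * (a * ennreal (?v * \<rho> ^ ?n)) \<le> ?i * (c * (ennreal (?v * (\<rho> + dist z x) ^ ?n) * maxop G x))"
    using * by (rule mult_left_mono) simp
  moreover have "?i * (a * ennreal (?v * \<rho> ^ ?n)) = a"
  proof -
    have "?i * ennreal (?v * \<rho> ^ ?n) = ennreal (1 / (?v * \<rho> ^ ?n) * (?v * \<rho> ^ ?n))"
      by (rule ennreal_mult''[OF less_imp_le[OF p], symmetric])
    also have "1 / (?v * \<rho> ^ ?n) * (?v * \<rho> ^ ?n) = 1"
      by (simp only: times_divide_eq_left mult_1 divide_self[OF less_imp_neq[OF p, symmetric]])
    finally have "?i * ennreal (?v * \<rho> ^ ?n) = 1" by simp
    then show ?thesis by (simp add: mult.left_commute)
  qed
  moreover have "?i * (c * (ennreal (?v * (\<rho> + dist z x) ^ ?n) * maxop G x)) = c * (ennreal ((1 + dist z x / \<rho>) ^ ?n) * maxop G x)"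
  proof -
    have "1 / (?v * \<rho> ^ ?n) * (?v * (\<rho> + dist z x) ^ ?n) = ((\<rho> + dist z x) / \<rho>) ^ ?n"
      by (simp add: power_divide v0)
    also have "(\<rho> + dist z x) / \<rho> = 1 + dist z x / \<rho>" using \<rho> by (simp add: field_simps)
    finally have "?i * ennreal (?v * (\<rho> + dist z x) ^ ?n) = ennreal ((1 + dist z x / \<rho>) ^ ?n)"
      using v \<rho>' v0 by (subst ennreal_mult''[symmetric]) auto
    then show ?thesis by (metis mult.assoc mult.left_commute)
  qed
  ultimately show ?thesis by simp
qed

section \<open>A discrete reproducing formula\<close>

definition defect :: "(real^'n \<Rightarrow> complex) \<Rightarrow> real \<Rightarrow> (real^'n \<Rightarrow> complex) \<Rightarrow> real^'n \<Rightarrow> complex" where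
  "defect \<phi> s u = (\<lambda>x. u x - mollify \<phi> s u x)"

locale approximate_identity =
  fixes \<phi> :: "real^'n \<Rightarrow> complex"
  assumes \<phi>: "\<phi> \<in> schwartz" and one: "(LINT w|lborel. \<phi> w) = 1"
begin

lemma defect_schwartz: "u \<in> schwartz \<Longrightarrow> 0 \<le> s \<Longrightarrow> s \<le> 1 \<Longrightarrow> defect \<phi> s u \<in> schwartz"
  unfolding defect_def by (intro schwartz_diff mollify_schwartz \<phi>)

lemma defect_iter_schwartz: "u \<in> schwartz \<Longrightarrow> 0 \<le> s \<Longrightarrow> s \<le> 1 \<Longrightarrow> (defect \<phi> s ^^ i) u \<in> schwartz"
  by (induction i) (auto intro: defect_schwartz)

lemma snorm_defect_iter:
  assumes u: "u \<in> schwartz" and s: "0 \<le> s" "s \<le> 1"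
  shows "snorm k l ((defect \<phi> s ^^ i) u) \<le> (s * (real CARD('n) * absmoment \<phi> (Suc k))) ^ i * snorm k (l + i) u"
proof (induction i arbitrary: l)
  case (Suc i)
  let ?c = "s * (real CARD('n) * absmoment \<phi> (Suc k))"
  have c: "0 \<le> ?c" using s absmoment_nonneg[of \<phi> "Suc k"] by simp
  have "snorm k l ((defect \<phi> s ^^ Suc i) u) \<le> ?c * snorm k (Suc l) ((defect \<phi> s ^^ i) u)"
    unfolding funpow.simps comp_def
    by (subst defect_def) (rule snorm_diff_mollify[OF \<phi> defect_iter_schwartz[OF u s] s one])
  also have "\<dots> \<le> ?c * (?c ^ i * snorm k (Suc l + i) u)"
    using c by (intro mult_left_mono Suc.IH)
  finally show ?case by (simp add: mult_ac)
qed simp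

lemma defect_diff:
  assumes "u \<in> schwartz" "v \<in> schwartz"
  shows "defect \<phi> s (\<lambda>x. u x - v x) = (\<lambda>x. defect \<phi> s u x - defect \<phi> s v x)"
  unfolding defect_def mollify_diff[OF \<phi> assms] by (simp add: fun_eq_iff)

lemma defect_iter_diff:
  assumes "u \<in> schwartz" "v \<in> schwartz" "0 \<le> s" "s \<le> 1"
  shows "(defect \<phi> s ^^ i) (\<lambda>x. u x - v x) = (\<lambda>x. (defect \<phi> s ^^ i) u x - (defect \<phi> s ^^ i) v x)"
  by (induction i) (simp_all add: defect_diff defect_iter_schwartz assms)

lemma mollify_defect:
  assumes u: "u \<in> schwartz" and s: "0 \<le> s" "s \<le> 1"
  shows "mollify \<phi> t (defect \<phi> s u) = defect \<phi> s (mollify \<phi> t u)"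
  unfolding defect_def mollify_diff[OF \<phi> u mollify_schwartz[OF \<phi> u s]] mollify_commute[OF \<phi> u, of t s] ..

lemma mollify_defect_iter:
  assumes u: "u \<in> schwartz" and s: "0 \<le> s" "s \<le> 1"
  shows "mollify \<phi> t ((defect \<phi> s ^^ i) u) = (defect \<phi> s ^^ i) (mollify \<phi> t u)"
  by (induction i) (simp_all add: mollify_defect[OF defect_iter_schwartz[OF u s] s])

text \<open>With \<open>L = m + 2\<close> and scales \<open>a = 2\<^sup>-\<^sup>j\<close>, \<open>b = a / 2\<close>, the telescoping sum
  \<open>D\<^sub>a\<^sup>L - D\<^sub>b\<^sup>L = \<Sum>\<^sub>i D\<^sub>b\<^sup>i (D\<^sub>a - D\<^sub>b) D\<^sub>a\<^sup>L\<^sup>-\<^sup>1\<^sup>-\<^sup>i\<close> has terms \<open>(\<phi>\<^sub>b - \<phi>\<^sub>a) * x\<^sub>i\<close> with \<open>x\<^sub>i = D\<^sub>b\<^sup>i D\<^sub>a\<^sup>L\<^sup>-\<^sup>1\<^sup>-\<^sup>i u\<close> by commutation, and \<open>x\<^sub>i\<close> is of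
  size \<open>2\<^sup>-\<^sup>j\<^sup>(\<^sup>m\<^sup>+\<^sup>1\<^sup>)\<close>. The hypothesis on \<open>F\<close> loses \<open>2\<^sup>\<kappa>\<^sup>j\<close>, which the condition on \<open>\<kappa>\<close> makes summable. The remainder
  \<open>D\<^sub>j\<^sup>L u\<close> tends to \<open>0\<close> in every seminorm, so continuity of \<open>F\<close> enters only qualitatively and the
  constant does not depend on \<open>F\<close>.\<close>
lemma reproducing_estimate:
  fixes \<kappa> :: real
  assumes \<kappa>: "\<kappa> < real m + 1"
  shows "\<exists>C>0. \<forall>F Q u. 0 \<le> Q \<longrightarrow> u \<in> schwartz \<longrightarrow>
    (\<forall>u\<in>schwartz. \<forall>v\<in>schwartz. F (\<lambda>x. u x - v x) = F u - F v) \<longrightarrow>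
    (\<exists>C' k l. \<forall>u\<in>schwartz. cmod (F u) \<le> C' * snorm k l u) \<longrightarrow>
    (\<forall>j. \<forall>v\<in>schwartz. cmod (F (mollify \<phi> ((1/2) ^ j) v)) \<le> Q * 2 powr (\<kappa> * real j) * snorm K 0 v) \<longrightarrow>
    cmod (F u) \<le> C * Q * snorm K (m + 1) u"
proof -
  define c where "c = real CARD('n) * absmoment \<phi> (Suc K)"
  have c: "0 \<le> c" unfolding c_def using absmoment_nonneg[of \<phi> "Suc K"] by simp
  define s where "s j = (1 / 2 :: real) ^ j" for j :: nat
  have s: "0 \<le> s j" "s j \<le> 1" "0 < s j" for j unfolding s_def by (auto intro: power_le_one)
  define \<rho> where "\<rho> = 2 powr (\<kappa> - (real m + 1))"
  have \<rho>: "0 < \<rho>" "\<rho> < 1" unfolding \<rho>_def using \<kappa> by (auto simp: powr_less_one)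
  define E where "E = real (m + 2) * c ^ (m + 1) * (2 powr \<kappa> + 1)"
  have E: "0 \<le> E" unfolding E_def using c by simp
  define I where "I = (\<Sum>i<m + 2. c ^ i)"
  have I: "0 \<le> I" unfolding I_def using c by (intro sum_nonneg) auto
  define C where "C = I + E / (1 - \<rho>) + 1"
  have C: "0 < C" unfolding C_def using I E \<rho> by (simp add: add_nonneg_pos)
  show ?thesis
  proof (intro exI[of _ C] conjI allI impI C)
    fix F :: "(real^'n \<Rightarrow> complex) \<Rightarrow> complex" and Q :: real and u :: "real^'n \<Rightarrow> complex"
    assume Q: "0 \<le> Q" and u: "u \<in> schwartz"
      and lin: "\<forall>u\<in>schwartz. \<forall>v\<in>schwartz. F (\<lambda>x. u x - v x) = F u - F v"
      and bd: "\<exists>C' k l. \<forall>u\<in>schwartz. cmod (F u) \<le> C' * snorm k l u"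
      and P: "\<forall>j. \<forall>v\<in>schwartz. cmod (F (mollify \<phi> ((1/2) ^ j) v)) \<le> Q * 2 powr (\<kappa> * real j) * snorm K 0 v"
    let ?N = "snorm K (m + 1) u"
    let ?L = "m + 2"
    define D where "D j = defect \<phi> (s j)" for j
    have DS: "(D j ^^ i) v \<in> schwartz" if "v \<in> schwartz" for i j v
      unfolding D_def by (intro defect_iter_schwartz that s)
    have Dn: "snorm k l ((D j ^^ i) v) \<le> (s j * (real CARD('n) * absmoment \<phi> (Suc k))) ^ i * snorm k (l + i) v" if "v \<in> schwartz" for i j v k l
      unfolding D_def by (intro snorm_defect_iter that s)
    have cvS: "mollify \<phi> (s j) v \<in> schwartz" if "v \<in> schwartz" for j v
      by (intro mollify_schwartz \<phi> that s)
    have P': "cmod (F (mollify \<phi> (s j) v)) \<le> Q * 2 powr (\<kappa> * real j) * snorm K 0 v" if "v \<in> schwartz" for j v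
      using P that unfolding s_def by blast
    \<comment> \<open>The coarsest scale: \<open>u - D\<^sub>0\<^sup>L u\<close> is the sum of the \<open>\<phi> * D\<^sub>0\<^sup>i u\<close>.\<close>
    have first: "cmod (F u - F ((D 0 ^^ ?L) u)) \<le> I * Q * ?N"
    proof -
      have "F u - F ((D 0 ^^ ?L) u) = (\<Sum>i<?L. F ((D 0 ^^ i) u) - F ((D 0 ^^ Suc i) u))"
        by (subst sum_lessThan_telescope') simp
      also have "cmod \<dots> \<le> (\<Sum>i<?L. c ^ i * Q * ?N)"
      proof (rule sum_norm_le)
        fix i assume "i \<in> {..<?L}"
        then have i: "i \<le> m + 1" by simp
        let ?v = "(D 0 ^^ i) u"
        have v: "?v \<in> schwartz" by (rule DS[OF u])
        have e: "(D 0 ^^ Suc i) u = (\<lambda>x. ?v x - mollify \<phi> (s 0) ?v x)"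
          by (simp add: D_def defect_def[of \<phi> _ "(defect \<phi> (s 0) ^^ i) u"])
        have "F (mollify \<phi> (s 0) ?v) = F (\<lambda>x. ?v x - (D 0 ^^ Suc i) u x)"
          unfolding e by simp
        also have "\<dots> = F ?v - F ((D 0 ^^ Suc i) u)"
          using lin v DS[OF u] by blast
        finally have "cmod (F ?v - F ((D 0 ^^ Suc i) u)) \<le> Q * snorm K 0 ?v"
          using P'[OF v, of 0] by simp
        also have "\<dots> \<le> Q * (c ^ i * ?N)"
        proof (rule mult_left_mono[OF _ Q])
          have "snorm K 0 ?v \<le> c ^ i * snorm K i u"
            using Dn[OF u, where k=K and l=0 and j=0 and i=i] unfolding c_def s_def by simp
          also have "\<dots> \<le> c ^ i * ?N"
            using c by (intro mult_left_mono snorm_mono u i order_refl) auto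
          finally show "snorm K 0 ?v \<le> c ^ i * ?N" .
        qed
        finally show "cmod (F ?v - F ((D 0 ^^ Suc i) u)) \<le> c ^ i * Q * ?N"
          by (simp only: mult_ac)
      qed
      also have "\<dots> = I * Q * ?N" unfolding I_def sum_distrib_right ..
      finally show ?thesis .
    qed
    have step: "cmod (F ((D j ^^ ?L) u) - F ((D (Suc j) ^^ ?L) u)) \<le> E * \<rho> ^ j * Q * ?N" for j
    proof -
      let ?V = "\<lambda>i. (D (Suc j) ^^ i) ((D j ^^ (?L - i)) u)"
      have eq: "F ((D j ^^ ?L) u) - F ((D (Suc j) ^^ ?L) u) = (\<Sum>i<?L. F (?V i) - F (?V (Suc i)))"
        by (subst sum_lessThan_telescope') simp
      have le: "cmod (\<Sum>i<?L. F (?V i) - F (?V (Suc i))) \<le> (\<Sum>i<?L. c ^ (m + 1) * (2 powr \<kappa> + 1) * \<rho> ^ j * Q * ?N)"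
      proof (rule sum_norm_le)
        fix i assume "i \<in> {..<?L}"
        then have i: "i \<le> m + 1" by simp
        define w where "w = (D j ^^ (m + 1 - i)) u"
        have w: "w \<in> schwartz" unfolding w_def by (rule DS[OF u])
        define x where "x = (D (Suc j) ^^ i) w"
        have x: "x \<in> schwartz" unfolding x_def by (rule DS[OF w])
        have "?L - i = Suc (m + 1 - i)" "?L - Suc i = m + 1 - i" using i by auto
        then have V: "?V i = (D (Suc j) ^^ i) (D j w)" "?V (Suc i) = (D (Suc j) ^^ i) (D (Suc j) w)"
          unfolding w_def by (simp_all add: funpow_swap1)
        have Dw: "D j w \<in> schwartz" "D (Suc j) w \<in> schwartz"
          unfolding D_def by (intro defect_schwartz w s)+
        have "(\<lambda>y. ?V i y - ?V (Suc i) y) = (D (Suc j) ^^ i) (\<lambda>y. D j w y - D (Suc j) w y)"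
          unfolding V unfolding D_def by (rule defect_iter_diff[symmetric]) (use Dw s in \<open>auto simp: D_def\<close>)
        also have "(\<lambda>y. D j w y - D (Suc j) w y) = (\<lambda>y. mollify \<phi> (s (Suc j)) w y - mollify \<phi> (s j) w y)"
          by (simp add: D_def defect_def)
        also have "(D (Suc j) ^^ i) \<dots> = (\<lambda>y. (D (Suc j) ^^ i) (mollify \<phi> (s (Suc j)) w) y - (D (Suc j) ^^ i) (mollify \<phi> (s j) w) y)"
          unfolding D_def by (rule defect_iter_diff) (intro cvS w s)+
        also have "\<dots> = (\<lambda>y. mollify \<phi> (s (Suc j)) x y - mollify \<phi> (s j) x y)"
          unfolding x_def D_def by (simp add: mollify_defect_iter[OF w s(1) s(2)])
        finally have e: "(\<lambda>y. ?V i y - ?V (Suc i) y) = (\<lambda>y. mollify \<phi> (s (Suc j)) x y - mollify \<phi> (s j) x y)" .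
        have "F (?V i) - F (?V (Suc i)) = F (\<lambda>y. ?V i y - ?V (Suc i) y)"
          by (rule lin[rule_format, OF DS[OF DS[OF u]] DS[OF DS[OF u]], symmetric])
        also have "\<dots> = F (mollify \<phi> (s (Suc j)) x) - F (mollify \<phi> (s j) x)"
          unfolding e using lin cvS[OF x] by blast
        finally have "cmod (F (?V i) - F (?V (Suc i))) \<le> cmod (F (mollify \<phi> (s (Suc j)) x)) + cmod (F (mollify \<phi> (s j) x))"
          by (simp add: norm_triangle_ineq4)
        also have "\<dots> \<le> Q * 2 powr (\<kappa> * real (Suc j)) * snorm K 0 x + Q * 2 powr (\<kappa> * real j) * snorm K 0 x"
          by (intro add_mono P' x)
        also have "\<dots> = (2 powr \<kappa> + 1) * 2 powr (\<kappa> * real j) * Q * snorm K 0 x"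
          by (simp add: algebra_simps powr_add)
        also have "\<dots> \<le> (2 powr \<kappa> + 1) * 2 powr (\<kappa> * real j) * Q * ((s j * c) ^ (m + 1) * ?N)"
        proof (rule mult_left_mono)
          have sc: "0 \<le> s j * c" "0 \<le> s (Suc j) * c" "s (Suc j) * c \<le> s j * c"
            using s c unfolding s_def by (auto intro!: mult_right_mono)
          have "snorm K 0 x \<le> (s (Suc j) * c) ^ i * snorm K i w"
            using Dn[OF w, where k=K and l=0 and j="Suc j" and i=i] unfolding x_def c_def by simp
          also have "\<dots> \<le> (s j * c) ^ i * ((s j * c) ^ (m + 1 - i) * snorm K (i + (m + 1 - i)) u)"
          proof (rule mult_mono)
            show "(s (Suc j) * c) ^ i \<le> (s j * c) ^ i" by (rule power_mono[OF sc(3) sc(2)])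
            show "snorm K i w \<le> (s j * c) ^ (m + 1 - i) * snorm K (i + (m + 1 - i)) u"
              unfolding w_def c_def by (rule Dn[OF u])
            show "0 \<le> (s j * c) ^ i" using sc(1) by (rule zero_le_power)
          qed simp
          also have "\<dots> = (s j * c) ^ (m + 1) * ?N"
            using i by (simp add: power_add[symmetric] mult.assoc[symmetric] del: power_Suc)
          finally show "snorm K 0 x \<le> (s j * c) ^ (m + 1) * ?N" .
        qed (use Q in simp)
        also have "\<dots> = c ^ (m + 1) * (2 powr \<kappa> + 1) * (2 powr (\<kappa> * real j) * s j ^ (m + 1)) * Q * ?N"
          by (simp only: power_mult_distrib mult_ac)
        also have "2 powr (\<kappa> * real j) * s j ^ (m + 1) = \<rho> ^ j"
        proof -
          have "s j ^ (m + 1) = 2 powr (- (real j * real (m + 1)))"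
          proof -
            have sj: "s j = 2 powr (- real j)"
              unfolding s_def by (simp add: powr_minus powr_realpow power_one_over inverse_eq_divide)
            have "s j ^ (m + 1) = s j powr real (m + 1)" using s(3)[of j] by (rule powr_realpow[symmetric])
            also have "\<dots> = 2 powr (- (real j * real (m + 1)))"
              unfolding sj by (simp only: powr_powr mult_minus_left)
            finally show ?thesis .
          qed
          moreover have "\<rho> ^ j = 2 powr ((\<kappa> - (real m + 1)) * real j)"
            unfolding \<rho>_def by (simp add: powr_realpow[symmetric] powr_powr)
          ultimately show ?thesis by (simp add: powr_add[symmetric] algebra_simps)
        qed
        finally show "cmod (F (?V i) - F (?V (Suc i))) \<le> c ^ (m + 1) * (2 powr \<kappa> + 1) * \<rho> ^ j * Q * ?N" .
      qed
      have "(\<Sum>i<?L. c ^ (m + 1) * (2 powr \<kappa> + 1) * \<rho> ^ j * Q * ?N) = E * \<rho> ^ j * Q * ?N"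
        unfolding E_def by simp
      then show ?thesis using le unfolding eq by (simp only:)
    qed
    have partial: "cmod (F u - F ((D J ^^ ?L) u)) \<le> (I + E / (1 - \<rho>)) * Q * ?N" for J
    proof -
      have "F u - F ((D J ^^ ?L) u) = (F u - F ((D 0 ^^ ?L) u)) + (\<Sum>j<J. F ((D j ^^ ?L) u) - F ((D (Suc j) ^^ ?L) u))"
        by (subst sum_lessThan_telescope') simp
      then have "cmod (F u - F ((D J ^^ ?L) u)) \<le> cmod (F u - F ((D 0 ^^ ?L) u)) + cmod (\<Sum>j<J. F ((D j ^^ ?L) u) - F ((D (Suc j) ^^ ?L) u))"
        by (simp only: norm_triangle_ineq)
      also have "\<dots> \<le> I * Q * ?N + (\<Sum>j<J. E * \<rho> ^ j * Q * ?N)"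
        by (intro add_mono first sum_norm_le step)
      also have "(\<Sum>j<J. E * \<rho> ^ j * Q * ?N) = (\<Sum>j<J. \<rho> ^ j) * (E * Q * ?N)"
        unfolding sum_distrib_right by (intro sum.cong refl) (simp only: mult_ac)
      also have "\<dots> \<le> 1 / (1 - \<rho>) * (E * Q * ?N)"
      proof (rule mult_right_mono)
        have "(\<Sum>j<J. \<rho> ^ j) \<le> (\<Sum>j. \<rho> ^ j)"
          using \<rho> by (intro sum_le_suminf summable_geometric) auto
        then show "(\<Sum>j<J. \<rho> ^ j) \<le> 1 / (1 - \<rho>)" using \<rho> by (simp add: suminf_geometric)
      qed (use E Q in simp)
      finally show ?thesis by (simp add: algebra_simps)
    qed
    obtain C' k l where C': "\<And>u. u \<in> schwartz \<Longrightarrow> cmod (F u) \<le> C' * snorm k l u" using bd by blast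
    define c' where "c' = real CARD('n) * absmoment \<phi> (Suc k)"
    have c': "0 \<le> c'" unfolding c'_def using absmoment_nonneg[of \<phi> "Suc k"] by simp
    let ?t = "\<lambda>J. max C' 0 * (c' ^ ?L * snorm k (l + ?L) u) * s J"
    have tail: "cmod (F ((D J ^^ ?L) u)) \<le> ?t J" for J
    proof -
      have "cmod (F ((D J ^^ ?L) u)) \<le> C' * snorm k l ((D J ^^ ?L) u)" by (rule C'[OF DS[OF u]])
      also have "\<dots> \<le> max C' 0 * snorm k l ((D J ^^ ?L) u)" by (intro mult_right_mono) auto
      also have "\<dots> \<le> max C' 0 * ((s J * c') ^ ?L * snorm k (l + ?L) u)"
        unfolding c'_def by (intro mult_left_mono Dn[OF u]) auto
      also have "\<dots> \<le> max C' 0 * ((s J * 1 * c' ^ ?L) * snorm k (l + ?L) u)"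
      proof (intro mult_left_mono mult_right_mono)
        have "(s J * c') ^ ?L = s J * s J ^ (m + 1) * c' ^ ?L" by (simp add: power_mult_distrib)
        also have "\<dots> \<le> s J * 1 * c' ^ ?L"
          using s c' by (intro mult_right_mono mult_left_mono power_le_one) auto
        finally show "(s J * c') ^ ?L \<le> s J * 1 * c' ^ ?L" .
      qed auto
      also have "\<dots> = ?t J" by (simp only: mult_ac mult_1)
      finally show ?thesis .
    qed
    have "(\<lambda>J. (I + E / (1 - \<rho>)) * Q * ?N + ?t J) \<longlonglongrightarrow> (I + E / (1 - \<rho>)) * Q * ?N + max C' 0 * (c' ^ ?L * snorm k (l + ?L) u) * 0"
      unfolding s_def by (intro tendsto_intros LIMSEQ_realpow_zero) auto
    moreover have "cmod (F u) \<le> (I + E / (1 - \<rho>)) * Q * ?N + ?t J" for J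
      using partial[of J] tail[of J] norm_triangle_ineq2[of "F u" "F ((D J ^^ ?L) u)"] by linarith
    ultimately have "cmod (F u) \<le> (I + E / (1 - \<rho>)) * Q * ?N"
      by (intro LIMSEQ_le_const[where X="\<lambda>J. (I + E / (1 - \<rho>)) * Q * ?N + ?t J"]) auto
    also have "\<dots> \<le> C * Q * ?N" unfolding C_def using Q by (intro mult_right_mono) auto
    finally show "cmod (F u) \<le> C * Q * ?N" .
  qed
qed

end

section \<open>Pointwise bounds at unit scale\<close>

lemma ennpow_le_iff:
  assumes "0 < r" shows "a ennpow r \<le> M \<longleftrightarrow> a \<le> M ennpow (1 / r)"
proof (cases a; cases M)
  fix x y assume x: "a = ennreal x" "0 \<le> x" and y: "M = ennreal y" "0 \<le> y"
  have "x powr r \<le> y \<longleftrightarrow> x \<le> y powr (1 / r)"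
  proof
    assume "x powr r \<le> y"
    then have "(x powr r) powr (1 / r) \<le> y powr (1 / r)" using assms by (intro powr_mono2) auto
    then show "x \<le> y powr (1 / r)" using assms x by (simp add: powr_powr)
  next
    assume "x \<le> y powr (1 / r)"
    then have "x powr r \<le> (y powr (1 / r)) powr r" using assms x by (intro powr_mono2) auto
    then show "x powr r \<le> y" using assms y by (simp add: powr_powr)
  qed
  then show ?thesis using x y by (simp add: ennpow_ennreal)
qed (auto simp: ennpow_top ennreal_powr_def top_unique)

text \<open>Balls correspond under the dilation, and volumes and integrals scale by the same power of \<open>a\<close>.\<close>
lemma maxop_rescale_le:
  fixes h :: "real^'n \<Rightarrow> ennreal"
  assumes h [measurable]: "h \<in> borel_measurable lebesgue" and a: "0 < a"
  shows "maxop (\<lambda>x. h (a *\<^sub>R x)) x \<le> maxop h (a *\<^sub>R x)"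
  unfolding maxop_def[of "\<lambda>x. h (a *\<^sub>R x)"]
proof (rule SUP_least, clarify)
  let ?n = "CARD('n)"
  fix c and \<rho> :: real assume x: "x \<in> ball c \<rho>"
  then have \<rho>: "0 < \<rho>" by (metis ball_eq_empty emptyE not_le)
  have a\<rho>: "0 < a * \<rho>" using a \<rho> by simp
  have ballm [measurable]: "ball c r \<in> sets lebesgue" for c :: "real^'n" and r by simp
  have iff: "a *\<^sub>R y \<in> ball (a *\<^sub>R c) (a * \<rho>) \<longleftrightarrow> y \<in> ball c \<rho>" for y
  proof -
    have "dist (a *\<^sub>R c) (a *\<^sub>R y) = a * dist c y"
      using a by (simp add: dist_norm scaleR_right_diff_distrib[symmetric])
    then show ?thesis using a by simp
  qed
  have "(\<integral>\<^sup>+y\<in>ball (a *\<^sub>R c) (a * \<rho>). h y \<partial>lebesgue) =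
      ennreal (\<bar>a\<bar> ^ ?n) * (\<integral>\<^sup>+y. h (0 + a *\<^sub>R y) * indicator (ball (a *\<^sub>R c) (a * \<rho>)) (0 + a *\<^sub>R y) \<partial>lebesgue)"
    using a by (intro nn_integral_lebesgue_affine) auto
  also have "(\<integral>\<^sup>+y. h (0 + a *\<^sub>R y) * indicator (ball (a *\<^sub>R c) (a * \<rho>)) (0 + a *\<^sub>R y) \<partial>lebesgue) = (\<integral>\<^sup>+y\<in>ball c \<rho>. h (a *\<^sub>R y) \<partial>lebesgue)"
  proof (rule nn_integral_cong)
    fix y
    have "(indicator (ball (a *\<^sub>R c) (a * \<rho>)) (0 + a *\<^sub>R y) :: ennreal) = indicator (ball c \<rho>) y"
      unfolding add_0 indicator_def using iff[of y] by (simp only:)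
    then show "h (0 + a *\<^sub>R y) * indicator (ball (a *\<^sub>R c) (a * \<rho>)) (0 + a *\<^sub>R y) = h (a *\<^sub>R y) * indicator (ball c \<rho>) y"
      by (simp only: add_0)
  qed
  finally have I: "(\<integral>\<^sup>+y\<in>ball (a *\<^sub>R c) (a * \<rho>). h y \<partial>lebesgue) = ennreal (a ^ ?n) * (\<integral>\<^sup>+y\<in>ball c \<rho>. h (a *\<^sub>R y) \<partial>lebesgue)"
    using a by simp
  let ?v = "unit_ball_vol (real ?n)"
  have v: "0 < ?v * \<rho> ^ ?n" using \<rho> by (intro mult_pos_pos) (auto simp: unit_ball_vol_pos)
  have va: "0 < ?v * (a * \<rho>) ^ ?n" using a\<rho> by (intro mult_pos_pos) (auto simp: unit_ball_vol_pos)
  have eq: "1 / (?v * (a * \<rho>) ^ ?n) * a ^ ?n = 1 / (?v * \<rho> ^ ?n)"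
    using a by (simp add: power_mult_distrib)
  have "(\<integral>\<^sup>+y\<in>ball c \<rho>. h (a *\<^sub>R y) \<partial>lebesgue) / emeasure lebesgue (ball c \<rho>) =
     ennreal (1 / (?v * \<rho> ^ ?n)) * (\<integral>\<^sup>+y\<in>ball c \<rho>. h (a *\<^sub>R y) \<partial>lebesgue)"
    unfolding emeasure_lebesgue_ball[OF \<rho>] by (rule ennreal_divide_eq_mult[OF v])
  also have "\<dots> = ennreal (1 / (?v * (a * \<rho>) ^ ?n)) * (ennreal (a ^ ?n) * (\<integral>\<^sup>+y\<in>ball c \<rho>. h (a *\<^sub>R y) \<partial>lebesgue))"
  proof -
    have "0 \<le> a ^ ?n" using a by simp
    from ennreal_mult''[OF this, of "1 / (?v * (a * \<rho>) ^ ?n)"]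
    show ?thesis unfolding eq by (simp only: mult.assoc)
  qed
  also have "\<dots> = (\<integral>\<^sup>+y\<in>ball (a *\<^sub>R c) (a * \<rho>). h y \<partial>lebesgue) / emeasure lebesgue (ball (a *\<^sub>R c) (a * \<rho>))"
    unfolding I[symmetric] emeasure_lebesgue_ball[OF a\<rho>] by (rule ennreal_divide_eq_mult[OF va, symmetric])
  also have "\<dots> \<le> maxop h (a *\<^sub>R x)"
    unfolding maxop_def using x iff[of x] by (intro SUP_upper2[of "(a *\<^sub>R c, a * \<rho>)"]) (simp_all only: mem_Collect_eq prod.case order_refl)
  finally show "(\<integral>\<^sup>+y\<in>ball c \<rho>. h (a *\<^sub>R y) \<partial>lebesgue) / emeasure lebesgue (ball c \<rho>) \<le> maxop h (a *\<^sub>R x)" .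
qed

lemma maxop_rescale:
  fixes h :: "real^'n \<Rightarrow> ennreal"
  assumes h [measurable]: "h \<in> borel_measurable lebesgue" and a: "0 < a"
  shows "maxop (\<lambda>x. h (a *\<^sub>R x)) x = maxop h (a *\<^sub>R x)"
proof (rule antisym[OF maxop_rescale_le[OF assms]])
  have "(\<lambda>x. h (a *\<^sub>R x)) \<in> borel_measurable lebesgue" by measurable
  from maxop_rescale_le[OF this, of "1 / a" "a *\<^sub>R x"] a
  show "maxop h (a *\<^sub>R x) \<le> maxop (\<lambda>x. h (a *\<^sub>R x)) x" by simp
qed

context approximate_identity
begin

text \<open>For \<open>r < 1\<close> the integral of \<open>|v| b\<close> with \<open>b = |\<phi>\<^sub>s * f(y - \<cdot>)|\<close> is estimated by writing \<open>b = b\<^sup>1\<^sup>-\<^sup>r b\<^sup>r\<close>. The first factor is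
  bounded pointwise through \<open>maxop_peetre\<close>, which costs \<open>s\<^sup>-\<^sup>\<kappa> (1 + |z|)\<^sup>\<kappa>\<close> with \<open>\<kappa> = n / r - n\<close>; the second is integrated
  against the remaining decay of \<open>v\<close>. Since \<open>\<kappa> < m + 1\<close> and \<open>(m + 2)(n + 1) \<ge> (m + 1) + (n + 1)\<close>, the kernel left
  over decays like \<open>(1 + |z|)\<^sup>-\<^sup>n\<^sup>-\<^sup>1\<close>.\<close>
lemma convolution_pairing_bound:
  fixes f :: "(real^'n \<Rightarrow> complex) \<Rightarrow> complex" and G :: "real^'n \<Rightarrow> ennreal" and m :: nat
  defines "n \<equiv> CARD('n)"
  assumes f: "f \<in> tempered_distributions" and v: "v \<in> schwartz" and G [measurable]: "G \<in> borel_measurable lebesgue"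
    and r: "0 < r" "r < 1" and m: "real n / r - real n < real m + 1" and c1: "0 < c1" and s: "0 < s" "s \<le> 1"
    and H: "\<And>z w. dist z w < s \<Longrightarrow> ennreal (cmod (dist_conv (dilation \<phi> s) f z) powr r) \<le> ennreal c1 * G w"
    and xy: "dist x y < 2" and \<mu>: "maxop G x = ennreal \<mu>" "0 \<le> \<mu>"
    and K0: "0 < K0" "\<And>(h :: real^'n \<Rightarrow> ennreal) x y. h \<in> borel_measurable lebesgue \<Longrightarrow> dist x y < 2 \<Longrightarrow>
      (\<integral>\<^sup>+z. ennreal (1 / (1 + norm (y - z)) ^ (CARD('n) + 1)) * h z \<partial>lebesgue) \<le> ennreal K0 * maxop h x"
  shows "cmod (dist_conv (mollify \<phi> s v) f y) \<le>
    K0 * 3 powr (real n / r - real n) * (c1 * \<mu>) powr (1 / r) * (1 / s) powr (real n / r - real n) * snorm ((m + 2) * (n + 1)) 0 v"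
proof -
  define \<kappa> where "\<kappa> = real n / r - real n"
  define K where "K = (m + 2) * (n + 1)"
  define N where "N = snorm K 0 v"
  have N: "0 \<le> N" unfolding N_def by simp
  have \<kappa>: "0 \<le> \<kappa>" "\<kappa> < real m + 1" "real n * ((1 - r) / r) = \<kappa>"
  proof -
    show e: "real n * ((1 - r) / r) = \<kappa>" unfolding \<kappa>_def using r by (simp add: field_simps)
    show "0 \<le> \<kappa>" unfolding e[symmetric] using r by simp
    show "\<kappa> < real m + 1" unfolding \<kappa>_def by (rule m)
  qed
  have dS: "dilation \<phi> s \<in> schwartz" by (rule schwartz_dilation[OF \<phi> s(1)])
  define g where "g = dist_conv (dilation \<phi> s) f"
  have [measurable]: "g \<in> borel_measurable borel"
    unfolding g_def by (intro borel_measurable_continuous_onI dist_conv_continuous f dS)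
  have [measurable]: "v \<in> borel_measurable borel" using v by (rule schwartz_measurable)
  have mollify: "dist_conv (mollify \<phi> s v) f y = (LINT z|lborel. v z * g (y - z))"
    unfolding mollify_swap[OF \<phi> v s(1)] g_def by (rule dist_conv_mollify[OF f v dS])
  define A where "A = N * ((c1 * \<mu>) powr ((1 - r) / r) * (3 / s) powr \<kappa>)"
  have A: "0 \<le> A" unfolding A_def using N by simp
  have point: "ennreal (cmod (v z * g (y - z))) \<le> ennreal (A * c1) * (ennreal (1 / (1 + norm z) ^ (n + 1)) * G (y - z))" for z
  proof -
    define b where "b = cmod (g (y - z))"
    have b: "0 \<le> b" unfolding b_def by simp
    let ?X = "c1 * ((1 + dist (y - z) x / s) ^ n * \<mu>)"
    have z1: "0 < 1 + norm z" by (simp add: add_pos_nonneg)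
    have "ennreal (b powr r) \<le> ennreal c1 * (ennreal ((1 + dist (y - z) x / s) ^ n) * maxop G x)"
      unfolding b_def g_def n_def by (rule maxop_peetre[OF G s(1) H])
    also have "\<dots> = ennreal ?X"
      unfolding \<mu>(1) using c1 s by (simp add: ennreal_mult''[symmetric] ennreal_mult'[symmetric] \<mu>(2))
    finally have bX: "b powr r \<le> ?X" using c1 s \<mu>(2) by (subst (asm) ennreal_le_iff) auto
    have d: "1 + dist (y - z) x / s \<le> 3 / s * (1 + norm z)"
    proof -
      have "dist (y - z) x \<le> dist (y - z) y + dist y x" by (rule dist_triangle)
      moreover have "dist (y - z) y = norm z" by (simp add: dist_norm)
      moreover have "dist y x < 2" using xy by (simp only: dist_commute)
      ultimately have "dist (y - z) x \<le> norm z + 2" by linarith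
      then have "s + dist (y - z) x \<le> 1 + (norm z + 2)" using s(2) by (rule add_mono[rotated])
      also have "\<dots> \<le> 3 * (1 + norm z)" by simp
      finally have "s + dist (y - z) x \<le> 3 * (1 + norm z)" .
      then have "(s + dist (y - z) x) / s \<le> 3 * (1 + norm z) / s" using s by (intro divide_right_mono) auto
      moreover have "(s + dist (y - z) x) / s = 1 + dist (y - z) x / s" using s by (simp add: add_divide_distrib)
      ultimately show ?thesis by simp
    qed
    have "?X powr ((1 - r) / r) \<le> (c1 * ((3 / s * (1 + norm z)) ^ n * \<mu>)) powr ((1 - r) / r)"
      using r c1 s \<mu>(2) d by (intro powr_mono2 mult_left_mono mult_right_mono power_mono) auto
    also have "\<dots> = (c1 * \<mu>) powr ((1 - r) / r) * ((3 / s) powr \<kappa> * (1 + norm z) powr \<kappa>)"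
    proof -
      have "((3 / s * (1 + norm z)) ^ n) powr ((1 - r) / r) = ((3 / s * (1 + norm z)) powr real n) powr ((1 - r) / r)"
        using s z1 by (subst powr_realpow) auto
      also have "\<dots> = (3 / s * (1 + norm z)) powr \<kappa>" unfolding powr_powr \<kappa>(3) ..
      also have "\<dots> = (3 / s) powr \<kappa> * (1 + norm z) powr \<kappa>" by (rule powr_mult)
      finally have e: "((3 / s * (1 + norm z)) ^ n) powr ((1 - r) / r) = (3 / s) powr \<kappa> * (1 + norm z) powr \<kappa>" .
      have "c1 * ((3 / s * (1 + norm z)) ^ n * \<mu>) = (c1 * \<mu>) * (3 / s * (1 + norm z)) ^ n" by (simp only: mult_ac)
      then have "(c1 * ((3 / s * (1 + norm z)) ^ n * \<mu>)) powr ((1 - r) / r) = (c1 * \<mu>) powr ((1 - r) / r) * ((3 / s * (1 + norm z)) ^ n) powr ((1 - r) / r)"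
        by (simp only:) (rule powr_mult)
      then show ?thesis unfolding e .
    qed
    also have "\<dots> \<le> (c1 * \<mu>) powr ((1 - r) / r) * ((3 / s) powr \<kappa> * (1 + norm z) ^ (m + 1))"
    proof (intro mult_left_mono)
      have "(1 + norm z) powr \<kappa> \<le> (1 + norm z) powr real (m + 1)" using \<kappa> by (intro powr_mono) auto
      also have "\<dots> = (1 + norm z) ^ (m + 1)" using z1 by (rule powr_realpow)
      finally show "(1 + norm z) powr \<kappa> \<le> (1 + norm z) ^ (m + 1)" .
    qed auto
    finally have X: "?X powr ((1 - r) / r) \<le> (c1 * \<mu>) powr ((1 - r) / r) * ((3 / s) powr \<kappa> * (1 + norm z) ^ (m + 1))" .
    have bb: "b \<le> (c1 * \<mu>) powr ((1 - r) / r) * ((3 / s) powr \<kappa> * (1 + norm z) ^ (m + 1)) * b powr r"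
    proof (cases "b = 0")
      case False
      then have "b = b powr 1" using b by simp
      also have "1 = r * ((1 - r) / r) + r" using r by simp
      also have "b powr (r * ((1 - r) / r) + r) = (b powr r) powr ((1 - r) / r) * b powr r"
        unfolding powr_add powr_powr ..
      also have "\<dots> \<le> ?X powr ((1 - r) / r) * b powr r"
        using r bX by (intro mult_right_mono powr_mono2) auto
      also have "\<dots> \<le> (c1 * \<mu>) powr ((1 - r) / r) * ((3 / s) powr \<kappa> * (1 + norm z) ^ (m + 1)) * b powr r"
        using X by (rule mult_right_mono) simp
      finally show ?thesis .
    qed simp
    have vz: "cmod (v z) * (1 + norm z) ^ (m + 1) \<le> N * (1 / (1 + norm z) ^ (n + 1))"
    proof -
      have "(1 + norm z) ^ (m + 1) * (1 + norm z) ^ (n + 1) \<le> (1 + norm z) ^ K"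
        unfolding power_add[symmetric] K_def by (intro power_increasing) auto
      then have "cmod (v z) * ((1 + norm z) ^ (m + 1) * (1 + norm z) ^ (n + 1)) \<le> cmod (v z) * (1 + norm z) ^ K"
        by (rule mult_left_mono) simp
      also have "\<dots> \<le> N" unfolding N_def using snorm_bound[OF v, of "[]" 0 z K] by (simp add: mult.commute)
      finally have "cmod (v z) * (1 + norm z) ^ (m + 1) * (1 + norm z) ^ (n + 1) \<le> N" by (simp only: mult.assoc)
      moreover have "0 < (1 + norm z) ^ (n + 1)" using z1 by simp
      ultimately show ?thesis by (simp only: pos_le_divide_eq times_divide_eq_right mult_1_right)
    qed
    have "cmod (v z * g (y - z)) = cmod (v z) * b" unfolding b_def by (simp add: norm_mult)
    also have "\<dots> \<le> cmod (v z) * ((c1 * \<mu>) powr ((1 - r) / r) * ((3 / s) powr \<kappa> * (1 + norm z) ^ (m + 1)) * b powr r)"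
      using bb by (rule mult_left_mono) simp
    also have "\<dots> = (cmod (v z) * (1 + norm z) ^ (m + 1)) * ((c1 * \<mu>) powr ((1 - r) / r) * (3 / s) powr \<kappa> * b powr r)"
      by (simp only: mult_ac)
    also have "\<dots> \<le> (N * (1 / (1 + norm z) ^ (n + 1))) * ((c1 * \<mu>) powr ((1 - r) / r) * (3 / s) powr \<kappa> * b powr r)"
      using vz by (rule mult_right_mono) simp
    also have "\<dots> = A * (1 / (1 + norm z) ^ (n + 1)) * b powr r" unfolding A_def by (simp only: mult_ac)
    finally have "ennreal (cmod (v z * g (y - z))) \<le> ennreal (A * (1 / (1 + norm z) ^ (n + 1)) * b powr r)" by (rule ennreal_leI)
    also have "\<dots> = ennreal A * ennreal (1 / (1 + norm z) ^ (n + 1)) * ennreal (b powr r)"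
    proof -
      have "0 \<le> 1 / (1 + norm z) ^ (n + 1)" using z1 by simp
      then show ?thesis by (simp only: ennreal_mult''[OF powr_ge_zero] ennreal_mult'')
    qed
    also have "\<dots> \<le> ennreal A * ennreal (1 / (1 + norm z) ^ (n + 1)) * (ennreal c1 * G (y - z))"
      unfolding b_def g_def using s by (intro mult_left_mono H) auto
    also have "\<dots> = ennreal (A * c1) * (ennreal (1 / (1 + norm z) ^ (n + 1)) * G (y - z))"
      using c1 by (simp only: ennreal_mult''[OF less_imp_le[OF c1]] mult_ac)
    finally show ?thesis .
  qed
  have "ennreal (cmod (LINT z|lborel. v z * g (y - z))) \<le> (\<integral>\<^sup>+z. ennreal (cmod (v z * g (y - z))) \<partial>lborel)"
  proof (cases "integrable lborel (\<lambda>z. v z * g (y - z))")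
    case True
    then show ?thesis by (rule integral_norm_bound_ennreal)
  qed (simp add: not_integrable_integral_eq)
  also have "\<dots> = (\<integral>\<^sup>+z. ennreal (cmod (v z * g (y - z))) \<partial>lebesgue)"
    by (rule nn_integral_completion[symmetric])
  also have "\<dots> \<le> (\<integral>\<^sup>+z. ennreal (A * c1) * (ennreal (1 / (1 + norm z) ^ (n + 1)) * G (y - z)) \<partial>lebesgue)"
    by (rule nn_integral_mono) (rule point)
  also have "\<dots> = ennreal (A * c1) * (\<integral>\<^sup>+z. ennreal (1 / (1 + norm z) ^ (n + 1)) * G (y - z) \<partial>lebesgue)"
  proof (rule nn_integral_cmult)
    have [measurable]: "(\<lambda>z. y - z) \<in> lebesgue \<rightarrow>\<^sub>M lebesgue"
    proof -
      have "(\<lambda>x :: real^'n. y + (\<Sum>j\<in>Basis. (-1 * (x \<bullet> j)) *\<^sub>R j)) = (\<lambda>x. y - x)"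
        by (simp add: sum_negf euclidean_representation)
      then show ?thesis using lebesgue_affine_measurable[of "\<lambda>_ :: real^'n. -1" y] by simp
    qed
    have [measurable]: "(\<lambda>z :: real^'n. ennreal (1 / (1 + norm z) ^ (n + 1))) \<in> borel_measurable lebesgue"
      by (rule measurable_completion) measurable
    show "(\<lambda>z. ennreal (1 / (1 + norm z) ^ (n + 1)) * G (y - z)) \<in> borel_measurable lebesgue"
      by measurable
  qed
  also have "(\<integral>\<^sup>+z. ennreal (1 / (1 + norm z) ^ (n + 1)) * G (y - z) \<partial>lebesgue) =
      (\<integral>\<^sup>+z. ennreal (1 / (1 + norm (y - z)) ^ (n + 1)) * G z \<partial>lebesgue)"
  proof -
    have m: "(\<lambda>z. ennreal (1 / (1 + norm (y - z)) ^ (n + 1)) * G z) \<in> borel_measurable lebesgue"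
    proof -
      have [measurable]: "(\<lambda>z :: real^'n. ennreal (1 / (1 + norm (y - z)) ^ (n + 1))) \<in> borel_measurable lebesgue"
        by (rule measurable_completion) measurable
      show ?thesis by measurable
    qed
    show ?thesis using nn_integral_lebesgue_affine[OF m, of "-1" y] by simp
  qed
  also have "\<dots> \<le> ennreal K0 * maxop G x" unfolding n_def by (rule K0(2)[OF G xy])
  finally have "ennreal (cmod (LINT z|lborel. v z * g (y - z))) \<le> ennreal (A * c1) * (ennreal K0 * ennreal \<mu>)"
    unfolding \<mu>(1) by (simp add: mult_left_mono)
  also have "\<dots> = ennreal (A * c1 * (K0 * \<mu>))"
    using A c1 K0(1) \<mu>(2) by (simp add: ennreal_mult)
  finally have le: "cmod (LINT z|lborel. v z * g (y - z)) \<le> A * c1 * (K0 * \<mu>)"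
    using A c1 K0(1) \<mu>(2) by (subst (asm) ennreal_le_iff) auto
  have "A * c1 * (K0 * \<mu>) = K0 * N * (3 / s) powr \<kappa> * ((c1 * \<mu>) * (c1 * \<mu>) powr ((1 - r) / r))"
    unfolding A_def by (simp only: mult_ac)
  also have "(c1 * \<mu>) * (c1 * \<mu>) powr ((1 - r) / r) = (c1 * \<mu>) powr (1 + (1 - r) / r)"
    using c1 \<mu>(2) by (intro powr_mult_base) simp
  also have "1 + (1 - r) / r = 1 / r" using r by (simp add: field_simps)
  also have "(3 / s) powr \<kappa> = 3 powr \<kappa> * (1 / s) powr \<kappa>"
    using s powr_mult[of 3 "1 / s" \<kappa>] by simp
  also have "K0 * N * (3 powr \<kappa> * (1 / s) powr \<kappa>) * (c1 * \<mu>) powr (1 / r) =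
      K0 * 3 powr \<kappa> * (c1 * \<mu>) powr (1 / r) * (1 / s) powr \<kappa> * N"
    by (simp only: mult_ac)
  finally have eq: "A * c1 * (K0 * \<mu>) = K0 * 3 powr \<kappa> * (c1 * \<mu>) powr (1 / r) * (1 / s) powr \<kappa> * N" .
  show ?thesis using le[unfolded eq] unfolding mollify \<kappa>_def[symmetric] N_def K_def .
qed

text \<open>The constant has to be the same for all \<open>f\<close> and \<open>G\<close>, so that the estimate survives dilations of \<open>f\<close>; this unit scale
  version then implies the one for all \<open>t > 0\<close>.\<close>
lemma local_maximal_bound:
  fixes m :: nat
  defines "n \<equiv> CARD('n)"
  assumes r: "0 < r" "r < 1" and m: "real n / r - real n < real m + 1" and c1: "0 < c1" and S: "0 < S"
  shows "\<exists>C>0. \<forall>f G u x y. f \<in> tempered_distributions \<longrightarrow> G \<in> borel_measurable lebesgue \<longrightarrow>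
    (\<forall>j::nat. \<forall>z w. dist z w < (1/2) ^ j \<longrightarrow>
       ennreal (cmod (dist_conv (dilation \<phi> ((1/2) ^ j)) f z) powr r) \<le> ennreal c1 * G w) \<longrightarrow>
    u \<in> schwartz \<longrightarrow> snorm ((m + 2) * (n + 1)) (m + 1) u \<le> S \<longrightarrow> dist x y < 2 \<longrightarrow>
    ennreal (cmod (dist_conv u f y) powr r) \<le> ennreal C * maxop G x"
proof -
  let ?K = "(m + 2) * (n + 1)"
  define \<kappa> where "\<kappa> = real n / r - real n"
  have \<kappa>: "\<kappa> < real m + 1" unfolding \<kappa>_def by (rule m)
  obtain K0 where K0: "0 < K0" "\<And>(h :: real^'n \<Rightarrow> ennreal) x y. h \<in> borel_measurable lebesgue \<Longrightarrow> dist x y < 2 \<Longrightarrow>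
      (\<integral>\<^sup>+z. ennreal (1 / (1 + norm (y - z)) ^ (CARD('n) + 1)) * h z \<partial>lebesgue) \<le> ennreal K0 * maxop h x"
    using polynomial_kernel_maxop by blast
  obtain C1 where C1: "0 < C1" and rep: "\<And>F Q u. 0 \<le> Q \<Longrightarrow> u \<in> schwartz \<Longrightarrow>
    (\<forall>u\<in>schwartz. \<forall>v\<in>schwartz. F (\<lambda>x. u x - v x) = F u - F v) \<Longrightarrow>
    (\<exists>C' k l. \<forall>u\<in>schwartz. cmod (F u) \<le> C' * snorm k l u) \<Longrightarrow>
    (\<forall>j. \<forall>v\<in>schwartz. cmod (F (mollify \<phi> ((1/2) ^ j) v)) \<le> Q * 2 powr (\<kappa> * real j) * snorm ?K 0 v) \<Longrightarrow>
    cmod (F u) \<le> C1 * Q * snorm ?K (m + 1) u"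
    using reproducing_estimate[OF \<kappa>, of ?K] by blast
  define C where "C = (C1 * K0 * 3 powr \<kappa> * S) powr r * c1"
  have C: "0 < C" unfolding C_def using C1 K0(1) S c1 by simp
  show ?thesis
  proof (intro exI[of _ C] conjI allI impI C)
    fix f and G :: "real^'n \<Rightarrow> ennreal" and u :: "real^'n \<Rightarrow> complex" and x y :: "real^'n"
    assume f: "f \<in> tempered_distributions" and G: "G \<in> borel_measurable lebesgue"
      and H: "\<forall>j::nat. \<forall>z w. dist z w < (1/2) ^ j \<longrightarrow>
       ennreal (cmod (dist_conv (dilation \<phi> ((1/2) ^ j)) f z) powr r) \<le> ennreal c1 * G w"
      and u: "u \<in> schwartz" and Su: "snorm ?K (m + 1) u \<le> S" and xy: "dist x y < 2"
    show "ennreal (cmod (dist_conv u f y) powr r) \<le> ennreal C * maxop G x"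
    proof (cases "maxop G x")
      case top
      then show ?thesis using C by (simp add: ennreal_mult_top)
    next
      case (real \<mu>)
      define Q where "Q = K0 * 3 powr \<kappa> * (c1 * \<mu>) powr (1 / r)"
      have Q: "0 \<le> Q" unfolding Q_def using K0(1) by simp
      have "cmod (dist_conv u f y) \<le> C1 * Q * snorm ?K (m + 1) u"
      proof (rule rep[OF Q u])
        show "\<forall>u\<in>schwartz. \<forall>v\<in>schwartz. dist_conv (\<lambda>x. u x - v x) f y = dist_conv u f y - dist_conv v f y"
          unfolding dist_conv_def by (intro ballI tempered_diff f schwartz_reflect)
        obtain C' k l where C': "0 < C'" "\<And>u. u \<in> schwartz \<Longrightarrow> cmod (f u) \<le> C' * snorm k l u"
          using tempered_bound[OF f] by blast
        show "\<exists>C' k l. \<forall>u\<in>schwartz. cmod (dist_conv u f y) \<le> C' * snorm k l u"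
        proof (intro exI ballI)
          fix u :: "real^'n \<Rightarrow> complex" assume u: "u \<in> schwartz"
          have "cmod (dist_conv u f y) \<le> C' * snorm k l (\<lambda>y'. u (y - y'))"
            unfolding dist_conv_def by (intro C' schwartz_reflect u)
          also have "\<dots> \<le> C' * ((1 + norm y) ^ k * 2 ^ k * 2 ^ l * snorm k l u)"
            using snorm_affine[OF u, where c="-1" and a=y and k=k and l=l] C'(1) by (intro mult_left_mono) auto
          finally show "cmod (dist_conv u f y) \<le> (C' * ((1 + norm y) ^ k * 2 ^ k * 2 ^ l)) * snorm k l u"
            by (simp only: mult.assoc)
        qed
        show "\<forall>j. \<forall>v\<in>schwartz. cmod (dist_conv (mollify \<phi> ((1/2) ^ j) v) f y) \<le> Q * 2 powr (\<kappa> * real j) * snorm ?K 0 v"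
        proof (intro allI ballI)
          fix j and v :: "real^'n \<Rightarrow> complex" assume v: "v \<in> schwartz"
          have s: "0 < (1/2 :: real) ^ j" "(1/2 :: real) ^ j \<le> 1" by (auto intro: power_le_one)
          have e: "(1 / (1/2 :: real) ^ j) powr \<kappa> = 2 powr (\<kappa> * real j)"
            by (simp add: power_one_over powr_realpow[symmetric] powr_powr mult.commute)
          show "cmod (dist_conv (mollify \<phi> ((1/2) ^ j) v) f y) \<le> Q * 2 powr (\<kappa> * real j) * snorm ?K 0 v"
            using convolution_pairing_bound[OF f v G r m[unfolded n_def] c1 s _ xy real(2,1) K0] H
            unfolding Q_def \<kappa>_def n_def e[unfolded \<kappa>_def n_def, symmetric] by blast
        qed
      qed
      also have "\<dots> \<le> C1 * Q * S" using C1 Q Su by (intro mult_left_mono) auto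
      finally have "cmod (dist_conv u f y) powr r \<le> (C1 * Q * S) powr r" using r by (intro powr_mono2) auto
      also have "C1 * Q * S = (C1 * K0 * 3 powr \<kappa> * S) * (c1 * \<mu>) powr (1 / r)" unfolding Q_def by (simp only: mult_ac)
      also have "\<dots> powr r = (C1 * K0 * 3 powr \<kappa> * S) powr r * ((c1 * \<mu>) powr (1 / r)) powr r"
        by (rule powr_mult)
      also have "((c1 * \<mu>) powr (1 / r)) powr r = c1 * \<mu>"
        using r c1 real by (simp add: powr_powr)
      finally have "cmod (dist_conv u f y) powr r \<le> C * \<mu>" unfolding C_def by (simp only: mult.assoc)
      then show ?thesis unfolding real(2) using C real(1) by (simp add: ennreal_mult''[symmetric] ennreal_leI)
    qed
  qed
qed

end

section \<open>Convolutions with dilates of the given test function\<close>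

text \<open>A lower type \<open>p > 1\<close> is incompatible with upper type \<open>1\<close>: together they give \<open>1 \<le> C D s\<^sup>p\<^sup>-\<^sup>1\<close> for all \<open>s \<in> (0,1]\<close>. Hence the
  supremum that defines \<open>i(\<phi>)\<close> is taken over a bounded set, and \<open>i(\<phi>) \<le> 1 \<le> q(\<phi>)\<close>.\<close>
lemma growth_indices:
  fixes \<phi> :: "real^'n \<Rightarrow> real \<Rightarrow> real"
  assumes G: "growth_function \<phi>"
  shows "bdd_above {p. 0 < p \<and> uniformly_lower_type \<phi> p}" "{p. 0 < p \<and> uniformly_lower_type \<phi> p} \<noteq> {}"
    and "0 < critical_lower_type_index \<phi>" "critical_lower_type_index \<phi> \<le> 1" "1 \<le> critical_weight_index \<phi>"
    and "{q. 1 \<le> q \<and> muckenhoupt \<phi> q} \<noteq> {}"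
proof -
  have le1: "p \<le> 1" if p: "0 < p" "uniformly_lower_type \<phi> p" for p
  proof (rule ccontr)
    assume "\<not> p \<le> 1"
    then have p1: "0 < p - 1" by simp
    obtain C where C: "0 < C" "\<And>x t s. 0 \<le> t \<Longrightarrow> 0 \<le> s \<Longrightarrow> s \<le> 1 \<Longrightarrow> \<phi> x (s * t) \<le> C * s powr p * \<phi> x t"
      using p(2) unfolding uniformly_lower_type_def by auto
    have "uniformly_upper_type \<phi> 1" using G unfolding growth_function_def by simp
    then obtain D where D: "0 < D" "\<And>x t s. 0 \<le> t \<Longrightarrow> 1 \<le> s \<Longrightarrow> \<phi> x (s * t) \<le> D * s powr 1 * \<phi> x t"
      unfolding uniformly_upper_type_def by auto
    define s where "s = min 1 ((1 / (2 * C * D)) powr (1 / (p - 1)))"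
    have s: "0 < s" "s \<le> 1" unfolding s_def using C(1) D(1) by auto
    have "s powr (p - 1) \<le> ((1 / (2 * C * D)) powr (1 / (p - 1))) powr (p - 1)"
      unfolding s_def using p1 C(1) D(1) by (intro powr_mono2) auto
    also have "\<dots> = 1 / (2 * C * D)" using p1 C(1) D(1) by (simp add: powr_powr)
    finally have sp: "s powr (p - 1) \<le> 1 / (2 * C * D)" .
    let ?a = "\<phi> 0 1"
    have a: "0 < ?a" using G unfolding growth_function_def orlicz_function_def by auto
    have "?a \<le> D * (1 / s) * \<phi> 0 s" using D(2)[of s "1 / s" 0] s by simp
    also have "\<dots> \<le> D * (1 / s) * (C * s powr p * ?a)"
      using C(2)[of 1 s 0] s D(1) by (intro mult_left_mono) auto
    also have "D * (1 / s) * (C * s powr p * ?a) = C * D * s powr (p - 1) * ?a"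
      using s by (simp add: powr_diff)
    also have "\<dots> \<le> C * D * (1 / (2 * C * D)) * ?a"
      using sp a C(1) D(1) by (intro mult_right_mono mult_left_mono) auto
    also have "\<dots> = ?a / 2" using C(1) D(1) by simp
    finally show False using a by simp
  qed
  show bdd: "bdd_above {p. 0 < p \<and> uniformly_lower_type \<phi> p}"
    by (rule bdd_aboveI[of _ 1]) (use le1 in auto)
  show ne: "{p. 0 < p \<and> uniformly_lower_type \<phi> p} \<noteq> {}"
    using G unfolding growth_function_def by auto
  then obtain p where p: "0 < p" "uniformly_lower_type \<phi> p" by blast
  have "p \<le> critical_lower_type_index \<phi>"
    unfolding critical_lower_type_index_def using p bdd by (intro cSup_upper) auto
  then show "0 < critical_lower_type_index \<phi>" using p(1) by linarith
  show "critical_lower_type_index \<phi> \<le> 1"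
    unfolding critical_lower_type_index_def using ne le1 by (intro cSup_least) auto
  show ne': "{q. 1 \<le> q \<and> muckenhoupt \<phi> q} \<noteq> {}"
    using G unfolding growth_function_def muckenhoupt_infinity_def by auto
  then show "1 \<le> critical_weight_index \<phi>"
    unfolding critical_weight_index_def by (intro cInf_greatest) auto
qed

text \<open>Take \<open>r = n / T\<close> with \<open>T\<close> strictly between \<open>n q(\<phi>) / i(\<phi>)\<close> and both \<open>A\<close> and \<open>n + m(\<phi>) + 1\<close>; the latter exceeds
  \<open>n q(\<phi>) / i(\<phi>)\<close> since \<open>m(\<phi>)\<close> is the integer part of \<open>n (q(\<phi>) / i(\<phi>) - 1)\<close>. The strict inequality leaves room to
  replace the indices by exponents that are attained.\<close>
lemma exponent_choice:
  fixes \<phi> :: "real^'n \<Rightarrow> real \<Rightarrow> real"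
  assumes G: "growth_function \<phi>"
    and A: "real CARD('n) * critical_weight_index \<phi> / critical_lower_type_index \<phi> < A"
  obtains r p q where "0 < r" "r < 1" "0 < p" "uniformly_lower_type \<phi> p" "1 \<le> q" "muckenhoupt \<phi> q" "q < p / r"
    "real CARD('n) / r \<le> A" "real CARD('n) / r - real CARD('n) < real (critical_order \<phi>) + 1"
proof -
  let ?n = "real CARD('n)" and ?q = "critical_weight_index \<phi>" and ?i = "critical_lower_type_index \<phi>"
  note I = growth_indices[OF G]
  have n: "0 < ?n" by simp
  have "?n * (?q / ?i - 1) < real (critical_order \<phi>) + 1"
    unfolding critical_order_def by linarith
  then have "?n * ?q / ?i < ?n + real (critical_order \<phi>) + 1" by (simp add: algebra_simps)
  then obtain T where T: "?n * ?q / ?i < T" "T < min A (?n + real (critical_order \<phi>) + 1)"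
    using A dense[of "?n * ?q / ?i" "min A (?n + real (critical_order \<phi>) + 1)"] by auto
  have "?i * 1 \<le> 1 * ?q" using I(3,4,5) by (intro mult_mono) auto
  then have "1 \<le> ?q / ?i" using I(3) by (simp add: le_divide_eq)
  then have "?n * 1 \<le> ?n * (?q / ?i)" using n by (intro mult_left_mono) auto
  then have Tn: "?n < T" using T(1) by simp
  then have T0: "0 < T" using n by linarith
  have "?n * ?q / T < ?i" using T(1) I(3) T0 by (simp add: field_simps)
  then obtain p where p: "0 < p" "uniformly_lower_type \<phi> p" "?n * ?q / T < p"
    unfolding critical_lower_type_index_def using less_cSupD[OF I(2)] by auto
  have "?q < T * p / ?n" using p(3) T0 n by (simp add: field_simps)
  then obtain q where q: "1 \<le> q" "muckenhoupt \<phi> q" "q < T * p / ?n"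
    unfolding critical_weight_index_def using cInf_lessD[OF I(6)] by auto
  show ?thesis
  proof (rule that[of "?n / T" p q])
    show "0 < ?n / T" "?n / T < 1" using n T0 Tn by auto
    show "q < p / (?n / T)" using q(3) by (simp add: mult.commute)
    show "?n / (?n / T) \<le> A" "?n / (?n / T) - ?n < real (critical_order \<phi>) + 1" using T(2) n by auto
  qed (use p q in auto)
qed

lemma infsum_le_geometric:
  fixes f :: "int \<Rightarrow> ennreal"
  assumes s: "0 < s" and le: "\<And>k. 0 \<le> k \<Longrightarrow> f k \<le> ennreal (2 powr (- s * real_of_int k)) * X"
  shows "(\<Sum>\<^sub>\<infinity>k\<in>{0..}. f k) \<le> ennreal (1 / (1 - 2 powr - s)) * X"
proof -
  have "(\<Sum>\<^sub>\<infinity>k\<in>{0..}. f k) = (SUP F\<in>{F. finite F \<and> F \<subseteq> {0..}}. sum f F)"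
    by (rule nonneg_infsum_complete) simp
  also have "\<dots> \<le> ennreal (1 / (1 - 2 powr - s)) * X"
  proof (rule SUP_least, clarify)
    fix F :: "int set" assume F: "finite F" "F \<subseteq> {0..}"
    have inj: "inj_on nat F" 
    proof (rule inj_onI)
      fix k l assume "k \<in> F" "l \<in> F" "nat k = nat l"
      moreover from this have "0 \<le> k" "0 \<le> l" using F(2) by auto
      ultimately show "k = l" by (metis int_nat_eq)
    qed
    have "sum f F \<le> (\<Sum>k\<in>F. ennreal ((2 powr - s) ^ nat k) * X)"
    proof (rule sum_mono)
      fix k assume "k \<in> F"
      then have k: "0 \<le> k" using F(2) by auto
      have "2 powr (- s * real_of_int k) = (2 powr - s) ^ nat k"
        using k by (simp add: powr_realpow[symmetric] powr_powr)
      then show "f k \<le> ennreal ((2 powr - s) ^ nat k) * X" using le[OF k] by simp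
    qed
    also have "\<dots> = (\<Sum>i\<in>nat ` F. ennreal ((2 powr - s) ^ i)) * X"
      by (subst sum.reindex[OF inj]) (simp only: comp_def sum_distrib_right)
    also have "\<dots> \<le> (\<Sum>i. ennreal ((2 powr - s) ^ i)) * X"
      using F(1) by (intro mult_right_mono sum_le_suminf) auto
    also have "(\<Sum>i. ennreal ((2 powr - s) ^ i)) = ennreal (1 / (1 - 2 powr - s))"
      using s by (intro suminf_ennreal_eq geometric_sums) (auto simp: powr_less_one)
    finally show "sum f F \<le> ennreal (1 / (1 - 2 powr - s)) * X" .
  qed
  finally show ?thesis .
qed

lemma exponential_le_polynomial_kernel:
  fixes r :: real
  assumes r: "0 < r" and N: "0 < N"
  obtains C where "0 < C" "\<And>t. 0 \<le> t \<Longrightarrow> 2 powr (- r * t) \<le> C * (1 / (1 + t) ^ N)"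
proof -
  define d where "d = min 1 (r * ln 2 / real N)"
  have d: "0 < d" "d \<le> 1" "d * real N \<le> r * ln 2"
    unfolding d_def using r N by (auto simp: min_def field_simps)
  show ?thesis
  proof (rule that[of "1 / d ^ N"])
    show "0 < 1 / d ^ N" using d by simp
    fix t :: real assume t: "0 \<le> t"
    have "d * (1 + t) \<le> 1 + d * t" using d by (simp add: algebra_simps)
    also have "\<dots> \<le> exp (d * t)" by (rule exp_ge_add_one_self)
    finally have "(d * (1 + t)) ^ N \<le> exp (d * t) ^ N" using d t by (intro power_mono) auto
    also have "\<dots> = exp (d * real N * t)" by (simp add: exp_of_nat_mult[symmetric] mult_ac)
    also have "\<dots> \<le> exp (r * ln 2 * t)" using d t by (simp add: mult_right_mono)
    also have "\<dots> = 2 powr (r * t)" by (simp add: powr_def mult_ac)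
    finally have "d ^ N * (1 + t) ^ N \<le> 2 powr (r * t)" by (simp only: power_mult_distrib)
    then have "2 powr (- r * t) * (d ^ N * (1 + t) ^ N) \<le> 2 powr (- r * t) * 2 powr (r * t)"
      by (rule mult_left_mono) simp
    also have "\<dots> = 1" by (simp add: powr_add[symmetric])
    finally have "2 powr (- r * t) * (d ^ N * (1 + t) ^ N) \<le> 1" .
    moreover have "0 < d ^ N * (1 + t) ^ N" using d t by (intro mult_pos_pos zero_less_power) auto
    ultimately have "2 powr (- r * t) \<le> 1 / (d ^ N * (1 + t) ^ N)" by (simp only: pos_le_divide_eq)
    then show "2 powr (- r * t) \<le> 1 / d ^ N * (1 / (1 + t) ^ N)" by simp
  qed
qed

text \<open>The function \<open>M(g\<^sup>r)\<close> that controls a single convolution.\<close>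
definition radial_average :: "(real^'n \<Rightarrow> complex) \<Rightarrow> real \<Rightarrow> ((real^'n \<Rightarrow> complex) \<Rightarrow> complex) \<Rightarrow> real^'n \<Rightarrow> ennreal" where
  "radial_average \<psi> r f = maxop (\<lambda>y. radial_maximal \<psi> f y ennpow r)"

lemma radial_maximal_measurable:
  assumes f: "f \<in> tempered_distributions" and \<psi>: "\<psi> \<in> schwartz"
  shows "radial_maximal \<psi> f \<in> borel_measurable lebesgue"
proof (rule measurable_completion)
  have [measurable]: "dist_conv (dyadic_dilation \<psi> j) f \<in> borel_measurable borel" for j
    by (intro borel_measurable_continuous_onI dist_conv_continuous f schwartz_dyadic_dilation \<psi>)
  show "radial_maximal \<psi> f \<in> borel_measurable lborel"
    unfolding radial_maximal_def[abs_def] by measurable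
qed

lemma radial_maximal_ennpow_measurable:
  assumes "f \<in> tempered_distributions" "\<psi> \<in> schwartz"
  shows "(\<lambda>y. radial_maximal \<psi> f y ennpow r) \<in> borel_measurable lebesgue"
  using radial_maximal_measurable[OF assms] by measurable

text \<open>The admissible constant is applied with \<open>j = 0\<close> and \<open>B = 1\<close>. Every term of the series on its right-hand side is
  at most a geometric factor times \<open>M(g\<^sup>r)(w)\<close>, as the exponential kernel is dominated by the
  polynomial one, and the weight on its left-hand side is bounded for \<open>|z - w| \<le> 1\<close>.\<close>
lemma unit_scale_nontangential_bound:
  fixes \<psi> :: "real^'n \<Rightarrow> complex"
  assumes \<psi>: "\<psi> \<in> test_functions" "(LINT x|lebesgue. \<psi> x) \<noteq> 0" and A0: "admissible_A0 (supp \<psi>) A\<^sub>0" and r: "0 < r"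
  shows "\<exists>c>0. \<forall>f\<in>tempered_distributions. \<forall>z w. dist z w \<le> 1 \<longrightarrow>
     ennreal (cmod (dist_conv (dyadic_dilation \<psi> 0) f z) powr r) \<le> ennreal c * radial_average \<psi> r f w"
proof -
  let ?n = "CARD('n)"
  \<comment> \<open>Any exponent beyond both thresholds will do; it is unrelated to the one in the Peetre maximal function.\<close>
  define A where "A = max A\<^sub>0 (real ?n / r) + 1"
  have A: "max A\<^sub>0 (real ?n / r) < A" "0 \<le> A" unfolding A_def by (auto simp: max_def r add_nonneg_nonneg less_imp_le)
    (smt (verit) r divide_nonneg_pos of_nat_0_le_iff)
  have \<psi>S: "\<psi> \<in> schwartz" by (rule test_functions_subset_schwartz[OF \<psi>(1)])
  have "real ?n / r < A" using A(1) by simp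
  then have s: "0 < A * r - real ?n" using r by (simp add: field_simps)
  define s where "s = A * r - real ?n"
  obtain C0 where C0: "0 < C0" and adm: "\<And>f j x. f \<in> tempered_distributions \<Longrightarrow>
      peetre_maximal_at \<psi> j A 1 f x ennpow r \<le> ennreal C0 *
        (\<Sum>\<^sub>\<infinity>k\<in>{j..}. ennreal (2 powr (of_int (j - k) * (A * r - real CARD('n)))) *
               (hl_maximal (\<lambda>y. cmod (dist_conv (dyadic_dilation \<psi> k) f y) powr r) x +
                exp_convolution (1 * r) (\<lambda>y. cmod (dist_conv (dyadic_dilation \<psi> k) f y) powr r) x))"
  proof -
    have "\<exists>C>0. \<forall>f\<in>tempered_distributions. \<forall>j x. peetre_maximal_at \<psi> j A 1 f x ennpow r \<le> ennreal C *
        (\<Sum>\<^sub>\<infinity>k\<in>{j..}. ennreal (2 powr (of_int (j - k) * (A * r - real CARD('n)))) *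
               (hl_maximal (\<lambda>y. cmod (dist_conv (dyadic_dilation \<psi> k) f y) powr r) x +
                exp_convolution (1 * r) (\<lambda>y. cmod (dist_conv (dyadic_dilation \<psi> k) f y) powr r) x))"
      by (rule A0[unfolded admissible_A0_def, THEN conjunct2, rule_format]) (use \<psi> r A in simp_all)
    then show ?thesis using that by blast
  qed
  obtain K0 where K0: "0 < K0" "\<And>(h :: real^'n \<Rightarrow> ennreal) x y. h \<in> borel_measurable lebesgue \<Longrightarrow> dist x y < 2 \<Longrightarrow>
      (\<integral>\<^sup>+z. ennreal (1 / (1 + norm (y - z)) ^ (CARD('n) + 1)) * h z \<partial>lebesgue) \<le> ennreal K0 * maxop h x"
    using polynomial_kernel_maxop by blast
  obtain Ce where Ce: "0 < Ce" "\<And>t. 0 \<le> t \<Longrightarrow> 2 powr (- r * t) \<le> Ce * (1 / (1 + t) ^ (?n + 1))"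
    using exponential_le_polynomial_kernel[OF r, of "?n + 1"] by auto
  define Cs where "Cs = 1 / (1 - 2 powr - s)"
  have Cs: "0 < Cs" unfolding Cs_def s_def using s by (simp add: powr_less_one)
  define c where "c = (2 powr A * 2) powr r * (C0 * (Cs * (1 + Ce * K0)))"
  have c: "0 < c" unfolding c_def using C0 Cs Ce(1) K0(1) by (intro mult_pos_pos) (auto simp: add_pos_pos)
  show ?thesis
  proof (intro exI[of _ c] conjI ballI allI impI c)
    fix f :: "(real^'n \<Rightarrow> complex) \<Rightarrow> complex" and z w :: "real^'n" assume f: "f \<in> tempered_distributions" and zw: "dist z w \<le> 1"
    let ?G = "radial_average \<psi> r f w"
    let ?h = "\<lambda>k y. cmod (dist_conv (dyadic_dilation \<psi> k) f y) powr r"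
    have hm: "(\<lambda>y. ennreal (?h k y)) \<in> borel_measurable lebesgue" for k
    proof (rule measurable_completion)
      have [measurable]: "dist_conv (dyadic_dilation \<psi> k) f \<in> borel_measurable borel"
        by (intro borel_measurable_continuous_onI dist_conv_continuous f schwartz_dyadic_dilation \<psi>S)
      show "(\<lambda>y. ennreal (?h k y)) \<in> borel_measurable lborel" by measurable
    qed
    have hG: "maxop (\<lambda>y. ennreal (?h k y)) w \<le> ?G" for k
      unfolding radial_average_def
    proof (rule maxop_mono)
      fix y
      have "ennreal (?h k y) = ennreal (cmod (dist_conv (dyadic_dilation \<psi> k) f y)) ennpow r" by (simp add: ennpow_ennreal)
      also have "\<dots> \<le> radial_maximal \<psi> f y ennpow r"
        unfolding radial_maximal_def using r by (intro ennpow_mono SUP_upper) auto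
      finally show "ennreal (?h k y) \<le> radial_maximal \<psi> f y ennpow r" .
    qed
    have hl: "hl_maximal (?h k) w \<le> ?G" for k
      using hG[of k] unfolding maxop_def hl_maximal_def by simp
    have ex: "exp_convolution (1 * r) (?h k) w \<le> ennreal (Ce * K0) * ?G" for k
    proof -
      have [measurable]: "(\<lambda>z :: real^'n. ennreal (1 / (1 + norm (w - z)) ^ (?n + 1))) \<in> borel_measurable lebesgue"
        by (rule measurable_completion) measurable
      note [measurable] = hm[of k]
      have "exp_convolution (1 * r) (?h k) w \<le> (\<integral>\<^sup>+z. ennreal Ce * (ennreal (1 / (1 + norm (w - z)) ^ (?n + 1)) * ennreal (?h k z)) \<partial>lebesgue)"
        unfolding exp_convolution_def
      proof (rule nn_integral_mono)
        fix z
        have "norm (?h k z) * 2 powr (- (1 * r) * norm (w - z)) \<le> ?h k z * (Ce * (1 / (1 + norm (w - z)) ^ (?n + 1)))"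
        proof -
          have "norm (?h k z) = ?h k z" by simp
          moreover have "2 powr (- (1 * r) * norm (w - z)) \<le> Ce * (1 / (1 + norm (w - z)) ^ (?n + 1))"
            unfolding mult_1 by (rule Ce(2)) simp
          ultimately show ?thesis by (metis mult_left_mono powr_ge_zero)
        qed
        then have "ennreal (norm (?h k z) * 2 powr (- (1 * r) * norm (w - z))) \<le> ennreal (Ce * (1 / (1 + norm (w - z)) ^ (?n + 1)) * ?h k z)"
          by (intro ennreal_leI) (simp only: mult_ac)
        also have "\<dots> = ennreal Ce * (ennreal (1 / (1 + norm (w - z)) ^ (?n + 1)) * ennreal (?h k z))"
          by (simp only: ennreal_mult''[OF powr_ge_zero] ennreal_mult'[OF less_imp_le[OF Ce(1)]] mult.assoc)
        finally show "ennreal (norm (?h k z) * 2 powr (- (1 * r) * norm (w - z))) \<le> \<dots>" .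
      qed
      also have "\<dots> = ennreal Ce * (\<integral>\<^sup>+z. (ennreal (1 / (1 + norm (w - z)) ^ (?n + 1)) * ennreal (?h k z)) \<partial>lebesgue)"
        by (rule nn_integral_cmult) measurable
      also have "\<dots> \<le> ennreal Ce * (ennreal K0 * ?G)"
      proof (rule mult_left_mono)
        have "(\<integral>\<^sup>+z. (ennreal (1 / (1 + norm (w - z)) ^ (?n + 1)) * ennreal (?h k z)) \<partial>lebesgue) \<le> ennreal K0 * maxop (\<lambda>y. ennreal (?h k y)) w"
          by (rule K0(2)[OF hm]) simp
        also have "\<dots> \<le> ennreal K0 * ?G" by (rule mult_left_mono[OF hG]) simp
        finally show "(\<integral>\<^sup>+z. (ennreal (1 / (1 + norm (w - z)) ^ (?n + 1)) * ennreal (?h k z)) \<partial>lebesgue) \<le> ennreal K0 * ?G" .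
      qed simp
      also have "\<dots> = ennreal (Ce * K0) * ?G"
        by (simp only: ennreal_mult'[OF less_imp_le[OF Ce(1)]] mult.assoc)
      finally show ?thesis .
    qed
    have "peetre_maximal_at \<psi> 0 A 1 f w ennpow r \<le> ennreal C0 *
        (\<Sum>\<^sub>\<infinity>k\<in>{0..}. ennreal (2 powr (of_int (0 - k) * (A * r - real CARD('n)))) *
               (hl_maximal (?h k) w + exp_convolution (1 * r) (?h k) w))"
      by (rule adm[OF f])
    also have "\<dots> \<le> ennreal C0 * (ennreal Cs * (ennreal (1 + Ce * K0) * ?G))"
    proof (rule mult_left_mono)
      show "(\<Sum>\<^sub>\<infinity>k\<in>{0..}. ennreal (2 powr (of_int (0 - k) * (A * r - real CARD('n)))) *
               (hl_maximal (?h k) w + exp_convolution (1 * r) (?h k) w)) \<le> ennreal Cs * (ennreal (1 + Ce * K0) * ?G)"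
        unfolding Cs_def
      proof (rule infsum_le_geometric)
        show "0 < s" using s unfolding s_def .
        fix k :: int
        have "hl_maximal (?h k) w + exp_convolution (1 * r) (?h k) w \<le> ?G + ennreal (Ce * K0) * ?G"
          by (intro add_mono hl ex)
        also have "\<dots> = ennreal (1 + Ce * K0) * ?G"
          using Ce(1) K0(1) by (simp add: distrib_right)
        finally have "ennreal (2 powr (of_int (0 - k) * (A * r - real CARD('n)))) * (hl_maximal (?h k) w + exp_convolution (1 * r) (?h k) w)
           \<le> ennreal (2 powr (of_int (0 - k) * (A * r - real CARD('n)))) * (ennreal (1 + Ce * K0) * ?G)"
          by (rule mult_left_mono) simp
        moreover have "of_int (0 - k) * (A * r - real CARD('n)) = - s * real_of_int k" unfolding s_def by (simp add: algebra_simps)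
        ultimately show "ennreal (2 powr (of_int (0 - k) * (A * r - real CARD('n)))) * (hl_maximal (?h k) w + exp_convolution (1 * r) (?h k) w)
           \<le> ennreal (2 powr (- s * real_of_int k)) * (ennreal (1 + Ce * K0) * ?G)"
          by (simp only:)
      qed
    qed simp
    finally have P: "peetre_maximal_at \<psi> 0 A 1 f w ennpow r \<le> ennreal C0 * (ennreal Cs * (ennreal (1 + Ce * K0) * ?G))" .
    let ?b = "cmod (dist_conv (dyadic_dilation \<psi> 0) f z)"
    have wt: "0 < peetre_weight 0 A 1 (w - z)" "peetre_weight 0 A 1 (w - z) \<le> 2 powr A * 2"
    proof -
      have nz: "norm (w - z) \<le> 1" using zw by (simp add: dist_norm norm_minus_commute)
      have "0 < 1 + norm (w - z)" by (simp add: add_pos_nonneg)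
      then have "1 + norm (w - z) \<noteq> 0" by (rule less_imp_neq[symmetric])
      then show "0 < peetre_weight 0 A 1 (w - z)" unfolding peetre_weight_def by simp
      have "(1 + norm (w - z)) powr A \<le> 2 powr A" using nz A(2) by (intro powr_mono2) auto
      moreover have "2 powr (norm (w - z)) \<le> 2 powr 1" using nz by (intro powr_mono) auto
      ultimately show "peetre_weight 0 A 1 (w - z) \<le> 2 powr A * 2" unfolding peetre_weight_def
        by (auto intro!: mult_mono)
    qed
    have "ennreal (?b / peetre_weight 0 A 1 (w - z)) \<le> peetre_maximal_at \<psi> 0 A 1 f w"
      unfolding peetre_maximal_at_def by (rule SUP_upper2[of "w - z"]) auto
    then have "ennreal (?b / peetre_weight 0 A 1 (w - z)) ennpow r \<le> peetre_maximal_at \<psi> 0 A 1 f w ennpow r"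
      using r by (intro ennpow_mono) auto
    then have Q: "ennreal ((?b / peetre_weight 0 A 1 (w - z)) powr r) \<le> ennreal C0 * (ennreal Cs * (ennreal (1 + Ce * K0) * ?G))"
      using P wt(1) by (simp add: ennpow_ennreal)
    have "?b = peetre_weight 0 A 1 (w - z) * (?b / peetre_weight 0 A 1 (w - z))" using wt(1) by simp
    also have "\<dots> \<le> (2 powr A * 2) * (?b / peetre_weight 0 A 1 (w - z))" using wt by (intro mult_right_mono) auto
    finally have "?b powr r \<le> ((2 powr A * 2) * (?b / peetre_weight 0 A 1 (w - z))) powr r"
      using r by (intro powr_mono2) auto
    also have "\<dots> = (2 powr A * 2) powr r * (?b / peetre_weight 0 A 1 (w - z)) powr r"
      by (rule powr_mult)
    finally have "ennreal (?b powr r) \<le> ennreal ((2 powr A * 2) powr r) * ennreal ((?b / peetre_weight 0 A 1 (w - z)) powr r)"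
      by (simp add: ennreal_mult[symmetric] ennreal_leI)
    also have "\<dots> \<le> ennreal ((2 powr A * 2) powr r) * (ennreal C0 * (ennreal Cs * (ennreal (1 + Ce * K0) * ?G)))"
      using Q by (rule mult_left_mono) simp
    also have "\<dots> = ennreal c * ?G"
      unfolding c_def using C0 Cs
      by (simp only: ennreal_mult'[OF less_imp_le[OF C0]] ennreal_mult'[OF less_imp_le[OF Cs]] ennreal_mult'[OF powr_ge_zero] mult.assoc)
    finally show "ennreal (?b powr r) \<le> ennreal c * ?G" .
  qed
qed

lemma dist_conv_rescale:
  fixes u :: "real^'n \<Rightarrow> complex"
  shows "dist_conv (dyadic_dilation u j) (\<lambda>v. f (dyadic_dilation v l)) x = dist_conv (dyadic_dilation u (j + l)) f ((2 powi (- l)) *\<^sub>R x)"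
proof -
  have "dyadic_dilation (\<lambda>y. dyadic_dilation u j (x - y)) l = (\<lambda>y. dyadic_dilation u (j + l) ((2 powi (- l)) *\<^sub>R x - y))"
  proof
    fix y
    have 1: "(2 powi (j + l) :: real) = 2 powi j * 2 powi l" by (simp add: power_int_add)
    have 2: "(2 powi ((j + l) * int CARD('n)) :: real) = 2 powi (l * int CARD('n)) * 2 powi (j * int CARD('n))"
      by (simp add: power_int_add distrib_right)
    have 3: "(2 powi l :: real) * 2 powi (- l) = 1" by (simp add: power_int_minus)
    have "2 powi (j + l) *\<^sub>R ((2 powi (- l)) *\<^sub>R x - y) = 2 powi j *\<^sub>R (x - 2 powi l *\<^sub>R y)"
      unfolding 1 by (simp add: scaleR_right_diff_distrib mult.assoc 3)
    then show "dyadic_dilation (\<lambda>y. dyadic_dilation u j (x - y)) l y = dyadic_dilation u (j + l) ((2 powi (- l)) *\<^sub>R x - y)"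
      unfolding dyadic_dilation_def 2 by simp
  qed
  then show ?thesis unfolding dist_conv_def by simp
qed

lemma dist_conv_dilation_rescale:
  fixes u :: "real^'n \<Rightarrow> complex"
  assumes "0 < \<tau>"
  shows "dist_conv (dilation u \<tau>) (\<lambda>v. f (dyadic_dilation v (- l))) ((2 powi (- l)) *\<^sub>R y) = dist_conv (dilation u (2 powi l * \<tau>)) f y"
proof -
  have "dyadic_dilation (\<lambda>y'. dilation u \<tau> ((2 powi (- l)) *\<^sub>R y - y')) (- l) = (\<lambda>y'. dilation u (2 powi l * \<tau>) (y - y'))"
  proof
    fix y'
    have 1: "(2 powi (- l * int CARD('n)) :: real) = inverse ((2 powi l) ^ CARD('n))"
      by (simp add: power_int_minus power_int_mult)
    have "((2 powi (- l)) *\<^sub>R y - (2 powi (- l)) *\<^sub>R y') /\<^sub>R \<tau> = (y - y') /\<^sub>R (2 powi l * \<tau>)"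
      by (simp add: scaleR_right_diff_distrib[symmetric] power_int_minus)
    then show "dyadic_dilation (\<lambda>y'. dilation u \<tau> ((2 powi (- l)) *\<^sub>R y - y')) (- l) y' = dilation u (2 powi l * \<tau>) (y - y')"
      unfolding dyadic_dilation_def dilation_def 1 by (simp add: power_mult_distrib)
  qed
  then show ?thesis unfolding dist_conv_def by simp
qed

lemma radial_maximal_rescale:
  fixes \<psi> :: "real^'n \<Rightarrow> complex"
  shows "radial_maximal \<psi> (\<lambda>v. f (dyadic_dilation v l)) x = radial_maximal \<psi> f ((2 powi (- l)) *\<^sub>R x)"
  unfolding radial_maximal_def dist_conv_rescale
proof (rule SUP_eq)
  show "\<exists>j\<in>UNIV. ennreal (cmod (dist_conv (dyadic_dilation \<psi> (i + l)) f (2 powi - l *\<^sub>R x))) \<le> ennreal (cmod (dist_conv (dyadic_dilation \<psi> j) f (2 powi - l *\<^sub>R x)))" for i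
    by blast
  show "\<exists>i\<in>UNIV. ennreal (cmod (dist_conv (dyadic_dilation \<psi> j) f (2 powi - l *\<^sub>R x))) \<le> ennreal (cmod (dist_conv (dyadic_dilation \<psi> (i + l)) f (2 powi - l *\<^sub>R x)))" for j
    by (rule bexI[of _ "j - l"]) simp_all
qed

lemma radial_average_rescale:
  fixes \<psi> :: "real^'n \<Rightarrow> complex"
  assumes f: "f \<in> tempered_distributions" and \<psi>: "\<psi> \<in> schwartz"
  shows "radial_average \<psi> r (\<lambda>v. f (dyadic_dilation v l)) x = radial_average \<psi> r f ((2 powi (- l)) *\<^sub>R x)"
  unfolding radial_average_def radial_maximal_rescale
  by (rule maxop_rescale[OF radial_maximal_ennpow_measurable[OF f \<psi>]]) simp

text \<open>The unit scale bound for the dilate \<open>f(2\<^sup>-\<^sup>j \<cdot>)\<close>. Dilating \<open>f\<close> shifts the index in the radial maximal function, which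
  is a supremum over all \<open>j\<close>, so \<open>M(g\<^sup>r)\<close> is merely dilated and the constant is unchanged.\<close>
lemma nontangential_bound:
  fixes \<psi> :: "real^'n \<Rightarrow> complex"
  assumes unit: "\<And>f z w. f \<in> tempered_distributions \<Longrightarrow> dist z w \<le> 1 \<Longrightarrow>
     ennreal (cmod (dist_conv (dyadic_dilation \<psi> 0) f z) powr r) \<le> ennreal c * radial_average \<psi> r f w"
    and f: "f \<in> tempered_distributions" and \<psi>: "\<psi> \<in> schwartz" and zw: "dist z w < 2 powi (- j)"
  shows "ennreal (cmod (dist_conv (dyadic_dilation \<psi> j) f z) powr r) \<le> ennreal c * radial_average \<psi> r f w"
proof -
  let ?f = "\<lambda>v. f (dyadic_dilation v j)"
  have inv: "(2 powi j :: real) * 2 powi (- j) = 1" "(2 powi (- j) :: real) * 2 powi j = 1" by (simp_all add: power_int_minus)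
  have "dist ((2 powi j) *\<^sub>R z) ((2 powi j) *\<^sub>R w) = 2 powi j * dist z w"
    by (simp add: dist_norm scaleR_right_diff_distrib[symmetric])
  also have "\<dots> \<le> 2 powi j * 2 powi (- j)" using zw by (intro mult_left_mono) auto
  finally have d: "dist ((2 powi j) *\<^sub>R z) ((2 powi j) *\<^sub>R w) \<le> 1" unfolding inv .
  have "ennreal (cmod (dist_conv (dyadic_dilation \<psi> 0) ?f ((2 powi j) *\<^sub>R z)) powr r) \<le> ennreal c * radial_average \<psi> r ?f ((2 powi j) *\<^sub>R w)"
    by (rule unit[OF tempered_rescale[OF f] d])
  then show ?thesis
    unfolding dist_conv_rescale radial_average_rescale[OF f \<psi>] scaleR_scaleR inv by simp
qed

text \<open>Averaging over the ball of radius \<open>2\<^sup>-\<^sup>j\<close> costs the factor \<open>(1 + 2\<^sup>j|y|)\<^sup>n\<close>, which the weight absorbs as \<open>A r \<ge> n\<close>.\<close>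
lemma peetre_maximal_bound:
  fixes \<psi> :: "real^'n \<Rightarrow> complex"
  assumes nt: "\<And>j z w. dist z w < 2 powi (- j) \<Longrightarrow>
     ennreal (cmod (dist_conv (dyadic_dilation \<psi> j) f z) powr r) \<le> ennreal c * radial_average \<psi> r f w"
    and r: "0 < r" and A: "real CARD('n) / r \<le> A" and B: "0 \<le> B"
  shows "peetre_maximal \<psi> A B f x ennpow r \<le> ennreal c * maxop (radial_average \<psi> r f) x"
  unfolding ennpow_le_iff[OF r] peetre_maximal_def peetre_maximal_at_def
proof (intro SUP_least)
  fix j and y :: "real^'n"
  let ?b = "cmod (dist_conv (dyadic_dilation \<psi> j) f (x - y))" and ?W = "peetre_weight j A B y"
  let ?M = "maxop (radial_average \<psi> r f) x"
  let ?e = "1 + 2 powi j * norm y"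
  have \<rho>: "0 < (2 powi (- j) :: real)" by simp
  have e: "1 \<le> ?e" by simp
  have "ennreal (?b powr r) \<le> ennreal c * (ennreal ((1 + dist (x - y) x / 2 powi (- j)) ^ CARD('n)) * ?M)"
    by (rule maxop_peetre[OF _ \<rho> nt]) (simp_all add: radial_average_def)
  also have "1 + dist (x - y) x / 2 powi (- j) = ?e"
    by (simp add: dist_norm power_int_minus divide_inverse mult.commute)
  finally have b: "ennreal (?b powr r) \<le> ennreal c * (ennreal (?e ^ CARD('n)) * ?M)" .
  have W: "?e ^ CARD('n) \<le> ?W powr r"
  proof -
    have "real CARD('n) \<le> A * r" using A r by (simp add: field_simps)
    then have "?e powr real CARD('n) \<le> ?e powr (A * r)" using e by (intro powr_mono) auto
    moreover have "?e powr real CARD('n) = ?e ^ CARD('n)" using e by (intro powr_realpow) linarith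
    moreover have "?e powr (A * r) * 1 \<le> ?e powr (A * r) * (2 powr (B * norm y)) powr r"
      using B r by (intro mult_left_mono) (auto simp: powr_powr intro!: ge_one_powr_ge_zero)
    ultimately show ?thesis unfolding peetre_weight_def by (simp add: powr_mult powr_powr)
  qed
  have ep: "0 < ?e ^ CARD('n)" using e by (intro zero_less_power) linarith
  then have Wr: "0 < ?W powr r" using W by linarith
  have Wp: "0 \<le> ?W" unfolding peetre_weight_def by simp
  have "ennreal ((?b / ?W) powr r) = ennreal (1 / ?W powr r) * ennreal (?b powr r)"
    using Wp by (simp add: powr_divide ennreal_mult[symmetric])
  also have "\<dots> \<le> ennreal (1 / ?W powr r) * (ennreal c * (ennreal (?e ^ CARD('n)) * ?M))"
    using b by (rule mult_left_mono) simp
  also have "\<dots> = ennreal c * ((ennreal (1 / ?W powr r) * ennreal (?e ^ CARD('n))) * ?M)"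
    by (simp only: mult_ac)
  also have "\<dots> \<le> ennreal c * (1 * ?M)"
  proof (intro mult_left_mono mult_right_mono)
    have "1 / ?W powr r * ?e ^ CARD('n) \<le> 1" using W Wr by (simp add: divide_le_eq)
    then show "ennreal (1 / ?W powr r) * ennreal (?e ^ CARD('n)) \<le> 1"
      using ep by (simp add: ennreal_mult''[symmetric])
  qed auto
  finally have "ennreal (?b / ?W) ennpow r \<le> ennreal c * ?M"
    using Wp by (simp add: ennpow_ennreal)
  then show "ennreal (?b / ?W) \<le> (ennreal c * ?M) ennpow (1 / r)"
    unfolding ennpow_le_iff[OF r] .
qed

section \<open>The grand maximal function and the norm inequalities\<close>

lemma dilation_half_power:
  fixes u :: "real^'n \<Rightarrow> complex"
  shows "dilation u ((1/2) ^ j) = dyadic_dilation u (int j)"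
proof
  fix x
  have 1: "(2 powi (int j * int CARD('n)) :: real) = inverse (((1/2) ^ j) ^ CARD('n))"
    by (simp add: power_int_mult power_one_over)
  have 2: "inverse ((1/2 :: real) ^ j) = 2 powi (int j)" by (simp add: power_one_over)
  show "dilation u ((1/2) ^ j) x = dyadic_dilation u (int j) x"
    unfolding dilation_def dyadic_dilation_def 1 2 ..
qed

lemma dyadic_bracket_left:
  fixes t :: real
  assumes "0 < t"
  obtains l :: int and \<tau> where "t = 2 powi l * \<tau>" "1 \<le> \<tau>" "\<tau> < 2"
proof (rule that)
  let ?l = "\<lfloor>log 2 t\<rfloor>"
  have p: "0 < (2 powi ?l :: real)" by simp
  have "2 powr real_of_int ?l \<le> t" using assms by (subst le_log_iff[symmetric]) auto
  then have le: "2 powi ?l \<le> t" by (simp add: powr_real_of_int')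
  have "log 2 t < real_of_int (?l + 1)" by linarith
  then have "t < 2 powr real_of_int (?l + 1)" using assms by (simp only: log_less_iff one_less_numeral_iff semiring_norm)
  then have lt: "t < 2 powi ?l * 2" using powr_real_of_int'[of 2 "?l + 1"] by (simp add: power_int_add)
  show "t = 2 powi ?l * (t / 2 powi ?l)" by simp
  show "1 \<le> t / 2 powi ?l" using le p by (simp add: le_divide_eq)
  show "t / 2 powi ?l < 2" using lt p by (simp add: divide_less_eq mult.commute)
qed

lemma snorm_dilation:
  fixes u :: "real^'n \<Rightarrow> complex"
  assumes u: "u \<in> schwartz" and t: "1 \<le> \<tau>" "\<tau> < 2"
  shows "snorm k l (dilation u \<tau>) \<le> 3 ^ k * 2 ^ l * snorm k l u"
proof -
  have e: "dilation u \<tau> = (\<lambda>x. of_real (inverse (\<tau> ^ CARD('n))) * u (0 + inverse \<tau> *\<^sub>R x))"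
    by (simp add: dilation_def[abs_def])
  have S: "(\<lambda>x. u (0 + inverse \<tau> *\<^sub>R x)) \<in> schwartz" using t by (intro schwartz_affine u) auto
  have i1: "inverse \<tau> \<le> 1" "0 < inverse \<tau>" using t by (auto simp: inverse_le_1_iff)
  have "snorm k l (dilation u \<tau>) \<le> cmod (of_real (inverse (\<tau> ^ CARD('n)))) * snorm k l (\<lambda>x. u (0 + inverse \<tau> *\<^sub>R x))"
    unfolding e by (rule snorm_cmult[OF S])
  also have "\<dots> \<le> 1 * snorm k l (\<lambda>x. u (0 + inverse \<tau> *\<^sub>R x))"
  proof (rule mult_right_mono)
    have "1 \<le> \<tau> ^ CARD('n)" using t by simp
    then show "cmod (of_real (inverse (\<tau> ^ CARD('n)))) \<le> 1" unfolding norm_of_real by (simp add: inverse_le_1_iff)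
  qed simp
  also have "\<dots> \<le> (1 + norm (0 :: real^'n)) ^ k * (1 + \<bar>1 / inverse \<tau>\<bar>) ^ k * (1 + \<bar>inverse \<tau>\<bar>) ^ l * snorm k l u"
    unfolding mult_1 using i1 by (intro snorm_affine u) auto
  also have "\<dots> \<le> 3 ^ k * 2 ^ l * snorm k l u"
  proof -
    have i2: "\<bar>1 / inverse \<tau>\<bar> = \<tau>" using t by (simp add: inverse_eq_divide)
    have "(1 + \<tau>) ^ k \<le> 3 ^ k" "(1 + \<bar>inverse \<tau>\<bar>) ^ l \<le> 2 ^ l"
      using t i1 by (intro power_mono; simp)+
    then show ?thesis unfolding i2 by (intro mult_right_mono mult_mono) auto
  qed
  finally show ?thesis .
qed

text \<open>Write \<open>t = 2\<^sup>l \<tau>\<close> with \<open>1 \<le> \<tau> < 2\<close>. The dilation by \<open>2\<^sup>-\<^sup>l\<close> reduces to the unit scale, and the remaining dilation by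
  \<open>\<tau>\<close> changes the seminorms of a test function of the class only by a constant.\<close>
lemma grand_maximal_bound:
  fixes \<psi> :: "real^'n \<Rightarrow> complex" and m :: nat
  assumes nt: "\<And>f j z w. f \<in> tempered_distributions \<Longrightarrow> dist z w < 2 powi (- j) \<Longrightarrow>
     ennreal (cmod (dist_conv (dyadic_dilation \<psi> j) f z) powr r) \<le> ennreal c * radial_average \<psi> r f w"
    and c: "0 < c" and \<psi>: "\<psi> \<in> schwartz" and I: "(LINT x|lborel. \<psi> x) \<noteq> 0"
    and r: "0 < r" "r < 1" and m: "real CARD('n) / r - real CARD('n) < real m + 1"
  shows "\<exists>C>0. \<forall>f\<in>tempered_distributions. \<forall>x.
    grand_maximal_of_order m f x ennpow r \<le> ennreal C * maxop (radial_average \<psi> r f) x"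
proof -
  \<comment> \<open>Normalising the integral to \<open>1\<close> changes the constants only by a power of \<open>|a|\<close>.\<close>
  define a where "a = inverse (LINT x|lborel. \<psi> x)"
  define \<phi> where "\<phi> = (\<lambda>x. a * \<psi> x)"
  have a: "0 < cmod a" unfolding a_def using I by simp
  have \<phi>: "\<phi> \<in> schwartz" unfolding \<phi>_def by (rule schwartz_cmult[OF \<psi>])
  interpret approximate_identity \<phi>
  proof
    show "(LINT w|lborel. \<phi> w) = 1" unfolding \<phi>_def a_def using I by simp
  qed (rule \<phi>)
  define c1 where "c1 = cmod a powr r * c"
  have c1: "0 < c1" unfolding c1_def using a c by simp
  define K where "K = (m + 2) * (CARD('n) + 1)"
  define S :: real where "S = 3 ^ K * 2 ^ (m + 1)"
  have S: "0 < S" unfolding S_def by simp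
  obtain C where C: "0 < C" and loc: "\<And>f G u x y. f \<in> tempered_distributions \<Longrightarrow> G \<in> borel_measurable lebesgue \<Longrightarrow>
    (\<forall>j::nat. \<forall>z w. dist z w < (1/2) ^ j \<longrightarrow>
       ennreal (cmod (dist_conv (dilation \<phi> ((1/2) ^ j)) f z) powr r) \<le> ennreal c1 * G w) \<Longrightarrow>
    u \<in> schwartz \<Longrightarrow> snorm K (m + 1) u \<le> S \<Longrightarrow> dist x y < 2 \<Longrightarrow>
    ennreal (cmod (dist_conv u f y) powr r) \<le> ennreal C * maxop G x"
    using local_maximal_bound[OF r m c1 S] unfolding K_def by blast
  have H: "ennreal (cmod (dist_conv (dilation \<phi> ((1/2) ^ j)) f z) powr r) \<le> ennreal c1 * radial_average \<psi> r f w"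
    if f: "f \<in> tempered_distributions" and zw: "dist z w < (1/2) ^ j" for f and j :: nat and z w
  proof -
    let ?u = "\<lambda>y. dyadic_dilation \<psi> (int j) (z - y)"
    have uS: "?u \<in> schwartz" by (intro schwartz_reflect schwartz_dyadic_dilation \<psi>)
    have "dilation \<phi> ((1/2) ^ j) = (\<lambda>x. a * dyadic_dilation \<psi> (int j) x)"
      unfolding dilation_half_power \<phi>_def by (simp add: dyadic_dilation_def[abs_def] mult_ac)
    then have "dist_conv (dilation \<phi> ((1/2) ^ j)) f z = f (\<lambda>y. a * ?u y + 0 * ?u y)"
      unfolding dist_conv_def by simp
    also have "\<dots> = a * dist_conv (dyadic_dilation \<psi> (int j)) f z"
      unfolding tempered_lincomb[OF f uS uS] dist_conv_def by simp
    finally have "cmod (dist_conv (dilation \<phi> ((1/2) ^ j)) f z) powr r = cmod a powr r * cmod (dist_conv (dyadic_dilation \<psi> (int j)) f z) powr r"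
      by (simp add: norm_mult powr_mult)
    then have "ennreal (cmod (dist_conv (dilation \<phi> ((1/2) ^ j)) f z) powr r) = ennreal (cmod a powr r) * ennreal (cmod (dist_conv (dyadic_dilation \<psi> (int j)) f z) powr r)"
      by (simp add: ennreal_mult)
    also have "\<dots> \<le> ennreal (cmod a powr r) * (ennreal c * radial_average \<psi> r f w)"
      using zw by (intro mult_left_mono nt f) (auto simp: power_one_over power_int_minus inverse_eq_divide)
    also have "\<dots> = ennreal c1 * radial_average \<psi> r f w"
      unfolding c1_def ennreal_mult'[OF powr_ge_zero] mult.assoc ..
    finally show ?thesis .
  qed
  show ?thesis
  proof (intro exI[of _ C] conjI ballI allI C)
    fix f :: "(real^'n \<Rightarrow> complex) \<Rightarrow> complex" and x :: "real^'n"
    assume f: "f \<in> tempered_distributions"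
    show "grand_maximal_of_order m f x ennpow r \<le> ennreal C * maxop (radial_average \<psi> r f) x"
      unfolding ennpow_le_iff[OF r(1)] grand_maximal_of_order_def
    proof (intro SUP_least, clarify)
      fix \<zeta> :: "real^'n \<Rightarrow> complex" and y :: "real^'n" and t :: real
      assume \<zeta>: "\<zeta> \<in> schwartz_class m" and t: "0 < t" and yx: "norm (y - x) < t"
      have \<zeta>S: "\<zeta> \<in> schwartz" and \<zeta>n: "snorm K (m + 1) \<zeta> \<le> 1"
        using \<zeta> seminorm_eq_snorm[of \<zeta> K "m + 1"] unfolding schwartz_class_def K_def by auto
      obtain l :: int and \<tau> where l: "t = 2 powi l * \<tau>" and \<tau>: "1 \<le> \<tau>" "\<tau> < 2"
        using dyadic_bracket_left[OF t] by blast
      let ?b = "2 powi (- l) :: real"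
      let ?f = "\<lambda>v. f (dyadic_dilation v (- l))"
      have inv: "?b * 2 powi l = 1" "2 powi l * ?b = 1" by (simp_all add: power_int_minus)
      have f': "?f \<in> tempered_distributions" by (rule tempered_rescale[OF f])
      have RA: "radial_average \<psi> r ?f = (\<lambda>x. radial_average \<psi> r f ((2 powi l) *\<^sub>R x))"
        using radial_average_rescale[OF f \<psi>, of r "- l"] by auto
      have RAm: "radial_average \<psi> r f' \<in> borel_measurable lebesgue" for f' :: "(real^'n \<Rightarrow> complex) \<Rightarrow> complex"
        unfolding radial_average_def by (rule maxop_measurable)
      have "ennreal (cmod (dist_conv (dilation \<zeta> \<tau>) ?f (?b *\<^sub>R y)) powr r) \<le> ennreal C * maxop (radial_average \<psi> r ?f) (?b *\<^sub>R x)"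
      proof (rule loc[OF f' RAm])
        show "\<forall>j::nat. \<forall>z w. dist z w < (1/2) ^ j \<longrightarrow>
           ennreal (cmod (dist_conv (dilation \<phi> ((1/2) ^ j)) ?f z) powr r) \<le> ennreal c1 * radial_average \<psi> r ?f w"
          using H[OF f'] by blast
        show "dilation \<zeta> \<tau> \<in> schwartz" using \<tau> by (intro schwartz_dilation \<zeta>S) auto
        have "snorm K (m + 1) (dilation \<zeta> \<tau>) \<le> S * snorm K (m + 1) \<zeta>"
          unfolding S_def by (rule snorm_dilation[OF \<zeta>S \<tau>])
        also have "\<dots> \<le> S * 1" using \<zeta>n S by (intro mult_left_mono) auto
        finally show "snorm K (m + 1) (dilation \<zeta> \<tau>) \<le> S" by simp
        have "dist (?b *\<^sub>R x) (?b *\<^sub>R y) = ?b * norm (y - x)"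
          by (simp add: dist_norm scaleR_right_diff_distrib[symmetric] norm_minus_commute)
        also have "\<dots> < ?b * t" using yx by (intro mult_strict_left_mono) auto
        also have "?b * t = \<tau>" unfolding l by (simp add: mult.assoc[symmetric] inv)
        finally show "dist (?b *\<^sub>R x) (?b *\<^sub>R y) < 2" using \<tau> by linarith
      qed
      also have "maxop (radial_average \<psi> r ?f) (?b *\<^sub>R x) = maxop (radial_average \<psi> r f) x"
        unfolding RA by (subst maxop_rescale[OF RAm]) (simp_all add: inv)
      also have "dist_conv (dilation \<zeta> \<tau>) ?f (?b *\<^sub>R y) = dist_conv (dilation \<zeta> t) f y"
        unfolding l using \<tau> by (intro dist_conv_dilation_rescale) simp
      finally have "ennreal (cmod (dist_conv (dilation \<zeta> t) f y)) ennpow r \<le> ennreal C * maxop (radial_average \<psi> r f) x"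
        by (simp add: ennpow_ennreal)
      then show "ennreal (cmod (dist_conv (dilation \<zeta> t) f y)) \<le> (ennreal C * maxop (radial_average \<psi> r f) x) ennpow (1 / r)"
        unfolding ennpow_le_iff[OF r(1)] .
    qed
  qed
qed

theorem theorem3p6:
  fixes \<phi> :: "real^'n \<Rightarrow> real \<Rightarrow> real"
    and \<psi>\<^sub>0 :: "real^'n \<Rightarrow> complex"
    and R A\<^sub>0 B\<^sub>0 A\<^sub>1 B\<^sub>1 A B :: real
    and N\<^sub>0 N :: int
  assumes "growth_function \<phi>"
    and "R > 0"
    and "\<psi>\<^sub>0 \<in> test_functions"
    and "(LINT x|lebesgue. \<psi>\<^sub>0 x) \<noteq> 0"
    and "admissible_A0 (supp \<psi>\<^sub>0) A\<^sub>0"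
    and "admissible_B0 \<phi> B\<^sub>0"
    and "A\<^sub>1 = max A\<^sub>0 (real CARD('n) * critical_weight_index \<phi> / critical_lower_type_index \<phi>)"
    and "B\<^sub>1 = B\<^sub>0 / critical_lower_type_index \<phi>"
    and "N\<^sub>0 = \<lfloor>2 * A\<^sub>1\<rfloor> + 1"
    and "A > A\<^sub>1"
    and "B > B\<^sub>1"
    and "N \<ge> N\<^sub>0"
  shows "\<exists>C>0. \<forall>f\<in>tempered_distributions.
           musielak_orlicz_norm \<phi> (peetre_maximal \<psi>\<^sub>0 A B f) \<le>
             ennreal C * musielak_orlicz_norm \<phi> (radial_maximal \<psi>\<^sub>0 f) \<and>
           musielak_orlicz_norm \<phi> (grand_maximal \<phi> f) \<le>
             ennreal C * musielak_orlicz_norm \<phi> (radial_maximal \<psi>\<^sub>0 f)"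
proof -
  have \<psi>S: "\<psi>\<^sub>0 \<in> schwartz" by (rule test_functions_subset_schwartz[OF assms(3)])
  have I: "(LINT x|lborel. \<psi>\<^sub>0 x) \<noteq> 0"
    using assms(4) integral_completion[of \<psi>\<^sub>0 lborel] schwartz_measurable[OF \<psi>S] by simp
  have "real CARD('n) * critical_weight_index \<phi> / critical_lower_type_index \<phi> < A"
    using assms(7,10) by simp
  from exponent_choice[OF assms(1) this] obtain r p q where r: "0 < r" "r < 1"
    and p: "0 < p" "uniformly_lower_type \<phi> p" and q: "1 \<le> q" "muckenhoupt \<phi> q" "q < p / r"
    and rA: "real CARD('n) / r \<le> A" and rm: "real CARD('n) / r - real CARD('n) < real (critical_order \<phi>) + 1" .
  have "0 < B\<^sub>1"
    using assms(6,8) growth_indices(3)[OF assms(1)] unfolding admissible_B0_def by simp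
  then have B: "0 \<le> B" using assms(11) by simp
  obtain c where c: "0 < c" and unit: "\<And>f z w. f \<in> tempered_distributions \<Longrightarrow> dist z w \<le> 1 \<Longrightarrow>
     ennreal (cmod (dist_conv (dyadic_dilation \<psi>\<^sub>0 0) f z) powr r) \<le> ennreal c * radial_average \<psi>\<^sub>0 r f w"
    using unit_scale_nontangential_bound[OF assms(3,4,5) r(1)] by blast
  have nt: "ennreal (cmod (dist_conv (dyadic_dilation \<psi>\<^sub>0 j) f z) powr r) \<le> ennreal c * radial_average \<psi>\<^sub>0 r f w"
    if "f \<in> tempered_distributions" "dist z w < 2 powi (- j)" for f j z w
    by (rule nontangential_bound) (fact unit that \<psi>S)+
  obtain C2 where C2: "0 < C2" "\<And>f x. f \<in> tempered_distributions \<Longrightarrow>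
     grand_maximal_of_order (critical_order \<phi>) f x ennpow r \<le> ennreal C2 * maxop (radial_average \<psi>\<^sub>0 r f) x"
    using grand_maximal_bound[OF nt c \<psi>S I r rm] by blast
  define C where "C = max c C2"
  have C: "0 < C" unfolding C_def using c by simp
  obtain K where K: "0 < K" and norm: "\<And>T g. g \<in> borel_measurable lebesgue \<Longrightarrow>
     (\<And>x. T x ennpow r \<le> ennreal C * maxop (maxop (\<lambda>x. g x ennpow r)) x) \<Longrightarrow>
     musielak_orlicz_norm \<phi> T \<le> ennreal K * musielak_orlicz_norm \<phi> g"
    using musielak_norm_maxop[OF assms(1) p(2,1) q(1,2) r(1) q(3) C] by blast
  show ?thesis
  proof (intro exI[of _ K] conjI ballI K)
    fix f :: "(real^'n \<Rightarrow> complex) \<Rightarrow> complex" assume f: "f \<in> tempered_distributions"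
    have gm: "radial_maximal \<psi>\<^sub>0 f \<in> borel_measurable lebesgue" by (rule radial_maximal_measurable[OF f \<psi>S])
    have le: "ennreal c * M \<le> ennreal C * M" "ennreal C2 * M \<le> ennreal C * M" for M
      unfolding C_def by (intro mult_right_mono ennreal_leI; simp)+
    show "musielak_orlicz_norm \<phi> (peetre_maximal \<psi>\<^sub>0 A B f) \<le> ennreal K * musielak_orlicz_norm \<phi> (radial_maximal \<psi>\<^sub>0 f)"
    proof (rule norm[OF gm])
      fix x
      have "peetre_maximal \<psi>\<^sub>0 A B f x ennpow r \<le> ennreal c * maxop (radial_average \<psi>\<^sub>0 r f) x"
        by (rule peetre_maximal_bound[OF nt[OF f] r(1) rA B])
      then show "peetre_maximal \<psi>\<^sub>0 A B f x ennpow r \<le> ennreal C * maxop (maxop (\<lambda>x. radial_maximal \<psi>\<^sub>0 f x ennpow r)) x"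
        unfolding radial_average_def using le(1) order_trans by blast
    qed
    show "musielak_orlicz_norm \<phi> (grand_maximal \<phi> f) \<le> ennreal K * musielak_orlicz_norm \<phi> (radial_maximal \<psi>\<^sub>0 f)"
    proof (rule norm[OF gm])
      fix x
      show "grand_maximal \<phi> f x ennpow r \<le> ennreal C * maxop (maxop (\<lambda>x. radial_maximal \<psi>\<^sub>0 f x ennpow r)) x"
        using C2(2)[OF f, of x] le(2) order_trans unfolding radial_average_def grand_maximal_def by blast
    qed
  qed
qed

end
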